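(* Let $k\in\mathbb{Z}_+$, $\lambda\in\mathbb{R}_+$ and $a\in L_\infty^{\{0,+\infty\}}(\mathbb{R}_+)$. For $x\in(0,1)$ put $$\nabla_{a,\lambda}^{(k)}(x)=-\frac{1}{\lambda}\ln(1-x)\int_{\mathbb{R}_+}a(v)(1-x)^{v/\lambda}L_k^2\!\left(-\frac{v}{\lambda}\ln(1-x)\right)\mathrm{d}v,$$ extended to $[0,1]$ by continuity. Then, in the sense of the continuous functional calculus for the self-adjoint operator $T_{\chi_{[0,\lambda]}}^{(0)}$ (whose spectrum is $[0,1]$), $$\nabla_{a,\lambda}^{(k)}\big(T_{\chi_{[0,\lambda]}}^{(0)}\big)=T_a^{(k)}.$$
   Context: Let $G=\{(u,v):u\in\mathbb{R},\ v>0\}$ with $\mathrm{d}\nu=v^{-2}\,\mathrm{d}u\,\mathrm{d}v$; $\mathbb{R}_+=(0,\infty)$, $\mathbb{Z}_+=\{0,1,2,\dots\}$, $\chi_+$ the indicator of $(0,\infty)$, $\chi_{[0,\lambda]}$ the indicator of $[0,\lambda]$; $\hat g(\xi)=\int_{\mathbb{R}}g(x)e^{-2\pi i x\xi}\,\mathrm{d}x$. $L_k(x)=\sum_{i=0}^k(-1)^i\binom{k}{i}\frac{x^i}{i!}$, $\ell_k(x)=e^{-x/2}L_k(x)$. $\psi^{(k)}$ is given by $\hat\psi^{(k)}(\xi)=\chi_+(\xi)\sqrt{2\xi}\,\ell_k(2\xi)$; $H_2^+(\mathbb{R})=\{h\in L_2(\mathbb{R}):\operatorname{supp}\hat h\subseteq[0,\infty)\}$;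 $(\rho_{(u,v)}\psi)(x)=v^{-1/2}\psi((x-u)/v)$. $A^{(k)}=\{(u,v)\mapsto\langle f,\rho_{(u,v)}\psi^{(k)}\rangle_{L_2(\mathbb{R})}:f\in H_2^+(\mathbb{R})\}\subset L_2(G,\mathrm{d}\nu)$, $P^{(k)}$ the orthogonal projection onto it; for bounded measurable $a$ on $G$, $T_a^{(k)}F=P^{(k)}(aF)$, $F\in A^{(k)}$. A function $a$ on $\mathbb{R}_+$ is regarded as the symbol $(u,v)\mapsto a(v)$ on $G$. $L_\infty^{\{0,+\infty\}}(\mathbb{R}_+)$ is the algebra of bounded functions on $\mathbb{R}_+$ having limits at $0$ and at $+\infty$. The identity asserts in particular that $T_a^{(k)}$ (on $A^{(k)}$) and $T_{\chi_{[0,\lambda]}}^{(0)}$ (on $A^{(0)}$) are related through the natural unitary identifications $A^{(k)}\cong L_2(\mathbb{R}_+)\cong A^{(0)}$ given by $(R_jF)(\xi)=\sqrt{2\xi}\int_{\mathbb{R}\times\mathbb{R}_+}F(u,v)\ell_j(2v\xi)e^{-2\pi i\xi u}\,\frac{\mathrm{d}u\,\mathrm{d}v}{v}$, $j=k,0$. *)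

theory Defs
  imports "HOL-Analysis.Analysis" "HOL-Computational_Algebra.Polynomial"
begin

definition laguerre :: "nat \<Rightarrow> real \<Rightarrow> real" where
  "laguerre k x = (\<Sum>i\<le>k. (-1)^i * real (k choose i) * x^i / fact i)"

definition ell :: "nat \<Rightarrow> real \<Rightarrow> real" where
  "ell k x = exp (- x / 2) * laguerre k x"

(* The upper half-plane G = R x R_+ with measure d nu = v^-2 du dv
   (points of G are pairs (u,v); the measure vanishes off v > 0) *)
definition nuG :: "(real \<times> real) measure" where
  "nuG = density lborel (\<lambda>z. if snd z > 0 then ennreal (1 / (snd z)^2) else 0)"

definition innerG :: "(real \<times> real \<Rightarrow> complex) \<Rightarrow> (real \<times> real \<Rightarrow> complex) \<Rightarrow> complex" where
  "innerG F H = (\<integral>z. F z * cnj (H z) \<partial>nuG)"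

definition sqnormG :: "(real \<times> real \<Rightarrow> complex) \<Rightarrow> ennreal" where
  "sqnormG F = (\<integral>\<^sup>+ z. ennreal ((cmod (F z))^2) \<partial>nuG)"

definition L2R :: "(real \<Rightarrow> complex) \<Rightarrow> bool" where
  "L2R h \<longleftrightarrow> h \<in> borel_measurable lborel \<and> (\<integral>\<^sup>+ x. ennreal ((cmod (h x))^2) \<partial>lborel) < \<infinity>"

definition L2Rpos :: "(real \<Rightarrow> complex) \<Rightarrow> bool" where
  "L2Rpos h \<longleftrightarrow> h \<in> borel_measurable lborel \<and>
     (\<integral>\<^sup>+ x. ennreal (indicator {0<..} x * (cmod (h x))^2) \<partial>lborel) < \<infinity>"

definition fourierL2 :: "(real \<Rightarrow> complex) \<Rightarrow> (real \<Rightarrow> complex) \<Rightarrow> bool" where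
  "fourierL2 h g \<longleftrightarrow> L2R g \<and>
     ((\<lambda>N::nat. \<integral>\<^sup>+ \<xi>. ennreal ((cmod (g \<xi> -
         (LINT x:{- real N..real N}|lborel. h x * cis (- 2 * pi * x * \<xi>))))^2) \<partial>lborel)
       \<longlonglongrightarrow> 0)"

definition H2plus :: "(real \<Rightarrow> complex) \<Rightarrow> bool" where
  "H2plus h \<longleftrightarrow> L2R h \<and> (\<exists>g. fourierL2 h g \<and> (AE \<xi> in lborel. \<xi> < 0 \<longrightarrow> g \<xi> = 0))"

(* psi^(k), given through its Fourier transform
   hat psi(xi) = chi_+(xi) sqrt(2 xi) ell_k(2 xi) (an L1 \<inter> L2 function),
   i.e. psi is the inverse Fourier transform of it *)
definition psi :: "nat \<Rightarrow> real \<Rightarrow> complex" where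
  "psi k x = (LINT \<xi>:{0<..}|lborel.
      complex_of_real (sqrt (2 * \<xi>) * ell k (2 * \<xi>)) * cis (2 * pi * x * \<xi>))"

definition rho :: "real \<times> real \<Rightarrow> (real \<Rightarrow> complex) \<Rightarrow> real \<Rightarrow> complex" where
  "rho z f x = complex_of_real (1 / sqrt (snd z)) * f ((x - fst z) / snd z)"

definition Aspace :: "nat \<Rightarrow> (real \<times> real \<Rightarrow> complex) set" where
  "Aspace k = {(\<lambda>z. (LINT x|lborel. f x * cnj (rho z (psi k) x))) | f. H2plus f}"

definition projA :: "(real \<times> real \<Rightarrow> complex) set \<Rightarrow> (real \<times> real \<Rightarrow> complex) \<Rightarrow> (real \<times> real \<Rightarrow> complex)" where
  "projA A F = (SOME G. G \<in> A \<and> (\<forall>H\<in>A. innerG (\<lambda>z. F z - G z) H = 0))"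

definition toep :: "(real \<Rightarrow> complex) \<Rightarrow> nat \<Rightarrow> (real \<times> real \<Rightarrow> complex) \<Rightarrow> (real \<times> real \<Rightarrow> complex)" where
  "toep a k F = projA (Aspace k) (\<lambda>z. a (snd z) * F z)"

definition op_poly :: "complex poly \<Rightarrow> (('b \<Rightarrow> complex) \<Rightarrow> ('b \<Rightarrow> complex)) \<Rightarrow> ('b \<Rightarrow> complex) \<Rightarrow> ('b \<Rightarrow> complex)" where
  "op_poly p T F = (\<lambda>z. \<Sum>i\<le>degree p. coeff p i * (T ^^ i) F z)"

(* the natural unitary identification L2(R_+) \<rightarrow> A^(j), inverse of R_j:
   (W_j phi)(u,v) = v \<integral>_0^\<infinity> phi(xi) sqrt(2 xi) ell_j(2 v xi) e^{2 pi i xi u} d xi *)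
definition Wmap :: "nat \<Rightarrow> (real \<Rightarrow> complex) \<Rightarrow> (real \<times> real \<Rightarrow> complex)" where
  "Wmap j \<phi> = (\<lambda>z. complex_of_real (snd z) * (LINT \<xi>:{0<..}|lborel.
      \<phi> \<xi> * complex_of_real (sqrt (2 * \<xi>) * ell j (2 * snd z * \<xi>)) * cis (2 * pi * \<xi> * fst z)))"

definition nabla :: "(real \<Rightarrow> complex) \<Rightarrow> real \<Rightarrow> nat \<Rightarrow> real \<Rightarrow> complex" where
  "nabla a lam k x = complex_of_real (- (1 / lam) * ln (1 - x)) *
     (LINT v:{0<..}|lborel. a v * complex_of_real ((1 - x) powr (v / lam) *
        (laguerre k (- (v / lam) * ln (1 - x)))^2))"

definition Linf0inf :: "(real \<Rightarrow> complex) \<Rightarrow> bool" where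
  "Linf0inf a \<longleftrightarrow> a \<in> borel_measurable lborel \<and> bounded (a ` {0<..}) \<and>
     (\<exists>l. (a \<longlongrightarrow> l) (at_right 0)) \<and> (\<exists>l. (a \<longlongrightarrow> l) at_top)"

end

(* Under the identifications A^(k) = L2(R_+) = A^(0) a Toeplitz operator whose symbol depends on v only
   becomes multiplication by the function
     xi |-> int_0^oo a(v) 2 xi ell_k(2 v xi)^2 dv,
   because Plancherel in u turns the inner product of A^(k) into a weighted integral over (v, xi).
   For k = 0 and a = chi_[0,lam] this function is x(xi) = 1 - exp(-2 lam xi), which runs through (0,1);
   substituting x(xi) into the nabla function of a reproduces the function attached to a and k.
   Hence a polynomial p applied to the first operator is multiplication by p(x(xi)), and uniform
   convergence on [0,1] gives convergence in norm.

   Plancherel on L1 and L2 is obtained by damping with a Gaussian, which replaces the pairing of two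
   Fourier transforms by the convolution with an approximate identity: this gives the contraction
   inequality for all functions and the exact identity against compactly supported continuous ones,
   which are dense. *)

theory Submission
  imports Defs "HOL-Probability.Probability"
begin

section \<open>L2 over an arbitrary measure: inner product, continuity, completeness\<close>

section \<open>Square-integrable functions\<close>

text \<open>Since \<open>Aspace\<close> is defined by wavelet transforms of functions in
  \<open>H2plus\<close>, the half-line picture has to be entered through the Fourier transform on
  L2, which \<open>fourierL2\<close> gives only as a relation. The adjoint formula and the L2 bound
  show that every element of \<open>Aspace\<close> is some \<open>Wmap k g\<close>. The converse,
  that every \<open>Wmap k \<phi>\<close> occurs, requires each square-integrable function to be a
  Fourier transform, and this is where completeness of L2 enters. The converse matters because
  \<open>projA\<close> is a choice: it has the expected properties only once an element with
  orthogonal remainder has been exhibited, and the half-line description supplies one explicitly.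
  Elements of \<open>Aspace\<close> are genuine functions on the plane and are controlled only where
  v > 0. Statements about operators are therefore made pointwise for v > 0 or almost everywhere for
  \<open>nuG\<close>. The normalization behind everything is int_0^oo ell_k(t)^2 dt = 1: for each
  \<xi> > 0 the weight in v is then a probability density, so \<open>Wmap k\<close> is isometric and
  the multiplier is an average of a.\<close>

definition square_integrable :: "'a measure \<Rightarrow> ('a \<Rightarrow> complex) \<Rightarrow> bool" where
  "square_integrable M f \<longleftrightarrow> f \<in> borel_measurable M \<and> integrable M (\<lambda>x. (cmod (f x))\<^sup>2)"

definition sqn :: "'a measure \<Rightarrow> ('a \<Rightarrow> complex) \<Rightarrow> real" where
  "sqn M f = (\<integral>x. (cmod (f x))\<^sup>2 \<partial>M)"

definition ip :: "'a measure \<Rightarrow> ('a \<Rightarrow> complex) \<Rightarrow> ('a \<Rightarrow> complex) \<Rightarrow> complex" where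
  "ip M f g = (\<integral>x. f x * cnj (g x) \<partial>M)"

lemma square_integrable_measurable:
  "square_integrable M f \<Longrightarrow> f \<in> borel_measurable M"
  by (simp add: square_integrable_def)

lemma square_integrable_iff_nn:
  "square_integrable M f \<longleftrightarrow>
     f \<in> borel_measurable M \<and> (\<integral>\<^sup>+x. ennreal ((cmod (f x))\<^sup>2) \<partial>M) < \<infinity>"
  by (auto simp: square_integrable_def integrable_iff_bounded)

lemma nn_sqn: "square_integrable M f \<Longrightarrow> (\<integral>\<^sup>+x. ennreal ((cmod (f x))\<^sup>2) \<partial>M) = ennreal (sqn M f)"
  unfolding square_integrable_def sqn_def by (subst nn_integral_eq_integral) auto

lemma sqn_nonneg [simp]: "0 \<le> sqn M f"
  by (simp add: sqn_def)

lemma sqn_diff_commute: "sqn M (\<lambda>x. f x - g x) = sqn M (\<lambda>x. g x - f x)"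
  by (simp add: sqn_def norm_minus_commute)

lemma square_integrable_bound:
  assumes "square_integrable M f" "g \<in> borel_measurable M"
    and "AE x in M. cmod (g x) \<le> C * cmod (f x)"
  shows "square_integrable M g"
  unfolding square_integrable_def
proof
  show "g \<in> borel_measurable M" by fact
  show "integrable M (\<lambda>x. (cmod (g x))\<^sup>2)"
  proof (rule Bochner_Integration.integrable_bound)
    show "integrable M (\<lambda>x. C\<^sup>2 * (cmod (f x))\<^sup>2)"
      using assms(1) by (simp add: square_integrable_def)
    show "AE x in M. norm ((cmod (g x))\<^sup>2) \<le> norm (C\<^sup>2 * (cmod (f x))\<^sup>2)"
      using assms(3)
    proof eventually_elim
      case (elim x)
      then have "(cmod (g x))\<^sup>2 \<le> (C * cmod (f x))\<^sup>2" by (rule power_mono) simp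
      then show ?case by (simp add: power_mult_distrib)
    qed
  qed (use assms(2) in measurable)
qed

lemma square_integrable_mult:
  assumes f: "square_integrable M f" and g: "square_integrable M g"
  shows "integrable M (\<lambda>x. f x * g x)"
proof (rule Bochner_Integration.integrable_bound)
  note [measurable] = square_integrable_measurable[OF f] square_integrable_measurable[OF g]
  show "integrable M (\<lambda>x. (cmod (f x))\<^sup>2 + (cmod (g x))\<^sup>2)"
    using f g by (simp add: square_integrable_def)
  show "(\<lambda>x. f x * g x) \<in> borel_measurable M" by measurable
  show "AE x in M. norm (f x * g x) \<le> norm ((cmod (f x))\<^sup>2 + (cmod (g x))\<^sup>2)"
  proof (rule AE_I2)
    fix x
    have "0 \<le> cmod (f x) * cmod (g x)" "2 * (cmod (f x) * cmod (g x)) \<le> (cmod (f x))\<^sup>2 + (cmod (g x))\<^sup>2"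
      using sum_squares_bound[of "cmod (f x)" "cmod (g x)"] by auto
    then show "norm (f x * g x) \<le> norm ((cmod (f x))\<^sup>2 + (cmod (g x))\<^sup>2)"
      unfolding norm_mult real_norm_def by linarith
  qed
qed

lemma square_integrable_cnj:
  "square_integrable M g \<Longrightarrow> square_integrable M (\<lambda>x. cnj (g x))"
  unfolding square_integrable_def
  by (auto intro: measurable_compose[OF _ borel_measurable_continuous_onI] continuous_intros)

lemma square_integrable_ip:
  "square_integrable M f \<Longrightarrow> square_integrable M g \<Longrightarrow> integrable M (\<lambda>x. f x * cnj (g x))"
  by (rule square_integrable_mult[OF _ square_integrable_cnj])

lemma square_integrable_add:
  assumes f: "square_integrable M f" and g: "square_integrable M g"
  shows "square_integrable M (\<lambda>x. f x + g x)"
  unfolding square_integrable_def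
proof
  note [measurable] = square_integrable_measurable[OF f] square_integrable_measurable[OF g]
  show "(\<lambda>x. f x + g x) \<in> borel_measurable M" by measurable
  show "integrable M (\<lambda>x. (cmod (f x + g x))\<^sup>2)"
  proof (rule Bochner_Integration.integrable_bound)
    show "integrable M (\<lambda>x. 2 * (cmod (f x))\<^sup>2 + 2 * (cmod (g x))\<^sup>2)"
      using f g by (simp add: square_integrable_def)
    show "AE x in M. norm ((cmod (f x + g x))\<^sup>2) \<le> norm (2 * (cmod (f x))\<^sup>2 + 2 * (cmod (g x))\<^sup>2)"
    proof (rule AE_I2)
      fix x
      have "(cmod (f x + g x))\<^sup>2 \<le> (cmod (f x) + cmod (g x))\<^sup>2"
        by (intro power_mono norm_triangle_ineq) simp
      also have "\<dots> \<le> 2 * (cmod (f x))\<^sup>2 + 2 * (cmod (g x))\<^sup>2"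
        using sum_squares_bound[of "cmod (f x)" "cmod (g x)"] by (simp add: power2_sum)
      finally show "norm ((cmod (f x + g x))\<^sup>2) \<le> norm (2 * (cmod (f x))\<^sup>2 + 2 * (cmod (g x))\<^sup>2)"
        by simp
    qed
  qed measurable
qed

lemma square_integrable_cmult:
  assumes f: "square_integrable M f" shows "square_integrable M (\<lambda>x. c * f x)"
proof -
  note [measurable] = square_integrable_measurable[OF f]
  show ?thesis
    by (rule square_integrable_bound[OF f, where C="cmod c"]) (auto simp: norm_mult)
qed

lemma square_integrable_diff:
  assumes f: "square_integrable M f" and g: "square_integrable M g"
  shows "square_integrable M (\<lambda>x. f x - g x)"
  using square_integrable_add[OF f square_integrable_cmult[OF g, of "-1"]] by simp

lemma ip_cnj: "cnj (ip M f g) = ip M g f"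
  unfolding ip_def by (subst Bochner_Integration.integral_cnj[symmetric]) (simp add: mult.commute)

lemma ip_self: "ip M f f = complex_of_real (sqn M f)"
  unfolding ip_def sqn_def
  by (simp only: complex_norm_square[symmetric] of_real_power[symmetric] integral_complex_of_real)

lemma ip_diff_left:
  assumes "square_integrable M f" "square_integrable M g" "square_integrable M h"
  shows "ip M (\<lambda>x. f x - g x) h = ip M f h - ip M g h"
  using assms unfolding ip_def
  by (simp add: left_diff_distrib square_integrable_ip)

lemma ip_Cauchy_Schwarz:
  assumes f: "square_integrable M f" and g: "square_integrable M g"
  shows "cmod (ip M f g) \<le> sqrt (sqn M f) * sqrt (sqn M g)"
proof -
  note [measurable] = square_integrable_measurable[OF f] square_integrable_measurable[OF g]
  have I: "integrable M (\<lambda>x. cmod (f x) * cmod (g x))"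
    using integrable_norm[OF square_integrable_ip[OF f g]] by (simp add: norm_mult)
  let ?I = "\<integral>x. cmod (f x) * cmod (g x) \<partial>M"
  have "(ennreal ?I)\<^sup>2 = (\<integral>\<^sup>+x. ennreal (cmod (f x)) * ennreal (cmod (g x)) \<partial>M)\<^sup>2"
    using I by (subst nn_integral_eq_integral[symmetric]) (auto simp: ennreal_mult)
  also have "\<dots> \<le> (\<integral>\<^sup>+x. (ennreal (cmod (f x)))\<^sup>2 \<partial>M) * (\<integral>\<^sup>+x. (ennreal (cmod (g x)))\<^sup>2 \<partial>M)"
    by (rule Cauchy_Schwarz_nn_integral) measurable
  also have "\<dots> = ennreal (sqn M f) * ennreal (sqn M g)"
    using nn_sqn[OF f] nn_sqn[OF g] by (simp add: ennreal_power)
  finally have "?I\<^sup>2 \<le> sqn M f * sqn M g"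
    by (simp add: ennreal_power ennreal_mult[symmetric])
  then have "?I \<le> sqrt (sqn M f) * sqrt (sqn M g)"
    by (metis real_le_rsqrt real_sqrt_mult)
  moreover have "cmod (ip M f g) \<le> ?I"
    unfolding ip_def by (rule order_trans[OF integral_norm_bound]) (simp add: norm_mult)
  ultimately show ?thesis by linarith
qed

lemma sqn_add:
  assumes f: "square_integrable M f" and g: "square_integrable M g"
  shows "sqn M (\<lambda>x. f x + g x) = sqn M f + 2 * Re (ip M f g) + sqn M g"
proof -
  note [measurable] = square_integrable_measurable[OF f] square_integrable_measurable[OF g]
  have *: "(cmod (f x + g x))\<^sup>2 = (cmod (f x))\<^sup>2 + 2 * Re (f x * cnj (g x)) + (cmod (g x))\<^sup>2" for x
    by (simp add: cmod_power2) algebra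
  have I: "integrable M (\<lambda>x. f x * cnj (g x))" by (rule square_integrable_ip[OF f g])
  then have "integrable M (\<lambda>x. Re (f x * cnj (g x)))" by (rule integrable_Re)
  then show ?thesis
    using f g I unfolding sqn_def * ip_def square_integrable_def
    by (simp del: times_complex.sel add: integral_Re)
qed

lemma sqn_diff:
  assumes f: "square_integrable M f" and g: "square_integrable M g"
  shows "sqn M (\<lambda>x. f x - g x) = sqn M f - 2 * Re (ip M f g) + sqn M g"
proof -
  have "sqn M (\<lambda>x. f x + (-1) * g x) = sqn M f + 2 * Re (ip M f (\<lambda>x. -1 * g x)) + sqn M (\<lambda>x. -1 * g x)"
    by (rule sqn_add[OF f square_integrable_cmult[OF g]])
  then show ?thesis by (simp add: sqn_def ip_def)
qed

lemma ip_tendsto_left: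
  assumes f: "\<And>n. square_integrable M (f n)" "square_integrable M F" and g: "square_integrable M g"
    and lim: "(\<lambda>n. sqn M (\<lambda>x. f n x - F x)) \<longlonglongrightarrow> 0"
  shows "(\<lambda>n. ip M (f n) g) \<longlonglongrightarrow> ip M F g"
proof (rule LIM_zero_cancel, rule Lim_null_comparison)
  show "\<forall>\<^sub>F n in sequentially. cmod (ip M (f n) g - ip M F g)
      \<le> sqrt (sqn M (\<lambda>x. f n x - F x)) * sqrt (sqn M g)"
    using ip_Cauchy_Schwarz[OF square_integrable_diff[OF f] g] f g by (simp add: ip_diff_left)
  show "(\<lambda>n. sqrt (sqn M (\<lambda>x. f n x - F x)) * sqrt (sqn M g)) \<longlonglongrightarrow> 0"
    using tendsto_mult[OF tendsto_real_sqrt[OF lim] tendsto_const[of "sqrt (sqn M g)"]] by simp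
qed

lemma ip_tendsto_right:
  assumes f: "\<And>n. square_integrable M (f n)" "square_integrable M F" and g: "square_integrable M g"
    and lim: "(\<lambda>n. sqn M (\<lambda>x. f n x - F x)) \<longlonglongrightarrow> 0"
  shows "(\<lambda>n. ip M g (f n)) \<longlonglongrightarrow> ip M g F"
  using tendsto_cnj[OF ip_tendsto_left[OF assms]] by (simp add: ip_cnj)

text \<open>Expanding the squared distance to F isolates the squared norm of \<open>f n\<close>; the
  cross term converges because pairing with the fixed F is continuous.\<close>

lemma sqn_tendsto:
  assumes f: "\<And>n. square_integrable M (f n)" "square_integrable M F"
    and lim: "(\<lambda>n. sqn M (\<lambda>x. f n x - F x)) \<longlonglongrightarrow> 0"
  shows "(\<lambda>n. sqn M (f n)) \<longlonglongrightarrow> sqn M F"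
proof -
  have d: "sqn M (\<lambda>x. f n x - F x) = sqn M (f n) - 2 * Re (ip M (f n) F) + sqn M F" for n
    by (rule sqn_diff[OF f])
  have "(\<lambda>n. Re (ip M (f n) F)) \<longlonglongrightarrow> sqn M F"
    using tendsto_Re[OF ip_tendsto_left[OF f f(2) lim]] by (simp add: ip_self)
  from tendsto_add[OF lim tendsto_diff[OF tendsto_mult[OF tendsto_const[of 2] this] tendsto_const[of "sqn M F"]]]
  show ?thesis by (simp add: d)
qed

lemma sqn_eq_0_AE:
  assumes f: "square_integrable M f" and 0: "sqn M f = 0"
  shows "AE x in M. f x = 0"
proof -
  have "AE x in M. (cmod (f x))\<^sup>2 = 0"
    using f 0 unfolding square_integrable_def sqn_def
    by (subst (asm) integral_nonneg_eq_0_iff_AE) auto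
  then show ?thesis by simp
qed

text \<open>Summability of the increments comes from
  \<open>\<bar>d\<^sub>n\<bar> \<le> 2\<^sup>-\<^sup>n + 2\<^sup>n \<bar>d\<^sub>n\<bar>\<^sup>2\<close>, whose right-hand side is almost everywhere summable.\<close>

lemma square_integrable_fast_Cauchy:
  fixes f :: "nat \<Rightarrow> 'a \<Rightarrow> complex"
  assumes f: "\<And>n. square_integrable M (f n)"
    and fast: "\<And>n. sqn M (\<lambda>x. f (Suc n) x - f n x) \<le> C / 4 ^ n"
  obtains F where "F \<in> borel_measurable M" "AE x in M. (\<lambda>n. f n x) \<longlonglongrightarrow> F x"
proof -
  note [measurable] = square_integrable_measurable[OF f]
  let ?d = "\<lambda>n x. f (Suc n) x - f n x"
  have "0 \<le> C"
    using order_trans[OF sqn_nonneg fast[of 0]] by simp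
  \<comment> \<open>The squared increments decay like C / 4^n. Weighting them by 2^n spends half of
    this decay and leaves the summable terms C * (1/2)^n.\<close>
  have s: "summable (\<lambda>n. C * (1/2)^n)" by (intro summable_mult summable_geometric) simp
  have "(\<integral>\<^sup>+x. (\<Sum>n. ennreal (2^n * (cmod (?d n x))\<^sup>2)) \<partial>M) = (\<Sum>n. \<integral>\<^sup>+x. ennreal (2^n * (cmod (?d n x))\<^sup>2) \<partial>M)"
    by (rule nn_integral_suminf) measurable
  also have "\<dots> \<le> (\<Sum>n. ennreal (C * (1/2)^n))"
  proof (intro suminf_le allI)
    fix n
    have "(\<integral>\<^sup>+x. ennreal (2^n * (cmod (?d n x))\<^sup>2) \<partial>M) = ennreal (2^n) * ennreal (sqn M (?d n))"
      by (subst nn_sqn[OF square_integrable_diff[OF f f], symmetric], subst nn_integral_cmult[symmetric])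
        (auto simp: ennreal_mult)
    also have "\<dots> = ennreal (2^n * sqn M (?d n))" by (simp add: ennreal_mult)
    also have "\<dots> \<le> ennreal (2^n * (C / 4^n))"
      using fast[of n] by (intro ennreal_leI mult_left_mono) auto
    also have "2^n * (C / 4^n) = C * (1/2)^n"
    proof -
      have "(4::real)^n = 2^n * 2^n" by (simp add: power_mult_distrib[symmetric])
      then show ?thesis by (simp add: field_simps)
    qed
    finally show "(\<integral>\<^sup>+x. ennreal (2^n * (cmod (?d n x))\<^sup>2) \<partial>M) \<le> ennreal (C * (1/2)^n)" .
  qed auto
  also have "\<dots> = ennreal (\<Sum>n. C * (1/2)^n)"
    using \<open>0 \<le> C\<close> s by (intro suminf_ennreal2) auto
  finally have le: "(\<integral>\<^sup>+x. (\<Sum>n. ennreal (2^n * (cmod (?d n x))\<^sup>2)) \<partial>M) \<le> ennreal (\<Sum>n. C * (1/2)^n)" .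
  have fin: "(\<integral>\<^sup>+x. (\<Sum>n. ennreal (2^n * (cmod (?d n x))\<^sup>2)) \<partial>M) \<noteq> \<infinity>"
    using le_less_trans[OF le ennreal_less_top] by (simp only: less_top infinity_ennreal_def not_False_eq_True)
  have "AE x in M. (\<Sum>n. ennreal (2^n * (cmod (?d n x))\<^sup>2)) \<noteq> \<infinity>"
    by (rule nn_integral_PInf_AE, measurable) (use fin in simp)
  then have conv: "AE x in M. convergent (\<lambda>n. f n x)"
  proof eventually_elim
    case (elim x)
    then have sm: "summable (\<lambda>n. 2^n * (cmod (?d n x))\<^sup>2)"
      by (intro summable_suminf_not_top) auto
    have "summable (\<lambda>n. (1/2::real)^n)" by (rule summable_geometric) simp
    from summable_add[OF this sm] have "summable (\<lambda>n. (1/2)^n + 2^n * (cmod (?d n x))\<^sup>2)" .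
    then have "summable (\<lambda>n. ?d n x)"
    proof (rule summable_norm_cancel[OF summable_comparison_test'])
      fix n :: nat
      let ?t = "cmod (?d n x)"
      have "0 \<le> (1 - 2^n * ?t)\<^sup>2" by simp
      then have "2^n * ?t * 2 \<le> 1 + (2^n * ?t)\<^sup>2" by (simp add: power2_eq_square algebra_simps)
      moreover have "0 \<le> 2^n * ?t" by simp
      ultimately have "2^n * ?t \<le> 1 + (2^n * ?t)\<^sup>2" by linarith
      then have "(1/2)^n * (2^n * ?t) \<le> (1/2)^n * (1 + (2^n * ?t)\<^sup>2)"
        by (rule mult_left_mono) simp
      then show "norm (norm (?d n x)) \<le> (1/2)^n + 2^n * ?t\<^sup>2"
        by (simp add: field_simps power2_eq_square)
    qed
    then have "convergent (\<lambda>n. \<Sum>i<n. ?d i x)" by (simp add: summable_iff_convergent)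
    moreover have "(\<Sum>i<n. ?d i x) = f n x - f 0 x" for n
      by (rule sum_lessThan_telescope[of "\<lambda>i. f i x"])
    ultimately have "convergent (\<lambda>n. f n x - f 0 x)" by simp
    then have "convergent (\<lambda>n. (f n x - f 0 x) + f 0 x)"
      by (rule convergent_add[OF _ convergent_const])
    then show ?case by simp
  qed
  show thesis
  proof
    show "(\<lambda>x. lim (\<lambda>n. f n x)) \<in> borel_measurable M" by measurable
    show "AE x in M. (\<lambda>n. f n x) \<longlonglongrightarrow> lim (\<lambda>n. f n x)"
      using conv by eventually_elim (simp add: convergent_LIMSEQ_iff)
  qed
qed

text \<open>Fatou's lemma, with the bound asked only from \<open>start\<close> on: for the
  increments \<open>f m - f n\<close> of a Cauchy sequence it is available only for m \<ge> n.
  Passing from the limit inferior to the limit superior lets an eventual bound suffice.\<close>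

lemma square_integrable_Fatou:
  fixes f :: "nat \<Rightarrow> 'a \<Rightarrow> complex"
  assumes f: "\<And>n. square_integrable M (f n)" and F: "F \<in> borel_measurable M"
    and ae: "AE x in M. (\<lambda>n. f n x) \<longlonglongrightarrow> F x"
    and bd: "\<And>n. n \<ge> start \<Longrightarrow> sqn M (f n) \<le> B"
  shows "square_integrable M F" "sqn M F \<le> B"
proof -
  note [measurable] = square_integrable_measurable[OF f] F
  have B0: "0 \<le> B" using order_trans[OF sqn_nonneg bd[of start]] by simp
  have "(\<integral>\<^sup>+x. ennreal ((cmod (F x))\<^sup>2) \<partial>M) = (\<integral>\<^sup>+x. liminf (\<lambda>n. ennreal ((cmod (f n x))\<^sup>2)) \<partial>M)"
  proof (rule nn_integral_cong_AE)
    show "AE x in M. ennreal ((cmod (F x))\<^sup>2) = liminf (\<lambda>n. ennreal ((cmod (f n x))\<^sup>2))"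
      using ae
    proof eventually_elim
      case (elim x)
      then have "(\<lambda>n. ennreal ((cmod (f n x))\<^sup>2)) \<longlonglongrightarrow> ennreal ((cmod (F x))\<^sup>2)"
        by (intro tendsto_ennrealI tendsto_power tendsto_norm)
      from lim_imp_Liminf[OF _ this] show ?case by simp
    qed
  qed
  also have "\<dots> \<le> liminf (\<lambda>n. \<integral>\<^sup>+x. ennreal ((cmod (f n x))\<^sup>2) \<partial>M)"
    by (rule nn_integral_liminf) measurable
  also have "\<dots> = liminf (\<lambda>n. ennreal (sqn M (f n)))"
    by (simp add: nn_sqn[OF f])
  also have "\<dots> \<le> limsup (\<lambda>n. ennreal (sqn M (f n)))"
    by (rule Liminf_le_Limsup) simp
  also have "\<dots> \<le> ennreal B"
    using bd by (intro Limsup_bounded) (auto simp: eventually_sequentially intro!: ennreal_leI)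
  finally have *: "(\<integral>\<^sup>+x. ennreal ((cmod (F x))\<^sup>2) \<partial>M) \<le> ennreal B" .
  then show si: "square_integrable M F"
    unfolding square_integrable_iff_nn using F le_less_trans[OF * ennreal_less_top] by simp
  show "sqn M F \<le> B"
    using * nn_sqn[OF si] B0 by simp
qed

section \<open>Approximation in L2 by continuous functions of compact support\<close>

section \<open>Density of compactly supported continuous functions\<close>

text \<open>From (s + t)^2 \<le> 2 s^2 + 2 t^2. Working with squared norms throughout avoids square
  roots at the price of the factors 2.\<close>

lemma sqn_triangle:
  assumes f: "square_integrable M f" and g: "square_integrable M g" and h: "square_integrable M h"
  shows "sqn M (\<lambda>x. f x - h x) \<le> 2 * sqn M (\<lambda>x. f x - g x) + 2 * sqn M (\<lambda>x. g x - h x)"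
proof -
  note fg = square_integrable_diff[OF f g] and gh = square_integrable_diff[OF g h]
    and fh = square_integrable_diff[OF f h]
  have "(cmod (f x - h x))\<^sup>2 \<le> 2 * (cmod (f x - g x))\<^sup>2 + 2 * (cmod (g x - h x))\<^sup>2" for x
  proof -
    have "(cmod (f x - h x))\<^sup>2 \<le> (cmod (f x - g x) + cmod (g x - h x))\<^sup>2"
      using norm_triangle_ineq[of "f x - g x" "g x - h x"] by (intro power_mono) auto
    also have "\<dots> \<le> 2 * (cmod (f x - g x))\<^sup>2 + 2 * (cmod (g x - h x))\<^sup>2"
      using sum_squares_bound[of "cmod (f x - g x)" "cmod (g x - h x)"] by (simp add: power2_sum)
    finally show ?thesis .
  qed
  then have "sqn M (\<lambda>x. f x - h x) \<le>
      (\<integral>x. 2 * (cmod (f x - g x))\<^sup>2 + 2 * (cmod (g x - h x))\<^sup>2 \<partial>M)"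
    using fg gh fh unfolding sqn_def square_integrable_def by (intro integral_mono) auto
  also have "\<dots> = 2 * sqn M (\<lambda>x. f x - g x) + 2 * sqn M (\<lambda>x. g x - h x)"
    using fg gh unfolding sqn_def square_integrable_def by simp
  finally show ?thesis .
qed

lemma sqn_tendsto_dominated:
  assumes h: "square_integrable M h" and f: "\<And>n. f n \<in> borel_measurable M"
    and ae: "AE x in M. (\<lambda>n. f n x) \<longlonglongrightarrow> h x"
    and w: "integrable M (\<lambda>x. (w x)\<^sup>2)"
    and bd: "\<And>n x. cmod (f n x - h x) \<le> w x"
  shows "(\<lambda>n. sqn M (\<lambda>x. f n x - h x)) \<longlonglongrightarrow> 0"
proof -
  note [measurable] = square_integrable_measurable[OF h] f
  have "(\<lambda>n. \<integral>x. (cmod (f n x - h x))\<^sup>2 \<partial>M) \<longlonglongrightarrow> (\<integral>x. 0 \<partial>M)"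
  proof (rule integral_dominated_convergence[OF _ _ w])
    show "AE x in M. (\<lambda>n. (cmod (f n x - h x))\<^sup>2) \<longlonglongrightarrow> 0"
      using ae
    proof eventually_elim
      case (elim x)
      from tendsto_power[OF tendsto_norm[OF LIM_zero[OF elim]], of 2] show ?case by simp
    qed
    show "AE x in M. norm ((cmod (f n x - h x))\<^sup>2) \<le> (w x)\<^sup>2" for n
      using bd[of n] by (auto intro!: AE_I2 power_mono)
  qed measurable
  then show ?thesis by (simp add: sqn_def)
qed

definition compactly_supported :: "(real \<Rightarrow> complex) \<Rightarrow> bool" where
  "compactly_supported g \<longleftrightarrow> continuous_on UNIV g \<and> (\<exists>M. \<forall>x. cmod (g x) \<le> M) \<and>
     (\<exists>R. \<forall>x. \<bar>x\<bar> > R \<longrightarrow> g x = 0)"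

lemma bounded_support_integrable:
  fixes g :: "real \<Rightarrow> complex"
  assumes [measurable]: "g \<in> borel_measurable lborel"
    and M: "\<And>x. cmod (g x) \<le> M" and R: "\<And>x. \<bar>x\<bar> > R \<Longrightarrow> g x = 0"
  shows "integrable lborel g" "square_integrable lborel g"
proof -
  have M0: "0 \<le> M" using order_trans[OF norm_ge_zero M] .
  have i: "integrable lborel (\<lambda>x. C * indicat_real {-R..R} x)" for C
    by (intro integrable_mult_right integrable_real_indicator) (auto simp: emeasure_lborel_Icc_eq)
  show "integrable lborel g"
  proof (rule Bochner_Integration.integrable_bound[OF i[of M]])
    show "AE x in lborel. cmod (g x) \<le> norm (M * indicat_real {- R..R} x)"
      using M M0 R by (auto intro!: AE_I2 simp: indicator_def abs_if not_le split: if_splits)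
  qed simp
  show "square_integrable lborel g"
    unfolding square_integrable_def
  proof
    show "integrable lborel (\<lambda>x. (cmod (g x))\<^sup>2)"
    proof (rule Bochner_Integration.integrable_bound[OF i[of "M\<^sup>2"]])
      show "AE x in lborel. norm ((cmod (g x))\<^sup>2) \<le> norm (M\<^sup>2 * indicat_real {- R..R} x)"
      proof (rule AE_I2)
        fix x show "norm ((cmod (g x))\<^sup>2) \<le> norm (M\<^sup>2 * indicat_real {- R..R} x)"
        proof (cases "\<bar>x\<bar> > R")
          case False
          then have "x \<in> {-R..R}" by auto
          then show ?thesis using M[of x] by (simp add: power_mono)
        qed (simp add: R)
      qed
    qed simp
  qed simp
qed

lemma compactly_supported_integrable:
  assumes "compactly_supported g"
  shows "integrable lborel g" "square_integrable lborel g"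
  using assms unfolding compactly_supported_def
  by (auto intro!: bounded_support_integrable borel_measurable_continuous_onI)

text \<open>A measurable function is an almost everywhere limit of continuous functions, by the
  characterization behind \<open>measurable_on\<close>. Those approximants have neither a common
  bound nor a common support; both are imposed afterwards by operations that leave h itself fixed,
  and dominated convergence then gives the limit in L2.\<close>

lemma compactly_supported_dense_bounded:
  assumes [measurable]: "h \<in> borel_measurable lborel"
    and M: "\<And>x. cmod (h x) \<le> M" and R: "\<And>x. \<bar>x\<bar> > R \<Longrightarrow> h x = 0" and "M > 0"
  shows "\<exists>g. (\<forall>n. compactly_supported (g n)) \<and> (\<lambda>n::nat. sqn lborel (\<lambda>x. g n x - h x)) \<longlonglongrightarrow> 0"
proof -
  have "h measurable_on UNIV"
    by (rule lebesgue_measurable_imp_measurable_on) (auto intro: measurable_completion)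
  then obtain N g where N: "negligible N" and g: "\<And>n. continuous_on UNIV (g n)"
      and lim: "\<And>x. x \<notin> N \<Longrightarrow> (\<lambda>n. g n x) \<longlonglongrightarrow> h x"
    unfolding measurable_on_def by auto
  let ?\<chi> = "\<lambda>x. max 0 (min 1 (R + 1 - \<bar>x\<bar>))"
  \<comment> \<open>The first factor shrinks values of modulus above M back to modulus M,
    continuously because \<open>M > 0\<close>. The second is a cut-off equal to 1 on [-R, R] and 0
    outside [-R-1, R+1]. Neither changes h, so the pointwise limit is kept.\<close>
  define c where "c = (\<lambda>(n::nat) x. g n x * of_real (M / max M (cmod (g n x))) * of_real (?\<chi> x))"
  have cont: "continuous_on UNIV (c n)" for n
    unfolding c_def using \<open>M > 0\<close> by (intro continuous_intros g) (auto simp: max_def)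
  have trunc: "cmod (z * of_real (M / max M (cmod z))) \<le> M" for z
    using \<open>M > 0\<close> by (auto simp: norm_mult norm_divide max_def field_simps)
  have bd: "cmod (c n x) \<le> M" for n x
  proof -
    have "cmod (c n x) \<le> M * 1"
      unfolding c_def norm_mult[of _ "of_real (?\<chi> x)"] using \<open>M > 0\<close>
      by (intro mult_mono trunc) auto
    then show ?thesis by simp
  qed
  have supp: "c n x = 0" if "\<bar>x\<bar> > R + 1" for n x
    using that by (simp add: c_def)
  have cc: "compactly_supported (c n)" for n
    unfolding compactly_supported_def using cont bd supp by blast
  have "AE x in lebesgue. x \<notin> N"
    using N by (auto simp: negligible_iff_null_sets intro: AE_not_in)
  then have "AE x in lborel. x \<notin> N" by (simp add: AE_completion_iff)
  then have ae: "AE x in lborel. (\<lambda>n. c n x) \<longlonglongrightarrow> h x"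
  proof eventually_elim
    case (elim x)
    have "(\<lambda>n. c n x) \<longlonglongrightarrow> h x * of_real (M / max M (cmod (h x))) * of_real (?\<chi> x)"
      unfolding c_def using \<open>M > 0\<close> by (intro tendsto_intros lim[OF elim]) (auto simp: max_def)
    moreover have "h x * of_real (M / max M (cmod (h x))) * of_real (?\<chi> x) = h x"
    proof (cases "\<bar>x\<bar> > R")
      case False
      then show ?thesis using M[of x] \<open>M > 0\<close> by (simp add: max_def)
    qed (simp add: R)
    ultimately show ?case by simp
  qed
  have "(\<lambda>n. sqn lborel (\<lambda>x. c n x - h x)) \<longlonglongrightarrow> 0"
  proof (rule sqn_tendsto_dominated[OF _ _ ae, where w="\<lambda>x. (2 * M) * indicat_real {-(R+1)..R+1} x"])
    show "square_integrable lborel h" by (rule bounded_support_integrable[OF assms(1-3)])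
    show "c n \<in> borel_measurable lborel" for n
      using cont[of n] by (auto intro: borel_measurable_continuous_onI)
    have "integrable lborel (\<lambda>x. (2 * M)\<^sup>2 * indicat_real {-(R+1)..R+1} x)"
      by (intro integrable_mult_right integrable_real_indicator) (auto simp: emeasure_lborel_Icc_eq)
    also have "(\<lambda>x. (2 * M)\<^sup>2 * indicat_real {-(R+1)..R+1} x) = (\<lambda>x. ((2 * M) * indicat_real {-(R+1)..R+1} x)\<^sup>2)"
      by (auto simp: indicator_def)
    finally show "integrable lborel (\<lambda>x. ((2 * M) * indicat_real {-(R+1)..R+1} x)\<^sup>2)" .
    show "cmod (c n x - h x) \<le> (2 * M) * indicat_real {-(R+1)..R+1} x" for n x
    proof (cases "x \<in> {-(R+1)..R+1}")
      case True
      then show ?thesis using norm_triangle_ineq4[of "c n x" "h x"] bd[of n x] M[of x] by simp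
    next
      case False
      then have "\<bar>x\<bar> > R + 1" by auto
      then have "c n x = 0" "h x = 0" using supp R by auto
      then show ?thesis using False by simp
    qed
  qed
  with cc show ?thesis by blast
qed

lemma compactly_supported_dense:
  assumes h: "square_integrable lborel h"
  shows "\<exists>g. (\<forall>n. compactly_supported (g n)) \<and> (\<lambda>n::nat. sqn lborel (\<lambda>x. g n x - h x)) \<longlonglongrightarrow> 0"
proof -
  note [measurable] = square_integrable_measurable[OF h]
  \<comment> \<open>Cutting off height and width at the same m reduces the general case to bounded
    functions of bounded support.\<close>
  define t where "t = (\<lambda>(m::nat) x. if cmod (h x) \<le> real m \<and> \<bar>x\<bar> \<le> real m then h x else 0)"
  have tm [measurable]: "t m \<in> borel_measurable lborel" for m unfolding t_def by measurable
  have t_lim: "(\<lambda>m. sqn lborel (\<lambda>x. t m x - h x)) \<longlonglongrightarrow> 0"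
  proof (rule sqn_tendsto_dominated[OF h tm, where w="\<lambda>x. cmod (h x)"])
    show "AE x in lborel. (\<lambda>n. t n x) \<longlonglongrightarrow> h x"
    proof (rule AE_I2)
      fix x
      have "t n x = h x" if "n \<ge> nat \<lceil>max (cmod (h x)) \<bar>x\<bar>\<rceil>" for n
        using that unfolding t_def by (auto simp: nat_ceiling_le_eq)
      then show "(\<lambda>n. t n x) \<longlonglongrightarrow> h x"
        by (intro tendsto_eventually) (unfold eventually_sequentially, blast)
    qed
    show "integrable lborel (\<lambda>x. (cmod (h x))\<^sup>2)" using h by (simp add: square_integrable_def)
  qed (auto simp: t_def)
  have ex: "\<exists>g. compactly_supported g \<and> sqn lborel (\<lambda>x. g x - h x) < e" if "e > 0" for e
  proof -
    \<comment> \<open>\<open>sqn_triangle\<close> doubles each of the two errors, so each may be at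
      most a quarter of e.\<close>
    have "e / 4 > 0" using that by simp
    have "\<forall>\<^sub>F m in sequentially. sqn lborel (\<lambda>x. t m x - h x) < e / 4"
      using order_tendstoD(2)[OF t_lim \<open>e / 4 > 0\<close>] .
    then obtain m where m: "sqn lborel (\<lambda>x. t m x - h x) < e / 4"
      by (auto simp: eventually_sequentially)
    \<comment> \<open>The bound \<open>real m + 1\<close> is positive even for m = 0, as the
      approximation of bounded functions requires.\<close>
    have tb: "cmod (t m x) \<le> real m + 1" "\<bar>x\<bar> > real m \<Longrightarrow> t m x = 0" for x by (auto simp: t_def)
    have ts: "square_integrable lborel (t m)" by (rule bounded_support_integrable(2)[OF tm tb])
    obtain g where g: "\<And>n. compactly_supported (g n)"
        and lim: "(\<lambda>n::nat. sqn lborel (\<lambda>x. g n x - t m x)) \<longlonglongrightarrow> 0"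
      using compactly_supported_dense_bounded[OF tm tb] by force
    have "\<forall>\<^sub>F n in sequentially. sqn lborel (\<lambda>x. g n x - t m x) < e / 4"
      using order_tendstoD(2)[OF lim \<open>e / 4 > 0\<close>] .
    then obtain n where n: "sqn lborel (\<lambda>x. g n x - t m x) < e / 4"
      by (auto simp: eventually_sequentially)
    have "sqn lborel (\<lambda>x. g n x - h x) < e"
      using sqn_triangle[OF compactly_supported_integrable(2)[OF g] ts h, of n] m n by linarith
    with g show ?thesis by blast
  qed
  have "\<forall>n::nat. \<exists>g. compactly_supported g \<and> sqn lborel (\<lambda>x. g x - h x) < inverse (real (Suc n))"
    using ex by simp
  then obtain g where g: "\<And>n. compactly_supported (g n)"
      and lt: "\<And>n. sqn lborel (\<lambda>x. g n x - h x) < inverse (real (Suc n))" by metis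
  have "(\<lambda>n. sqn lborel (\<lambda>x. g n x - h x)) \<longlonglongrightarrow> 0"
    by (rule Lim_null_comparison[OF _ LIMSEQ_inverse_real_of_nat])
      (use lt in \<open>auto intro!: always_eventually less_imp_le\<close>)
  with g show ?thesis by blast
qed

section \<open>The Fourier integral on L1, Gaussian damping, Plancherel on L1 and L2\<close>

section \<open>Plancherel's theorem\<close>

lemma measurable_cis [measurable]: "cis \<in> borel_measurable borel"
  by (intro borel_measurable_continuous_onI continuous_intros)

lemma measurable_cnj [measurable (raw)]:
  "f \<in> borel_measurable M \<Longrightarrow> (\<lambda>x. cnj (f x)) \<in> borel_measurable M"
  by (erule measurable_compose) (intro borel_measurable_continuous_onI continuous_intros)

text \<open>A Bochner integral without integrability is 0 by convention, so the estimate holds for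
  every f and can be nested without checking inner integrals.\<close>

lemma norm_integral_le_nn_integral:
  fixes f :: "'a \<Rightarrow> complex"
  shows "ennreal (cmod (\<integral>x. f x \<partial>M)) \<le> (\<integral>\<^sup>+x. ennreal (cmod (f x)) \<partial>M)"
  by (cases "integrable M f") (auto simp: not_integrable_integral_eq intro: integral_norm_bound_ennreal)

lemma integrable_prod_lborel:
  fixes u v :: "real \<Rightarrow> complex"
  assumes u: "integrable lborel u" and v: "integrable lborel v"
    and b: "b \<in> borel_measurable (lborel \<Otimes>\<^sub>M lborel)" and C: "\<And>z. cmod (b z) \<le> C"
  shows "integrable (lborel \<Otimes>\<^sub>M lborel) (\<lambda>(x, y). u x * v y * b (x, y))"
proof (rule Bochner_Integration.integrable_bound)
  note [measurable] = borel_measurable_integrable[OF u] borel_measurable_integrable[OF v] b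
  show "(\<lambda>(x, y). u x * v y * b (x, y)) \<in> borel_measurable (lborel \<Otimes>\<^sub>M lborel)"
    by measurable
  show "integrable (lborel \<Otimes>\<^sub>M lborel) (\<lambda>(x, y). cmod (u x) * cmod (v y) * C)"
  proof (rule lborel_pair.Fubini_integrable)
    have "integrable lborel (\<lambda>x. cmod (u x) * (\<bar>C\<bar> * (\<integral>y. cmod (v y) \<partial>lborel)))"
      by (intro integrable_mult_left integrable_norm u)
    then show "integrable lborel (\<lambda>x. \<integral>y. norm (case (x, y) of (x, y) \<Rightarrow> cmod (u x) * cmod (v y) * C) \<partial>lborel)"
      by (simp add: abs_mult mult_ac)
    show "AE x in lborel. integrable lborel (\<lambda>y. case (x, y) of (x, y) \<Rightarrow> cmod (u x) * cmod (v y) * C)"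
      using v by simp
  qed measurable
  show "AE x in lborel \<Otimes>\<^sub>M lborel. cmod (case x of (x, y) \<Rightarrow> u x * v y * b (x, y))
      \<le> norm (case x of (x, y) \<Rightarrow> cmod (u x) * cmod (v y) * C)"
    using C order_trans[OF norm_ge_zero C]
    by (auto intro!: AE_I2 mult_left_mono simp: norm_mult abs_mult)
qed

text \<open>In every use the kernel b is a phase, possibly times a bounded Fourier transform, so
  absolute integrability comes from u and v alone.\<close>

lemma Fubini_prod_lborel:
  fixes u v :: "real \<Rightarrow> complex"
  assumes u: "integrable lborel u" and v: "integrable lborel v"
    and b: "(\<lambda>(x, y). b x y) \<in> borel_measurable (lborel \<Otimes>\<^sub>M lborel)" and C: "\<And>x y. cmod (b x y) \<le> C"
  shows "(\<integral>y. (\<integral>x. u x * v y * b x y \<partial>lborel) \<partial>lborel) = (\<integral>x. (\<integral>y. u x * v y * b x y \<partial>lborel) \<partial>lborel)"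
  by (rule lborel_pair.Fubini_integral)
    (use integrable_prod_lborel[OF u v b, of C] C in \<open>auto simp: case_prod_unfold\<close>)

definition FT :: "(real \<Rightarrow> complex) \<Rightarrow> real \<Rightarrow> complex" where
  "FT h \<xi> = (\<integral>x. h x * cis (- 2 * pi * x * \<xi>) \<partial>lborel)"

lemma integrable_cis:
  assumes h: "integrable lborel h"
  shows "integrable lborel (\<lambda>x. h x * cis (c * x))"
proof -
  note [measurable] = borel_measurable_integrable[OF h]
  show ?thesis
    by (rule Bochner_Integration.integrable_bound[OF h]) (auto simp: norm_mult)
qed

lemma integrable_FT:
  assumes h: "integrable lborel h"
  shows "integrable lborel (\<lambda>x. h x * cis (- 2 * pi * x * \<xi>))"
  using integrable_cis[OF h, of "- 2 * pi * \<xi>"] by (simp add: mult_ac)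

lemma FT_measurable [measurable]:
  assumes [measurable]: "h \<in> borel_measurable lborel"
  shows "FT h \<in> borel_measurable borel"
  unfolding FT_def by measurable

lemma FT_bound: "cmod (FT h \<xi>) \<le> (\<integral>x. cmod (h x) \<partial>lborel)"
  unfolding FT_def by (rule order_trans[OF integral_norm_bound]) (simp add: norm_mult)

lemma FT_diff:
  assumes "integrable lborel f" "integrable lborel g"
  shows "FT (\<lambda>x. f x - g x) \<xi> = FT f \<xi> - FT g \<xi>"
  unfolding FT_def left_diff_distrib by (intro Bochner_Integration.integral_diff integrable_FT assms)

text \<open>Fubini moves the phase from f to h, and conjugation reverses its sign: the adjoint of
  the transform is the reflected transform, that is, the inverse one.\<close>

lemma FT_adjoint:
  assumes f: "integrable lborel f" and h: "integrable lborel h"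
  shows "ip lborel (FT f) h = ip lborel f (\<lambda>x. FT h (- x))"
proof -
  have h': "integrable lborel (\<lambda>x. cnj (h x))" using h by simp
  have inner: "(\<integral>\<xi>. cnj (h \<xi>) * cis (- 2 * pi * x * \<xi>) \<partial>lborel) = cnj (FT h (- x))" for x
    unfolding FT_def by (subst Bochner_Integration.integral_cnj[symmetric]) (simp add: cis_cnj mult_ac)
  have "ip lborel (FT f) h = (\<integral>\<xi>. (\<integral>x. f x * cnj (h \<xi>) * cis (- 2 * pi * x * \<xi>) \<partial>lborel) \<partial>lborel)"
    unfolding ip_def FT_def
    by (subst integral_mult_left_zero[symmetric]) (simp add: mult_ac)
  also have "\<dots> = (\<integral>x. (\<integral>\<xi>. f x * cnj (h \<xi>) * cis (- 2 * pi * x * \<xi>) \<partial>lborel) \<partial>lborel)"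
    by (rule Fubini_prod_lborel[OF f h', where C=1]) auto
  also have "\<dots> = (\<integral>x. f x * (\<integral>\<xi>. cnj (h \<xi>) * cis (- 2 * pi * x * \<xi>) \<partial>lborel) \<partial>lborel)"
    by (simp add: mult.assoc)
  finally show ?thesis by (simp only: ip_def inner)
qed

text \<open>Scaled to have value 1 at 0, so that it tends to 1 as s grows and the damping
  disappears. The exponent makes it a multiple of the normal density of deviation s, which brings in
  the known characteristic function.\<close>

definition gauss :: "real \<Rightarrow> real \<Rightarrow> real" where
  "gauss s \<xi> = exp (- ((\<xi> / s)\<^sup>2 / 2))"

lemma gauss_measurable [measurable]: "gauss s \<in> borel_measurable borel"
  unfolding gauss_def by measurable

lemma gauss_pos: "0 < gauss s \<xi>" by (simp add: gauss_def)

lemma gauss_le_1: "gauss s \<xi> \<le> 1" by (simp add: gauss_def)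

lemma gauss_tendsto: "(\<lambda>n. gauss (real (Suc n)) \<xi>) \<longlonglongrightarrow> 1"
proof -
  have "(\<lambda>n. exp (- ((\<xi> * inverse (real (Suc n)))\<^sup>2 / 2))) \<longlonglongrightarrow> exp (- ((\<xi> * 0)\<^sup>2 / 2))"
    by (rule tendsto_exp[OF tendsto_minus[OF tendsto_divide[OF tendsto_power[OF
          tendsto_mult[OF tendsto_const LIMSEQ_inverse_real_of_nat]] tendsto_const]]]) simp
  then show ?thesis unfolding gauss_def divide_inverse[of \<xi>] by simp
qed

lemma gauss_normal: "s > 0 \<Longrightarrow> gauss s \<xi> = sqrt (2 * pi * s\<^sup>2) * normal_density 0 s \<xi>"
  by (simp add: gauss_def normal_density_def power_divide)

lemma gauss_integrable: "s > 0 \<Longrightarrow> integrable lborel (gauss s)"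
proof -
  assume "s > 0"
  then have "gauss s = (\<lambda>\<xi>. sqrt (2 * pi * s\<^sup>2) * normal_density 0 s \<xi>)"
    by (intro ext gauss_normal)
  then show ?thesis using \<open>s > 0\<close> by simp
qed

text \<open>After rescaling by s the integral is the characteristic function of the standard normal
  law at -2 pi s t. The result is a probability density of deviation 1 / (2 pi s), hence an
  approximate identity as s grows.\<close>

lemma FT_gauss:
  assumes s: "s > 0"
  shows "FT (\<lambda>\<xi>. complex_of_real (gauss s \<xi>)) t = complex_of_real (normal_density 0 (1 / (2 * pi * s)) t)"
proof -
  have "char std_normal_distribution (- 2 * pi * s * t) =
     (\<integral>x. complex_of_real (std_normal_density x) * cis (- 2 * pi * s * t * x) \<partial>lborel)"
    unfolding char_def
    by (subst integral_density) (auto simp: scaleR_conv_of_real cis_conv_exp mult_ac intro!: Bochner_Integration.integral_cong)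
  then have c: "(\<integral>x. complex_of_real (std_normal_density x) * cis (- 2 * pi * s * t * x) \<partial>lborel)
     = complex_of_real (exp (- ((2 * pi * s * t)\<^sup>2 / 2)))"
    by (simp add: char_std_normal_distribution power2_eq_square)
  have "FT (\<lambda>\<xi>. complex_of_real (gauss s \<xi>)) t =
      \<bar>s\<bar> *\<^sub>R (\<integral>x. complex_of_real (gauss s (0 + s * x)) * cis (- 2 * pi * (0 + s * x) * t) \<partial>lborel)"
    unfolding FT_def using s by (intro lborel_integral_real_affine) simp
  also have "(\<integral>x. complex_of_real (gauss s (0 + s * x)) * cis (- 2 * pi * (0 + s * x) * t) \<partial>lborel) =
    (\<integral>x. complex_of_real (sqrt (2 * pi)) * (complex_of_real (std_normal_density x) * cis (- 2 * pi * s * t * x)) \<partial>lborel)"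
  proof (rule Bochner_Integration.integral_cong)
    fix x
    have "gauss s (0 + s * x) = sqrt (2 * pi) * std_normal_density x"
      using s by (simp add: gauss_def std_normal_density_def)
    moreover have "- 2 * pi * (0 + s * x) * t = - 2 * pi * s * t * x" by simp
    ultimately show "complex_of_real (gauss s (0 + s * x)) * cis (- 2 * pi * (0 + s * x) * t) =
       complex_of_real (sqrt (2 * pi)) * (complex_of_real (std_normal_density x) * cis (- 2 * pi * s * t * x))"
      by (simp only: of_real_mult mult.assoc)
  qed simp
  also have "\<bar>s\<bar> *\<^sub>R \<dots> = complex_of_real (s * sqrt (2 * pi) * exp (- ((2 * pi * s * t)\<^sup>2 / 2)))"
    using s by (simp only: integral_mult_right_zero c) (simp add: scaleR_conv_of_real)
  also have "s * sqrt (2 * pi) * exp (- ((2 * pi * s * t)\<^sup>2 / 2)) = normal_density 0 (1 / (2 * pi * s)) t"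
  proof -
    have "2 * pi * (1 / (2 * pi * s))\<^sup>2 = 1 / (2 * pi * s\<^sup>2)"
      using s by (simp add: power2_eq_square field_simps)
    then have "1 / sqrt (2 * pi * (1 / (2 * pi * s))\<^sup>2) = s * sqrt (2 * pi)"
      using s by (simp add: real_sqrt_divide real_sqrt_mult)
    moreover have "(t - 0)\<^sup>2 / (2 * (1 / (2 * pi * s))\<^sup>2) = (2 * pi * s * t)\<^sup>2 / 2"
      using s by (simp add: power2_eq_square field_simps)
    ultimately show ?thesis by (simp add: normal_density_def)
  qed
  finally show ?thesis .
qed

text \<open>Without the damping the triple integral over x, y and \<xi> is not absolutely
  convergent. With it, Fubini applies twice: in (y, \<xi>) to produce the Gaussian's transform at x
  - y, and in (x, \<xi>) with the conjugated transform of g as part of the bounded kernel.\<close>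

lemma gauss_pairing:
  assumes s: "s > 0" and h: "integrable lborel h" and g: "integrable lborel g"
  shows "(\<integral>\<xi>. complex_of_real (gauss s \<xi>) * (FT h \<xi> * cnj (FT g \<xi>)) \<partial>lborel) =
     (\<integral>x. h x * (\<integral>y. cnj (g y) * complex_of_real (normal_density 0 (1 / (2 * pi * s)) (x - y)) \<partial>lborel) \<partial>lborel)"
proof -
  note [measurable] = borel_measurable_integrable[OF h] borel_measurable_integrable[OF g]
  let ?W = "\<lambda>\<xi>. complex_of_real (gauss s \<xi>)"
  let ?G = "\<lambda>\<xi>. cnj (FT g \<xi>)"
  have W: "integrable lborel ?W" using gauss_integrable[OF s] by simp
  have g': "integrable lborel (\<lambda>x. cnj (g x))" using g by simp
  have G: "?G \<xi> = (\<integral>y. cnj (g y) * cis (2 * pi * y * \<xi>) \<partial>lborel)" for \<xi>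
    unfolding FT_def by (subst Bochner_Integration.integral_cnj[symmetric]) (simp add: cis_cnj)
  have inner: "(\<integral>\<xi>. ?W \<xi> * (cis (- 2 * pi * x * \<xi>) * ?G \<xi>) \<partial>lborel) =
      (\<integral>y. cnj (g y) * complex_of_real (normal_density 0 (1 / (2 * pi * s)) (x - y)) \<partial>lborel)" for x
  proof -
    have "(\<integral>\<xi>. ?W \<xi> * (cis (- 2 * pi * x * \<xi>) * ?G \<xi>) \<partial>lborel) =
       (\<integral>\<xi>. (\<integral>y. cnj (g y) * ?W \<xi> * cis (- 2 * pi * \<xi> * (x - y)) \<partial>lborel) \<partial>lborel)"
    proof (rule Bochner_Integration.integral_cong)
      fix \<xi>
      have "(\<integral>y. cnj (g y) * ?W \<xi> * cis (- 2 * pi * \<xi> * (x - y)) \<partial>lborel) =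
         (\<integral>y. (?W \<xi> * cis (- 2 * pi * x * \<xi>)) * (cnj (g y) * cis (2 * pi * y * \<xi>)) \<partial>lborel)"
      proof (rule Bochner_Integration.integral_cong)
        fix y
        have "cis (- 2 * pi * \<xi> * (x - y)) = cis (- 2 * pi * x * \<xi>) * cis (2 * pi * y * \<xi>)"
          by (simp add: cis_mult algebra_simps)
        then show "cnj (g y) * ?W \<xi> * cis (- 2 * pi * \<xi> * (x - y)) =
           (?W \<xi> * cis (- 2 * pi * x * \<xi>)) * (cnj (g y) * cis (2 * pi * y * \<xi>))"
          by (simp only: mult_ac)
      qed simp
      then show "?W \<xi> * (cis (- 2 * pi * x * \<xi>) * ?G \<xi>) =
          (\<integral>y. cnj (g y) * ?W \<xi> * cis (- 2 * pi * \<xi> * (x - y)) \<partial>lborel)"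
        by (simp only: integral_mult_right_zero G mult.assoc)
    qed simp
    also have "\<dots> = (\<integral>y. (\<integral>\<xi>. cnj (g y) * ?W \<xi> * cis (- 2 * pi * \<xi> * (x - y)) \<partial>lborel) \<partial>lborel)"
      by (rule Fubini_prod_lborel[OF g' W, where C=1]) auto
    also have "\<dots> = (\<integral>y. cnj (g y) * FT ?W (x - y) \<partial>lborel)"
      by (simp only: mult.assoc integral_mult_right_zero FT_def)
    finally show ?thesis by (simp only: FT_gauss[OF s])
  qed
  have "(\<integral>\<xi>. ?W \<xi> * (FT h \<xi> * ?G \<xi>) \<partial>lborel) =
      (\<integral>\<xi>. (\<integral>x. h x * ?W \<xi> * (cis (- 2 * pi * x * \<xi>) * ?G \<xi>) \<partial>lborel) \<partial>lborel)"
  proof (rule Bochner_Integration.integral_cong)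
    fix \<xi>
    have "(\<integral>x. h x * ?W \<xi> * (cis (- 2 * pi * x * \<xi>) * ?G \<xi>) \<partial>lborel) =
       (\<integral>x. (?W \<xi> * ?G \<xi>) * (h x * cis (- 2 * pi * x * \<xi>)) \<partial>lborel)"
      by (simp only: mult_ac)
    also have "\<dots> = (?W \<xi> * ?G \<xi>) * FT h \<xi>"
      unfolding FT_def[of h \<xi>] by (rule integral_mult_right_zero)
    finally show "?W \<xi> * (FT h \<xi> * ?G \<xi>) = (\<integral>x. h x * ?W \<xi> * (cis (- 2 * pi * x * \<xi>) * ?G \<xi>) \<partial>lborel)"
      by (simp only: mult_ac)
  qed simp
  also have "\<dots> = (\<integral>x. (\<integral>\<xi>. h x * ?W \<xi> * (cis (- 2 * pi * x * \<xi>) * ?G \<xi>) \<partial>lborel) \<partial>lborel)"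
    by (rule Fubini_prod_lborel[OF h W, where C="\<integral>x. cmod (g x) \<partial>lborel"])
      (auto simp: norm_mult FT_bound)
  also have "\<dots> = (\<integral>x. h x * (\<integral>\<xi>. ?W \<xi> * (cis (- 2 * pi * x * \<xi>) * ?G \<xi>) \<partial>lborel) \<partial>lborel)"
    by (simp only: mult.assoc integral_mult_right_zero)
  finally show ?thesis by (simp only: inner)
qed

text \<open>By \<open>gauss_pairing\<close> the damped norm of the transform is the quadratic form
  of a convolution kernel K. A Schur test bounds it: |h(x)| |h(y)| is at most half the sum of the
  squares, and K has mass 1 in each variable, so each half contributes half of the squared norm of
  h. Fatou's lemma then removes the damping.\<close>

lemma FT_contraction:
  assumes h: "integrable lborel h" and h2: "square_integrable lborel h"
  shows "square_integrable lborel (FT h)" "sqn lborel (FT h) \<le> sqn lborel h"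
proof -
  note [measurable] = borel_measurable_integrable[OF h]
  \<comment> \<open>The square root makes the squared modulus of \<open>f n\<close> exactly the
    damped integrand of \<open>gauss_pairing\<close> with g = h.\<close>
  define f where "f = (\<lambda>n \<xi>. complex_of_real (sqrt (gauss (real (Suc n)) \<xi>)) * FT h \<xi>)"
  have f_sq: "(cmod (f n \<xi>))\<^sup>2 = gauss (real (Suc n)) \<xi> * (cmod (FT h \<xi>))\<^sup>2" for n \<xi>
    using gauss_pos[of "real (Suc n)" \<xi>] by (simp add: f_def norm_mult power_mult_distrib)
  have fi: "integrable lborel (\<lambda>\<xi>. gauss (real (Suc n)) \<xi> * (cmod (FT h \<xi>))\<^sup>2)" for n
  proof (rule Bochner_Integration.integrable_bound)
    show "integrable lborel (\<lambda>\<xi>. gauss (real (Suc n)) \<xi> * (\<integral>x. cmod (h x) \<partial>lborel)\<^sup>2)"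
      by (intro integrable_mult_left gauss_integrable) simp
    show "AE \<xi> in lborel. norm (gauss (real (Suc n)) \<xi> * (cmod (FT h \<xi>))\<^sup>2)
       \<le> norm (gauss (real (Suc n)) \<xi> * (\<integral>x. cmod (h x) \<partial>lborel)\<^sup>2)"
      using FT_bound[of h]
      by (auto intro!: AE_I2 mult_left_mono power_mono simp: abs_mult)
  qed measurable
  have fs: "square_integrable lborel (f n)" for n
    unfolding square_integrable_def f_sq using fi by (auto simp: f_def)
  have bd: "sqn lborel (f n) \<le> sqn lborel h" for n
  proof -
    let ?\<sigma> = "1 / (2 * pi * real (Suc n))"
    have \<sigma>: "?\<sigma> > 0" by simp
    define K where "K = normal_density 0 ?\<sigma>"
    have K0 [simp]: "0 \<le> K t" for t by (simp add: K_def)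
    have [measurable]: "K \<in> borel_measurable borel" by (simp add: K_def)
    have K1: "(\<integral>\<^sup>+y. ennreal (K (x - y)) \<partial>lborel) = 1" "(\<integral>\<^sup>+y. ennreal (K (y - x)) \<partial>lborel) = 1" for x
    proof -
      have "(\<integral>\<^sup>+y. ennreal (K y) \<partial>lborel) = 1"
        unfolding K_def using \<sigma> by (subst nn_integral_eq_integral) auto
      then show "(\<integral>\<^sup>+y. ennreal (K (x - y)) \<partial>lborel) = 1" "(\<integral>\<^sup>+y. ennreal (K (y - x)) \<partial>lborel) = 1"
        using nn_integral_real_affine[of "\<lambda>y. ennreal (K y)" "-1" x]
          nn_integral_real_affine[of "\<lambda>y. ennreal (K y)" "1" "-x"] by simp_all
    qed
    let ?I = "\<integral>x. h x * (\<integral>y. cnj (h y) * complex_of_real (K (x - y)) \<partial>lborel) \<partial>lborel"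
    have "complex_of_real (sqn lborel (f n)) = ?I"
    proof -
      have "complex_of_real (sqn lborel (f n)) =
         (\<integral>\<xi>. complex_of_real (gauss (real (Suc n)) \<xi>) * (FT h \<xi> * cnj (FT h \<xi>)) \<partial>lborel)"
        unfolding sqn_def f_sq integral_complex_of_real[symmetric]
        by (simp only: complex_norm_square of_real_mult)
      also have "\<dots> = ?I" unfolding K_def by (rule gauss_pairing[OF _ h h]) simp
      finally show ?thesis .
    qed
    then have "ennreal (sqn lborel (f n)) = ennreal (cmod ?I)"
      by (metis norm_of_real abs_of_nonneg sqn_nonneg)
    also have "\<dots> \<le> (\<integral>\<^sup>+x. ennreal (cmod (h x * (\<integral>y. cnj (h y) * complex_of_real (K (x - y)) \<partial>lborel))) \<partial>lborel)"
      by (rule norm_integral_le_nn_integral)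
    also have "\<dots> \<le> (\<integral>\<^sup>+x. (\<integral>\<^sup>+y. ennreal (((cmod (h x))\<^sup>2 / 2) * K (x - y)) + ennreal (((cmod (h y))\<^sup>2 / 2) * K (x - y)) \<partial>lborel) \<partial>lborel)"
    proof (rule nn_integral_mono)
      fix x
      have "ennreal (cmod (h x * (\<integral>y. cnj (h y) * complex_of_real (K (x - y)) \<partial>lborel))) =
         ennreal (cmod (\<integral>y. h x * (cnj (h y) * complex_of_real (K (x - y))) \<partial>lborel))"
        by simp
      also have "\<dots> \<le> (\<integral>\<^sup>+y. ennreal (cmod (h x * (cnj (h y) * complex_of_real (K (x - y))))) \<partial>lborel)"
        by (rule norm_integral_le_nn_integral)
      also have "\<dots> \<le> (\<integral>\<^sup>+y. ennreal (((cmod (h x))\<^sup>2 / 2) * K (x - y)) + ennreal (((cmod (h y))\<^sup>2 / 2) * K (x - y)) \<partial>lborel)"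
      proof (rule nn_integral_mono)
        fix y
        have "cmod (h x) * cmod (h y) \<le> (cmod (h x))\<^sup>2 / 2 + (cmod (h y))\<^sup>2 / 2"
          using sum_squares_bound[of "cmod (h x)" "cmod (h y)"] by simp
        then have "cmod (h x) * cmod (h y) * K (x - y) \<le> ((cmod (h x))\<^sup>2 / 2 + (cmod (h y))\<^sup>2 / 2) * K (x - y)"
          by (rule mult_right_mono) simp
        then show "ennreal (cmod (h x * (cnj (h y) * complex_of_real (K (x - y))))) \<le>
            ennreal (((cmod (h x))\<^sup>2 / 2) * K (x - y)) + ennreal (((cmod (h y))\<^sup>2 / 2) * K (x - y))"
          by (subst ennreal_plus[symmetric])
            (auto intro!: ennreal_leI simp: norm_mult mult.assoc distrib_right simp del: ennreal_plus)
      qed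
      finally show "ennreal (cmod (h x * (\<integral>y. cnj (h y) * complex_of_real (K (x - y)) \<partial>lborel))) \<le>
        (\<integral>\<^sup>+y. ennreal (((cmod (h x))\<^sup>2 / 2) * K (x - y)) + ennreal (((cmod (h y))\<^sup>2 / 2) * K (x - y)) \<partial>lborel)" .
    qed
    also have "\<dots> = (\<integral>\<^sup>+x. (\<integral>\<^sup>+y. ennreal ((cmod (h x))\<^sup>2 / 2) * ennreal (K (x - y)) \<partial>lborel) \<partial>lborel)
        + (\<integral>\<^sup>+x. (\<integral>\<^sup>+y. ennreal ((cmod (h y))\<^sup>2 / 2) * ennreal (K (x - y)) \<partial>lborel) \<partial>lborel)"
    proof -
      have "ennreal ((cmod w)\<^sup>2 / 2 * K t) = ennreal ((cmod w)\<^sup>2 / 2) * ennreal (K t)" for w t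
        by (rule ennreal_mult) auto
      then show ?thesis by (simp only:) (simp add: nn_integral_add)
    qed
    also have "(\<integral>\<^sup>+x. (\<integral>\<^sup>+y. ennreal ((cmod (h y))\<^sup>2 / 2) * ennreal (K (x - y)) \<partial>lborel) \<partial>lborel)
       = (\<integral>\<^sup>+y. (\<integral>\<^sup>+x. ennreal ((cmod (h y))\<^sup>2 / 2) * ennreal (K (x - y)) \<partial>lborel) \<partial>lborel)"
      by (rule lborel_pair.Fubini') measurable
    finally have "ennreal (sqn lborel (f n)) \<le>
       (\<integral>\<^sup>+x. ennreal ((cmod (h x))\<^sup>2 / 2) \<partial>lborel) + (\<integral>\<^sup>+x. ennreal ((cmod (h x))\<^sup>2 / 2) \<partial>lborel)"
      by (simp add: nn_integral_cmult K1)
    also have "\<dots> = (\<integral>\<^sup>+x. ennreal ((cmod (h x))\<^sup>2) \<partial>lborel)"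
      by (subst nn_integral_add[symmetric]) (auto simp: ennreal_plus[symmetric] simp del: ennreal_plus)
    also have "\<dots> = ennreal (sqn lborel h)" by (rule nn_sqn[OF h2])
    finally show ?thesis by simp
  qed
  have ae: "AE \<xi> in lborel. (\<lambda>n. f n \<xi>) \<longlonglongrightarrow> FT h \<xi>"
  proof (rule AE_I2)
    fix \<xi>
    have "(\<lambda>n. f n \<xi>) \<longlonglongrightarrow> of_real (sqrt 1) * FT h \<xi>"
      unfolding f_def by (intro tendsto_intros gauss_tendsto)
    then show "(\<lambda>n. f n \<xi>) \<longlonglongrightarrow> FT h \<xi>" by simp
  qed
  have m: "FT h \<in> borel_measurable lborel" by simp
  show "square_integrable lborel (FT h)" "sqn lborel (FT h) \<le> sqn lborel h"
    by (rule square_integrable_Fatou[OF fs m ae bd])+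
qed

text \<open>Substituting y = x - \<sigma> t freezes the kernel at the standard normal density and
  moves the small parameter into g, where continuity and boundedness allow dominated convergence.
  The second claim is the bound uniform in x and n that serves as majorant when these averages are
  integrated against h.\<close>

lemma gauss_smoothing_tendsto:
  assumes g: "compactly_supported g"
  shows "(\<lambda>n. \<integral>y. cnj (g y) * complex_of_real (normal_density 0 (1 / (2 * pi * real (Suc n))) (x - y)) \<partial>lborel)
           \<longlonglongrightarrow> cnj (g x)" (is "?L \<longlonglongrightarrow> _")
    and "\<And>M. (\<And>y. cmod (g y) \<le> M) \<Longrightarrow>
       cmod (\<integral>y. cnj (g y) * complex_of_real (normal_density 0 (1 / (2 * pi * real (Suc n))) (x - y)) \<partial>lborel) \<le> M"
proof -
  have cont: "continuous_on UNIV g" and "\<exists>M. \<forall>y. cmod (g y) \<le> M"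
    using g by (auto simp: compactly_supported_def)
  have [measurable]: "g \<in> borel_measurable borel" using cont by (rule borel_measurable_continuous_onI)
  define \<sigma> where "\<sigma> n = 1 / (2 * pi * real (Suc n))" for n
  have \<sigma>: "\<sigma> n > 0" for n by (simp add: \<sigma>_def)
  have eq: "(\<integral>y. cnj (g y) * complex_of_real (normal_density 0 (\<sigma> n) (x - y)) \<partial>lborel) =
      (\<integral>t. cnj (g (x - \<sigma> n * t)) * complex_of_real (std_normal_density t) \<partial>lborel)" for n
  proof -
    have "(\<integral>y. cnj (g y) * complex_of_real (normal_density 0 (\<sigma> n) (x - y)) \<partial>lborel) =
      \<bar>- \<sigma> n\<bar> *\<^sub>R (\<integral>t. cnj (g (x + (- \<sigma> n) * t)) * complex_of_real (normal_density 0 (\<sigma> n) (x - (x + (- \<sigma> n) * t))) \<partial>lborel)"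
      using \<sigma>[of n] by (intro lborel_integral_real_affine) simp
    also have "\<dots> = (\<integral>t. \<sigma> n *\<^sub>R (cnj (g (x + (- \<sigma> n) * t)) * complex_of_real (normal_density 0 (\<sigma> n) (x - (x + (- \<sigma> n) * t)))) \<partial>lborel)"
      using \<sigma>[of n] by simp
    also have "\<dots> = (\<integral>t. cnj (g (x - \<sigma> n * t)) * complex_of_real (std_normal_density t) \<partial>lborel)"
    proof (rule Bochner_Integration.integral_cong)
      fix t
      have "\<sigma> n * normal_density 0 (\<sigma> n) (\<sigma> n * t) = std_normal_density t"
        using \<sigma>[of n] by (simp add: normal_density_def real_sqrt_mult power_mult_distrib)
      then have "complex_of_real (std_normal_density t) = of_real (\<sigma> n) * of_real (normal_density 0 (\<sigma> n) (\<sigma> n * t))"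
        by (metis of_real_mult)
      then show "\<sigma> n *\<^sub>R (cnj (g (x + (- \<sigma> n) * t)) * complex_of_real (normal_density 0 (\<sigma> n) (x - (x + (- \<sigma> n) * t))))
         = cnj (g (x - \<sigma> n * t)) * complex_of_real (std_normal_density t)"
        by (simp add: scaleR_conv_of_real)
    qed simp
    finally show ?thesis .
  qed
  { fix M assume M: "\<And>y. cmod (g y) \<le> M"
    have bd: "cmod (cnj (g (x - \<sigma> n * t)) * complex_of_real (std_normal_density t)) \<le> M * std_normal_density t" for n t
      unfolding norm_mult using M by (intro mult_mono) (auto simp: order_trans[OF norm_ge_zero M])
    have i: "integrable lborel (\<lambda>t. cnj (g (x - \<sigma> n * t)) * complex_of_real (std_normal_density t))" for n
    proof (rule Bochner_Integration.integrable_bound)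
      show "integrable lborel (\<lambda>t. M * std_normal_density t)" by simp
      show "AE t in lborel. cmod (cnj (g (x - \<sigma> n * t)) * complex_of_real (std_normal_density t)) \<le> norm (M * std_normal_density t)"
        using bd by (intro AE_I2) (auto intro: order_trans[OF _ abs_ge_self] simp del: norm_mult)
    qed measurable
    have "cmod (\<integral>t. cnj (g (x - \<sigma> n * t)) * complex_of_real (std_normal_density t) \<partial>lborel) \<le> (\<integral>t. M * std_normal_density t \<partial>lborel)" for n
      by (rule order_trans[OF integral_norm_bound integral_mono[OF integrable_norm[OF i] _ bd]]) simp
    then show "cmod (\<integral>y. cnj (g y) * complex_of_real (normal_density 0 (1 / (2 * pi * real (Suc n))) (x - y)) \<partial>lborel) \<le> M"
      unfolding \<sigma>_def[symmetric] eq by simp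
    have "(\<lambda>n. \<integral>t. cnj (g (x - \<sigma> n * t)) * complex_of_real (std_normal_density t) \<partial>lborel) \<longlonglongrightarrow>
        (\<integral>t. cnj (g x) * complex_of_real (std_normal_density t) \<partial>lborel)"
    proof (rule integral_dominated_convergence[where w="\<lambda>t. M * std_normal_density t"])
      show "AE t in lborel. (\<lambda>n. cnj (g (x - \<sigma> n * t)) * complex_of_real (std_normal_density t)) \<longlonglongrightarrow> cnj (g x) * complex_of_real (std_normal_density t)"
      proof (rule AE_I2)
        fix t
        have "\<sigma> \<longlonglongrightarrow> 0"
        proof -
          have "(\<lambda>n. 1 / (2 * pi) * inverse (real (Suc n))) \<longlonglongrightarrow> 1 / (2 * pi) * 0"
            by (rule tendsto_mult[OF tendsto_const LIMSEQ_inverse_real_of_nat])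
          then show ?thesis by (simp add: \<sigma>_def[abs_def] field_simps)
        qed
        then have "(\<lambda>n. x - \<sigma> n * t) \<longlonglongrightarrow> x - 0 * t" by (intro tendsto_intros)
        then have "(\<lambda>n. g (x - \<sigma> n * t)) \<longlonglongrightarrow> g x"
          using cont by (intro isCont_tendsto_compose[of x g]) (auto simp: continuous_on_eq_continuous_at)
        then show "(\<lambda>n. cnj (g (x - \<sigma> n * t)) * complex_of_real (std_normal_density t)) \<longlonglongrightarrow> cnj (g x) * complex_of_real (std_normal_density t)"
          by (intro tendsto_intros)
      qed
      show "AE t in lborel. cmod (cnj (g (x - \<sigma> n * t)) * complex_of_real (std_normal_density t)) \<le> M * std_normal_density t" for n
        using bd by (intro AE_I2)
    qed (simp, measurable)
    then have "?L \<longlonglongrightarrow> cnj (g x)" unfolding \<sigma>_def[symmetric] eq by simp }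
  with \<open>\<exists>M. \<forall>y. cmod (g y) \<le> M\<close> show "?L \<longlonglongrightarrow> cnj (g x)" by blast
qed

text \<open>The damping in \<open>gauss_pairing\<close> is removed under both integrals. On the
  frequency side the majorant is the product of the two transforms, integrable by
  \<open>FT_contraction\<close>; on the other side it is M |h|, because g is bounded.\<close>

lemma FT_Plancherel_compactly_supported:
  assumes h: "integrable lborel h" and h2: "square_integrable lborel h" and g: "compactly_supported g"
  shows "ip lborel (FT h) (FT g) = ip lborel h g"
proof (rule LIMSEQ_unique)
  note [measurable] = borel_measurable_integrable[OF h]
  note gi = compactly_supported_integrable[OF g]
  have [measurable]: "g \<in> borel_measurable borel" using gi(1) by auto
  let ?P = "\<lambda>n. \<integral>\<xi>. complex_of_real (gauss (real (Suc n)) \<xi>) * (FT h \<xi> * cnj (FT g \<xi>)) \<partial>lborel"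
  have I: "integrable lborel (\<lambda>\<xi>. FT h \<xi> * cnj (FT g \<xi>))"
    by (rule square_integrable_ip[OF FT_contraction(1)[OF h h2] FT_contraction(1)[OF gi]])
  show "?P \<longlonglongrightarrow> ip lborel (FT h) (FT g)"
    unfolding ip_def
  proof (rule integral_dominated_convergence[OF _ _ integrable_norm[OF I]])
    show "AE \<xi> in lborel. (\<lambda>n. complex_of_real (gauss (real (Suc n)) \<xi>) * (FT h \<xi> * cnj (FT g \<xi>))) \<longlonglongrightarrow> FT h \<xi> * cnj (FT g \<xi>)"
    proof (rule AE_I2)
      fix \<xi>
      have "(\<lambda>n. complex_of_real (gauss (real (Suc n)) \<xi>) * (FT h \<xi> * cnj (FT g \<xi>))) \<longlonglongrightarrow> of_real 1 * (FT h \<xi> * cnj (FT g \<xi>))"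
        by (intro tendsto_intros gauss_tendsto)
      then show "(\<lambda>n. complex_of_real (gauss (real (Suc n)) \<xi>) * (FT h \<xi> * cnj (FT g \<xi>))) \<longlonglongrightarrow> FT h \<xi> * cnj (FT g \<xi>)" by simp
    qed
    show "AE \<xi> in lborel. cmod (complex_of_real (gauss (real (Suc n)) \<xi>) * (FT h \<xi> * cnj (FT g \<xi>))) \<le> cmod (FT h \<xi> * cnj (FT g \<xi>))" for n
      using gauss_pos[of "real (Suc n)"] gauss_le_1[of "real (Suc n)"]
      by (auto intro!: AE_I2 mult_left_le_one_le simp: norm_mult less_imp_le abs_of_pos)
  qed measurable
  obtain M where M: "\<And>y. cmod (g y) \<le> M" using g by (auto simp: compactly_supported_def)
  have eq: "?P n = (\<integral>x. h x * (\<integral>y. cnj (g y) * complex_of_real (normal_density 0 (1 / (2 * pi * real (Suc n))) (x - y)) \<partial>lborel) \<partial>lborel)" for n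
    by (rule gauss_pairing[OF _ h gi(1)]) simp
  show "?P \<longlonglongrightarrow> ip lborel h g"
    unfolding ip_def eq
  proof (rule integral_dominated_convergence[where w="\<lambda>x. M * cmod (h x)"])
    show "integrable lborel (\<lambda>x. M * cmod (h x))" by (intro integrable_mult_right integrable_norm h)
    show "AE x in lborel. (\<lambda>n. h x * (\<integral>y. cnj (g y) * complex_of_real (normal_density 0 (1 / (2 * pi * real (Suc n))) (x - y)) \<partial>lborel)) \<longlonglongrightarrow> h x * cnj (g x)"
      by (intro AE_I2 tendsto_mult tendsto_const gauss_smoothing_tendsto(1) g)
    show "AE x in lborel. cmod (h x * (\<integral>y. cnj (g y) * complex_of_real (normal_density 0 (1 / (2 * pi * real (Suc n))) (x - y)) \<partial>lborel)) \<le> M * cmod (h x)" for n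
    proof (rule AE_I2)
      fix x
      show "cmod (h x * (\<integral>y. cnj (g y) * complex_of_real (normal_density 0 (1 / (2 * pi * real (Suc n))) (x - y)) \<partial>lborel)) \<le> M * cmod (h x)"
        using mult_right_mono[OF gauss_smoothing_tendsto(2)[OF g M, of n x] norm_ge_zero[of "h x"]]
        by (simp only: norm_mult mult.commute)
    qed
  qed measurable
qed

text \<open>Density approximates g only in L2, which gives no pointwise control of the integrals
  defining the transforms. The contraction inequality, applied to the differences
  \<open>c n - g\<close>, carries the L2 convergence to the transforms.\<close>

lemma FT_Plancherel:
  assumes h: "integrable lborel h" "square_integrable lborel h"
    and g: "integrable lborel g" "square_integrable lborel g"
  shows "ip lborel (FT h) (FT g) = ip lborel h g"
proof -
  obtain c where c: "\<And>n. compactly_supported (c n)"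
      and lim: "(\<lambda>n::nat. sqn lborel (\<lambda>x. c n x - g x)) \<longlonglongrightarrow> 0"
    using compactly_supported_dense[OF g(2)] by auto
  note ci = compactly_supported_integrable[OF c]
  have "(\<lambda>n. sqn lborel (\<lambda>\<xi>. FT (c n) \<xi> - FT g \<xi>)) \<longlonglongrightarrow> 0"
  proof (rule tendsto_sandwich[OF _ _ tendsto_const lim])
    show "\<forall>\<^sub>F n in sequentially. sqn lborel (\<lambda>\<xi>. FT (c n) \<xi> - FT g \<xi>) \<le> sqn lborel (\<lambda>x. c n x - g x)"
    proof (rule always_eventually, rule allI)
      fix n
      have "FT (\<lambda>x. c n x - g x) = (\<lambda>\<xi>. FT (c n) \<xi> - FT g \<xi>)" using FT_diff[OF ci(1) g(1)] by auto
      then show "sqn lborel (\<lambda>\<xi>. FT (c n) \<xi> - FT g \<xi>) \<le> sqn lborel (\<lambda>x. c n x - g x)"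
        using FT_contraction(2)[OF Bochner_Integration.integrable_diff[OF ci(1) g(1)] square_integrable_diff[OF ci(2) g(2)]]
        by metis
    qed
  qed simp
  then have "(\<lambda>n. ip lborel (FT h) (FT (c n))) \<longlonglongrightarrow> ip lborel (FT h) (FT g)"
    by (intro ip_tendsto_right FT_contraction ci g h)
  moreover have "(\<lambda>n. ip lborel (FT h) (FT (c n))) \<longlonglongrightarrow> ip lborel h g"
    unfolding FT_Plancherel_compactly_supported[OF h c] by (intro ip_tendsto_right ci g h lim)
  ultimately show ?thesis by (rule LIMSEQ_unique)
qed

section \<open>The transform on L2 as a limit of truncated integrals; surjectivity\<close>

section \<open>The Fourier transform on square-integrable functions\<close>

lemma square_integrable_reflect:
  fixes f :: "real \<Rightarrow> complex"
  assumes f: "square_integrable lborel f"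
  shows "square_integrable lborel (\<lambda>x. f (- x))"
proof -
  note [measurable] = square_integrable_measurable[OF f]
  show ?thesis
    using f lborel_integrable_real_affine[of "\<lambda>x. (cmod (f x))\<^sup>2" "-1" 0]
    by (simp add: square_integrable_def)
qed

lemma sqn_reflect: "sqn lborel (\<lambda>x::real. f (- x)) = sqn lborel f"
  unfolding sqn_def using lborel_integral_real_affine[of "-1" "\<lambda>x. (cmod (f x))\<^sup>2" 0] by simp

lemma ip_reflect: "ip lborel (\<lambda>x::real. f (- x)) (\<lambda>x. g (- x)) = ip lborel f g"
  unfolding ip_def using lborel_integral_real_affine[of "-1" "\<lambda>x. f x * cnj (g x)" 0] by simp

text \<open>The symmetric integrals over [-N, N] in \<open>fourierL2\<close> are the values of
  \<open>FT (trunc N h)\<close>. For square-integrable h the truncation is also integrable, so the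
  results on L1 and L2 apply to it.\<close>

definition trunc :: "nat \<Rightarrow> (real \<Rightarrow> complex) \<Rightarrow> real \<Rightarrow> complex" where
  "trunc N h x = indicat_real {- real N..real N} x *\<^sub>R h x"

lemma trunc_integrable:
  assumes h: "square_integrable lborel h"
  shows "integrable lborel (trunc N h)"
proof -
  have "square_integrable lborel (\<lambda>x. complex_of_real (indicat_real {- real N..real N} x))"
    by (rule bounded_support_integrable(2)[where M=1 and R="real N"]) (auto simp: indicator_def)
  from square_integrable_mult[OF this h] show ?thesis
    by (simp add: trunc_def[abs_def] scaleR_conv_of_real)
qed

lemma trunc_square_integrable:
  assumes h: "square_integrable lborel h"
  shows "square_integrable lborel (trunc N h)"
proof -
  note [measurable] = square_integrable_measurable[OF h]
  show ?thesis
    by (rule square_integrable_bound[OF h, where C=1]) (auto simp: trunc_def[abs_def] indicator_def)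
qed

lemma trunc_tendsto:
  assumes h: "square_integrable lborel h"
  shows "(\<lambda>N. sqn lborel (\<lambda>x. trunc N h x - h x)) \<longlonglongrightarrow> 0"
proof (rule sqn_tendsto_dominated[OF h])
  show "trunc N h \<in> borel_measurable lborel" for N
    by (rule square_integrable_measurable[OF trunc_square_integrable[OF h]])
  show "AE x in lborel. (\<lambda>n. trunc n h x) \<longlonglongrightarrow> h x"
  proof (rule AE_I2)
    fix x
    have "trunc n h x = h x" if "n \<ge> nat \<lceil>\<bar>x\<bar>\<rceil>" for n
    proof -
      have "\<bar>x\<bar> \<le> real n" using that by linarith
      then show ?thesis by (auto simp: trunc_def indicator_def)
    qed
    then show "(\<lambda>n. trunc n h x) \<longlonglongrightarrow> h x"
      by (intro tendsto_eventually) (unfold eventually_sequentially, blast)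
  qed
  show "integrable lborel (\<lambda>x. (cmod (h x))\<^sup>2)" using h by (simp add: square_integrable_def)
qed (auto simp: trunc_def indicator_def)

lemma L2R_iff: "L2R h \<longleftrightarrow> square_integrable lborel h"
  by (simp add: L2R_def square_integrable_iff_nn)

lemma fourierL2_iff:
  assumes h: "square_integrable lborel h"
  shows "fourierL2 h g \<longleftrightarrow>
    square_integrable lborel g \<and> (\<lambda>N. sqn lborel (\<lambda>\<xi>. g \<xi> - FT (trunc N h) \<xi>)) \<longlonglongrightarrow> 0"
proof (cases "square_integrable lborel g")
  case True
  have "(LINT x:{- real N..real N}|lborel. h x * cis (- 2 * pi * x * \<xi>)) = FT (trunc N h) \<xi>" for N \<xi>
    by (simp add: FT_def trunc_def set_lebesgue_integral_def)
  moreover have "(\<integral>\<^sup>+ \<xi>. ennreal ((cmod (g \<xi> - FT (trunc N h) \<xi>))\<^sup>2) \<partial>lborel) =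
      ennreal (sqn lborel (\<lambda>\<xi>. g \<xi> - FT (trunc N h) \<xi>))" for N
    by (intro nn_sqn square_integrable_diff True FT_contraction trunc_integrable trunc_square_integrable h)
  moreover have "(\<lambda>N. ennreal (f N)) \<longlonglongrightarrow> 0 \<longleftrightarrow> f \<longlonglongrightarrow> 0" if "\<And>N. 0 \<le> f N" for f :: "nat \<Rightarrow> real"
    using that tendsto_ennreal_iff[of f sequentially 0] by simp
  ultimately show ?thesis
    using True unfolding fourierL2_def L2R_iff by simp
qed (simp add: fourierL2_def L2R_iff)

text \<open>The adjoint formula for truncations of f passes to the limit on both sides. This
  replaces pointwise values of an L2 transform by its pairings with integrable h, for which the
  wavelets are the intended instance.\<close>

lemma fourierL2_pairing:
  assumes f: "square_integrable lborel f" and fg: "fourierL2 f g"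
    and h: "integrable lborel h" "square_integrable lborel h"
  shows "ip lborel f (\<lambda>x. FT h (- x)) = ip lborel g h"
proof (rule LIMSEQ_unique)
  note ft = trunc_integrable[OF f] trunc_square_integrable[OF f]
  have g: "square_integrable lborel g" and lim: "(\<lambda>N. sqn lborel (\<lambda>\<xi>. g \<xi> - FT (trunc N f) \<xi>)) \<longlonglongrightarrow> 0"
    using fg fourierL2_iff[OF f] by auto
  have "(\<lambda>N. ip lborel (trunc N f) (\<lambda>x. FT h (- x))) \<longlonglongrightarrow> ip lborel f (\<lambda>x. FT h (- x))"
    by (intro ip_tendsto_left ft f square_integrable_reflect FT_contraction h trunc_tendsto)
  then show "(\<lambda>N. ip lborel (FT (trunc N f)) h) \<longlonglongrightarrow> ip lborel f (\<lambda>x. FT h (- x))"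
    by (simp only: FT_adjoint[OF ft(1) h(1)])
  show "(\<lambda>N. ip lborel (FT (trunc N f)) h) \<longlonglongrightarrow> ip lborel g h"
    using lim by (intro ip_tendsto_left FT_contraction ft g h) (simp add: sqn_diff_commute)
qed

text \<open>The candidate F is the L2 limit of the inverse transforms of truncations of g. That its
  transform is g follows from norms: the adjoint formula makes the cross term of g with
  \<open>FT (trunc N F)\<close> equal to the squared norm of \<open>trunc N F\<close>, so the
  squared distance is the difference of the squared norms of g and \<open>trunc N F\<close>, which
  tends to 0 because F and g have equal norm.\<close>

lemma fourierL2_surjective:
  assumes g: "square_integrable lborel g"
  shows "\<exists>f. square_integrable lborel f \<and> fourierL2 f g"
proof -
  have "\<exists>N. sqn lborel (\<lambda>x. trunc N g x - g x) \<le> 1 / 4 ^ n" for n :: nat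
  proof -
    have "\<forall>\<^sub>F N in sequentially. sqn lborel (\<lambda>x. trunc N g x - g x) < 1 / 4 ^ n"
      by (rule order_tendstoD(2)[OF trunc_tendsto[OF g]]) simp
    then show ?thesis by (auto simp: eventually_sequentially intro: less_imp_le)
  qed
  \<comment> \<open>Truncation levels are chosen so that the errors decrease geometrically, the rate
    that yields almost everywhere convergence of the transforms.\<close>
  then obtain r where r: "\<And>n. sqn lborel (\<lambda>x. trunc (r n) g x - g x) \<le> 1 / 4 ^ n" by metis
  define G where "G = (\<lambda>n. trunc (r n) g)"
  have G1: "integrable lborel (G n)" and G2: "square_integrable lborel (G n)" for n
    unfolding G_def by (intro trunc_integrable trunc_square_integrable g)+
  have Glim: "sqn lborel (\<lambda>x. G n x - g x) \<le> 1 / 4 ^ n" for n using r by (simp add: G_def)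
  define f where "f = (\<lambda>n x. FT (G n) (- x))"
  have f2: "square_integrable lborel (f n)" for n
    unfolding f_def by (intro square_integrable_reflect FT_contraction G1 G2)
  have f_norm: "sqn lborel (f n) = sqn lborel (G n)" for n
  proof -
    have "complex_of_real (sqn lborel (f n)) = complex_of_real (sqn lborel (G n))"
      unfolding f_def sqn_reflect ip_self[symmetric] by (rule FT_Plancherel[OF G1 G2 G1 G2])
    then show ?thesis by simp
  qed
  \<comment> \<open>For m \<ge> n both errors are at most 1 / 4^n and \<open>sqn_triangle\<close>
    doubles each, whence the constant 4.\<close>
  have f_diff: "sqn lborel (\<lambda>x. f m x - f n x) \<le> 4 / 4 ^ n" if "m \<ge> n" for m n
  proof -
    have "sqn lborel (\<lambda>x. f m x - f n x) = sqn lborel (FT (\<lambda>x. G m x - G n x))"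
      unfolding f_def FT_diff[OF G1 G1, symmetric] by (rule sqn_reflect)
    also have "\<dots> \<le> sqn lborel (\<lambda>x. G m x - G n x)"
      by (intro FT_contraction Bochner_Integration.integrable_diff square_integrable_diff G1 G2)
    also have "\<dots> \<le> 2 * sqn lborel (\<lambda>x. G m x - g x) + 2 * sqn lborel (\<lambda>x. g x - G n x)"
      by (rule sqn_triangle[OF G2 g G2])
    also have "\<dots> \<le> 2 * (1 / 4 ^ m) + 2 * (1 / 4 ^ n)"
      using Glim[of m] Glim[of n] by (simp add: sqn_diff_commute[of lborel g "G n"])
    also have "\<dots> \<le> 2 * (1 / 4 ^ n) + 2 * (1 / 4 ^ n)"
      using that by (intro add_mono mult_left_mono divide_left_mono power_increasing) auto
    finally show ?thesis by simp
  qed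
  obtain F where Fm: "F \<in> borel_measurable lborel" and Fae: "AE x in lborel. (\<lambda>n. f n x) \<longlonglongrightarrow> F x"
    by (rule square_integrable_fast_Cauchy[of lborel f 4]) (use f2 f_diff in auto)
  \<comment> \<open>Fatou in m with n fixed turns the Cauchy estimate into an estimate of the
    distance to the limit, and places F in L2 at the same time.\<close>
  have Ff: "square_integrable lborel (\<lambda>x. F x - f n x) \<and> sqn lborel (\<lambda>x. F x - f n x) \<le> 4 / 4 ^ n" for n
  proof -
    note [measurable] = Fm square_integrable_measurable[OF f2]
    have "AE x in lborel. (\<lambda>m. f m x - f n x) \<longlonglongrightarrow> F x - f n x"
      using Fae by eventually_elim (intro tendsto_intros)
    moreover have "(\<lambda>x. F x - f n x) \<in> borel_measurable lborel" by measurable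
    ultimately show ?thesis
      using square_integrable_Fatou[of lborel "\<lambda>m x. f m x - f n x" "\<lambda>x. F x - f n x" n "4 / 4 ^ n"]
        square_integrable_diff[OF f2 f2] f_diff by blast
  qed
  have F2: "square_integrable lborel F"
    using square_integrable_add[OF conjunct1[OF Ff[of 0]] f2[of 0]] by simp
  have p4: "(\<lambda>n. c / 4 ^ n) \<longlonglongrightarrow> 0" for c :: real
  proof -
    have "(\<lambda>n. c * (1 / 4) ^ n) \<longlonglongrightarrow> c * 0" by (intro tendsto_intros LIMSEQ_realpow_zero) auto
    then show ?thesis by (simp add: power_one_over)
  qed
  have f_F: "(\<lambda>n. sqn lborel (\<lambda>x. f n x - F x)) \<longlonglongrightarrow> 0"
    by (rule tendsto_sandwich[OF _ _ tendsto_const p4[of 4]])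
      (use Ff in \<open>auto simp: sqn_diff_commute[of lborel _ F]\<close>)
  have G_g: "(\<lambda>n. sqn lborel (\<lambda>x. G n x - g x)) \<longlonglongrightarrow> 0"
    by (rule tendsto_sandwich[OF _ _ tendsto_const p4[of 1]]) (use Glim in auto)
  have norm_eq: "sqn lborel F = sqn lborel g"
    using LIMSEQ_unique[OF sqn_tendsto[OF f2 F2 f_F]] sqn_tendsto[OF G2 g G_g] by (simp add: f_norm)
  note T1 = trunc_integrable[OF F2] and T2 = trunc_square_integrable[OF F2]
  \<comment> \<open>The pairing with g is computed as a limit of pairings with \<open>G n\<close>,
    for which the adjoint formula produces \<open>f n\<close>. Truncation is an orthogonal
    projection, so pairing \<open>trunc N F\<close> with F gives its squared norm.\<close>
  have pair: "ip lborel (FT (trunc N F)) g = of_real (sqn lborel (trunc N F))" for N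
  proof -
    have "(\<lambda>n. ip lborel (FT (trunc N F)) (G n)) \<longlonglongrightarrow> ip lborel (FT (trunc N F)) g"
      by (intro ip_tendsto_right G2 g FT_contraction T1 T2 G_g)
    moreover have "(\<lambda>n. ip lborel (FT (trunc N F)) (G n)) \<longlonglongrightarrow> ip lborel (trunc N F) F"
      unfolding FT_adjoint[OF T1 G1] f_def[symmetric]
      using f_F f2 by (intro ip_tendsto_right F2 T2) (auto simp: f_def)
    moreover have "ip lborel (trunc N F) F = ip lborel (trunc N F) (trunc N F)"
      unfolding ip_def by (intro Bochner_Integration.integral_cong) (auto simp: trunc_def indicator_def)
    ultimately show ?thesis using LIMSEQ_unique ip_self by metis
  qed
  have "sqn lborel (\<lambda>\<xi>. g \<xi> - FT (trunc N F) \<xi>) = sqn lborel g - sqn lborel (trunc N F)" for N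
  proof -
    have "complex_of_real (sqn lborel (FT (trunc N F))) = of_real (sqn lborel (trunc N F))"
      unfolding ip_self[symmetric] by (rule FT_Plancherel[OF T1 T2 T1 T2])
    moreover have "Re (ip lborel g (FT (trunc N F))) = sqn lborel (trunc N F)"
      using pair[of N] ip_cnj[of lborel "FT (trunc N F)" g] by (metis complex_cnj_complex_of_real Re_complex_of_real)
    ultimately show ?thesis
      by (subst sqn_diff[OF g FT_contraction(1)[OF T1 T2]]) simp
  qed
  moreover have "(\<lambda>N. sqn lborel g - sqn lborel (trunc N F)) \<longlonglongrightarrow> sqn lborel g - sqn lborel F"
    by (intro tendsto_intros sqn_tendsto T2 F2 trunc_tendsto)
  ultimately have "fourierL2 F g" unfolding fourierL2_iff[OF F2] using g norm_eq by simp
  with F2 show ?thesis by blast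
qed

section \<open>Normalization and exponential decay of the Laguerre functions\<close>

section \<open>Laguerre functions\<close>

text \<open>Pascal's rule in the form of finite differences: one more alternation replaces f(j) by
  f(j) - f(j+1).\<close>

lemma alternating_binomial_sum_Suc:
  fixes f :: "nat \<Rightarrow> real"
  shows "(\<Sum>j\<le>Suc k. (-1)^j * real (Suc k choose j) * f j) =
    (\<Sum>j\<le>k. (-1)^j * real (k choose j) * f j) - (\<Sum>j\<le>k. (-1)^j * real (k choose j) * f (Suc j))"
proof -
  have "(\<Sum>j\<le>k. (-1)^j * real (k choose j) * f j) = (\<Sum>j\<le>Suc k. (-1)^j * real (k choose j) * f j)"
    by simp
  also have "\<dots> = f 0 + (\<Sum>j\<le>k. (-1)^Suc j * real (k choose Suc j) * f (Suc j))"
    by (subst sum.atMost_Suc_shift) simp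
  finally have *: "(\<Sum>j\<le>k. (-1)^j * real (k choose j) * f j) =
     f 0 + (\<Sum>j\<le>k. (-1)^Suc j * real (k choose Suc j) * f (Suc j))" .
  show ?thesis unfolding *
    by (subst sum.atMost_Suc_shift) (simp add: algebra_simps sum.distrib sum_negf sum_subtractf)
qed

text \<open>As a function of j, the binomial coefficient is a polynomial of degree i, and each
  difference lowers its lower index by one. Differences of order k > i therefore vanish; for k = i a
  sign remains.\<close>

lemma alternating_binomial_sum_choose:
  "(\<Sum>j\<le>k. (-1)^j * real (k choose j) * real ((n + j) choose i)) =
     (if k \<le> i then (-1)^k * real (n choose (i - k)) else 0)"
proof (induction k arbitrary: n)
  case (Suc k)
  have "(\<Sum>j\<le>Suc k. (-1)^j * real (Suc k choose j) * real ((n + j) choose i)) =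
      (if k \<le> i then (-1)^k * real (n choose (i - k)) else 0) -
      (if k \<le> i then (-1)^k * real (Suc n choose (i - k)) else 0)"
    using Suc.IH[of n] Suc.IH[of "Suc n"] by (simp only: alternating_binomial_sum_Suc) simp
  also have "\<dots> = (if Suc k \<le> i then (-1)^Suc k * real (n choose (i - Suc k)) else 0)"
  proof (cases "k < i")
    case True
    then have "i - k = Suc (i - Suc k)" by simp
    then show ?thesis using True by (simp add: algebra_simps)
  qed auto
  finally show ?case .
qed simp

text \<open>This is int_0^oo e^(-t) L_k(t)^2 dt written in coefficients, as t^(i+j) integrates to
  (i+j)!. Dividing by i! j! gives a binomial coefficient, and the sum over j then kills every i <
  k.\<close>

lemma laguerre_norm_sum:
  "(\<Sum>i\<le>k. \<Sum>j\<le>k. ((-1)^i * real (k choose i) / fact i) * ((-1)^j * real (k choose j) / fact j) * fact (i + j)) = 1"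
proof -
  have "(\<Sum>i\<le>k. \<Sum>j\<le>k. ((-1)^i * real (k choose i) / fact i) * ((-1)^j * real (k choose j) / fact j) * fact (i + j))
     = (\<Sum>i\<le>k. (-1)^i * real (k choose i) * (\<Sum>j\<le>k. (-1)^j * real (k choose j) * real ((i + j) choose i)))"
    unfolding sum_distrib_left
  proof (intro sum.cong refl)
    fix i j
    have "real ((i + j) choose i) = fact (i + j) / (fact i * fact j)"
      by (subst binomial_fact) auto
    then show "((-1)^i * real (k choose i) / fact i) * ((-1)^j * real (k choose j) / fact j) * fact (i + j) =
       (-1)^i * real (k choose i) * ((-1)^j * real (k choose j) * real ((i + j) choose i))" by simp
  qed
  also have "\<dots> = (\<Sum>i\<le>k. if i = k then 1 else 0)"
    unfolding alternating_binomial_sum_choose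
    by (intro sum.cong refl) (auto simp: power_mult_distrib[symmetric])
  finally show ?thesis by simp
qed

lemma has_bochner_integral_power_exp:
  "has_bochner_integral lborel (\<lambda>t. indicat_real {0<..} t * (t ^ n * exp (- t))) (fact n)"
proof -
  have "has_bochner_integral lborel (\<lambda>t. t ^ n * exp (- t) * indicat_real {0..} t) (fact n)"
  proof (rule has_bochner_integral_nn_integral)
    show "(\<integral>\<^sup>+ t. ennreal (t ^ n * exp (- t) * indicat_real {0..} t) \<partial>lborel) = ennreal (fact n)"
    proof -
      have "ennreal (t ^ n * exp (- t) * indicat_real {0..} t) = ennreal (t ^ n * exp (- t)) * indicator {0..} t" for t
        by (simp split: split_indicator)
      then show ?thesis
        using nn_intergal_power_times_exp_Ici[of n] by simp
    qed
  qed (auto simp: indicator_def)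
  moreover have "AE t in lborel. t ^ n * exp (- t) * indicat_real {0..} t = indicat_real {0<..} t * (t ^ n * exp (- t))"
    using AE_lborel_singleton[of 0] by eventually_elim (auto simp: indicator_def)
  ultimately show ?thesis
    by (subst has_bochner_integral_cong_AE[symmetric]) (auto simp: mult.commute)
qed

lemma laguerre_measurable [measurable]: "laguerre k \<in> borel_measurable borel"
  unfolding laguerre_def[abs_def] by measurable

lemma ell_measurable [measurable]: "ell k \<in> borel_measurable borel"
  unfolding ell_def[abs_def] by measurable

lemma ell_square: "(ell k t)\<^sup>2 = exp (- t) * (laguerre k t)\<^sup>2"
  by (simp add: ell_def power_mult_distrib exp_double[symmetric])

lemma ell_normalized:
  "has_bochner_integral lborel (\<lambda>t. indicat_real {0<..} t * (ell k t)\<^sup>2) 1"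
proof -
  define c where "c = (\<lambda>i. (-1)^i * real (k choose i) / fact i)"
  have "has_bochner_integral lborel
     (\<lambda>t. \<Sum>i\<le>k. \<Sum>j\<le>k. (c i * c j) * (indicat_real {0<..} t * (t ^ (i + j) * exp (- t))))
     (\<Sum>i\<le>k. \<Sum>j\<le>k. (c i * c j) * fact (i + j))"
    by (intro has_bochner_integral_sum has_bochner_integral_mult_right has_bochner_integral_power_exp)
  moreover have "(\<Sum>i\<le>k. \<Sum>j\<le>k. (c i * c j) * (indicat_real {0<..} t * (t ^ (i + j) * exp (- t))))
      = indicat_real {0<..} t * (ell k t)\<^sup>2" for t
  proof -
    have "laguerre k t = (\<Sum>i\<le>k. c i * t ^ i)" by (simp add: laguerre_def c_def)
    then have "(laguerre k t)\<^sup>2 = (\<Sum>i\<le>k. \<Sum>j\<le>k. (c i * t ^ i) * (c j * t ^ j))"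
      by (simp add: power2_eq_square sum_product)
    then show ?thesis
      by (simp add: ell_square sum_distrib_left power_add mult_ac)
  qed
  ultimately show ?thesis using laguerre_norm_sum[of k] by (simp add: c_def)
qed

text \<open>A single term of the series of exp(t/4) bounds t^i / i! by 4^i exp(t/4). Half of the
  decay exp(-t/2) pays for the polynomial and the other half remains.\<close>

lemma ell_exp_bound: "\<exists>K\<ge>0. \<forall>t\<ge>0. \<bar>ell k t\<bar> \<le> K * exp (- t / 4)"
proof -
  define K where "K = (\<Sum>i\<le>k. real (k choose i) * 4 ^ i)"
  have "\<bar>ell k t\<bar> \<le> K * exp (- t / 4)" if t: "t \<ge> 0" for t
  proof -
    have summand: "\<bar>(-1)^i * real (k choose i) * t^i / fact i\<bar> \<le> real (k choose i) * 4 ^ i * exp (t / 4)" for i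
    proof -
      have "(t / 4)^i / fact i \<le> exp (t / 4)"
      proof -
        have "(\<Sum>n\<in>{i}. (t / 4)^n /\<^sub>R fact n) \<le> (\<Sum>n. (t / 4)^n /\<^sub>R fact n)"
          using t by (intro sum_le_suminf summable_exp_generic) auto
        moreover have "(t / 4)^i /\<^sub>R fact i = (t / 4)^i / fact i"
          unfolding real_scaleR_def divide_inverse[of "(t / 4)^i"] by (rule mult.commute)
        ultimately show ?thesis unfolding exp_def by simp
      qed
      then have "4 ^ i * ((t / 4)^i / fact i) \<le> 4 ^ i * exp (t / 4)" by (rule mult_left_mono) simp
      then have "t ^ i / fact i \<le> 4 ^ i * exp (t / 4)" by (simp add: power_divide)
      then have "real (k choose i) * (t ^ i / fact i) \<le> real (k choose i) * (4 ^ i * exp (t / 4))"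
        by (rule mult_left_mono) simp
      then show ?thesis using t by (simp add: abs_mult mult.assoc)
    qed
    have "\<bar>laguerre k t\<bar> \<le> K * exp (t / 4)"
      unfolding laguerre_def K_def sum_distrib_right
      by (rule order_trans[OF sum_abs sum_mono[OF summand]])
    then have "exp (- t / 2) * \<bar>laguerre k t\<bar> \<le> exp (- t / 2) * (K * exp (t / 4))"
      by (rule mult_left_mono) simp
    also have "\<dots> = K * exp (- t / 4)"
      by (simp add: mult_exp_exp[symmetric] mult.left_commute exp_add[symmetric])
    finally show ?thesis by (simp add: ell_def abs_mult)
  qed
  moreover have "K \<ge> 0" by (simp add: K_def sum_nonneg)
  ultimately show ?thesis by blast
qed

section \<open>Wavelet transforms expressed on the positive frequency half-line\<close>

section \<open>The wavelet subspaces\<close>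

text \<open>\<open>L2Rpos\<close> leaves the values off (0, oo) unrestricted. Setting them to 0
  gives an ordinary L2 function on the line and, in \<open>Wmap_Aspace\<close>, a transform
  supported on positive frequencies.\<close>

definition pos :: "(real \<Rightarrow> complex) \<Rightarrow> real \<Rightarrow> complex" where
  "pos \<phi> \<xi> = indicat_real {0<..} \<xi> *\<^sub>R \<phi> \<xi>"

lemma L2Rpos_square_integrable: "L2Rpos \<phi> \<Longrightarrow> square_integrable lborel (pos \<phi>)"
proof -
  assume \<phi>: "L2Rpos \<phi>"
  then have [measurable]: "\<phi> \<in> borel_measurable borel" by (simp add: L2Rpos_def)
  have "indicator {0<..} \<xi> * (cmod (\<phi> \<xi>))\<^sup>2 = (cmod (pos \<phi> \<xi>))\<^sup>2" for \<xi>
    by (simp add: pos_def indicator_def)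
  then show ?thesis
    using \<phi> unfolding L2Rpos_def square_integrable_iff_nn by (simp add: pos_def[abs_def])
qed

lemma L2Rpos_measurable: "L2Rpos \<phi> \<Longrightarrow> \<phi> \<in> borel_measurable borel"
  by (simp add: L2Rpos_def)

lemma L2RposI:
  assumes "\<phi> \<in> borel_measurable borel" "square_integrable lborel (pos \<phi>)"
  shows "L2Rpos \<phi>"
proof -
  have "indicator {0<..} \<xi> * (cmod (\<phi> \<xi>))\<^sup>2 = (cmod (pos \<phi> \<xi>))\<^sup>2" for \<xi>
    by (simp add: pos_def indicator_def)
  then show ?thesis
    using assms unfolding L2Rpos_def square_integrable_iff_nn by simp
qed

lemma square_integrable_L2Rpos:
  assumes g: "square_integrable lborel g" shows "L2Rpos g"
proof (rule L2RposI)
  show m: "g \<in> borel_measurable borel" using square_integrable_measurable[OF g] by simp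
  note [measurable] = m
  show "square_integrable lborel (pos g)"
    by (rule square_integrable_bound[OF g, where C=1]) (auto simp: pos_def[abs_def] indicator_def)
qed

lemma exp_integrable_Ioi:
  assumes c: "c > 0"
  shows "integrable lborel (\<lambda>\<xi>. indicat_real {0<..} \<xi> * exp (- c * \<xi>))"
proof -
  have "integrable lborel (\<lambda>t. indicat_real {0<..} t * exp (- t))"
    using has_bochner_integral_power_exp[of 0] by (simp add: has_bochner_integral_iff)
  from lborel_integrable_real_affine[OF this, of c 0]
  show ?thesis using c by (simp add: indicator_def zero_less_mult_iff)
qed

text \<open>The Fourier transform of \<open>\<rho>\<^sub>z \<psi>\<^sup>(\<^sup>k\<^sup>)\<close>.\<close>

definition atom :: "nat \<Rightarrow> real \<times> real \<Rightarrow> real \<Rightarrow> complex" where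
  "atom k z \<xi> = indicat_real {0<..} \<xi> *\<^sub>R
     (complex_of_real (snd z * (sqrt (2 * \<xi>) * ell k (2 * snd z * \<xi>))) * cis (- 2 * pi * \<xi> * fst z))"

lemma atom_measurable [measurable]: "atom k z \<in> borel_measurable borel"
  unfolding atom_def[abs_def] by measurable

text \<open>At t = 2 v \<xi> the Laguerre function decays like exp(-v \<xi> / 2). Half of this
  absorbs the growing factor sqrt(2 \<xi>), so the atom is both bounded and integrable.\<close>

lemma atom_bound:
  assumes v: "snd z > 0"
  shows "\<exists>C\<ge>0. \<forall>\<xi>. cmod (atom k z \<xi>) \<le> C * (indicat_real {0<..} \<xi> * exp (- (snd z / 4) * \<xi>))"
proof -
  obtain K where K: "K \<ge> 0" "\<And>t. t \<ge> 0 \<Longrightarrow> \<bar>ell k t\<bar> \<le> K * exp (- t / 4)" using ell_exp_bound by blast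
  let ?v = "snd z"
  let ?C = "?v * ((1 + 8 / ?v) * K)"
  have "cmod (atom k z \<xi>) \<le> ?C * (indicat_real {0<..} \<xi> * exp (- (?v / 4) * \<xi>))" for \<xi>
  proof (cases "\<xi> > 0")
    case True
    have "sqrt (2 * \<xi>) \<le> 1 + 2 * \<xi>"
      using True by (intro real_le_lsqrt) (auto simp: power2_eq_square algebra_simps)
    \<comment> \<open>The constant satisfies (8 / v) * (v / 4 * \<xi>) = 2 * \<xi>, which is the
      term to be dominated.\<close>
    also have "\<dots> \<le> (1 + 8 / ?v) * (1 + ?v / 4 * \<xi>)"
      using True v by (simp add: field_simps)
    also have "\<dots> \<le> (1 + 8 / ?v) * exp (?v / 4 * \<xi>)"
      using v by (intro mult_left_mono exp_ge_add_one_self) auto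
    finally have s: "sqrt (2 * \<xi>) \<le> (1 + 8 / ?v) * exp (?v / 4 * \<xi>)" .
    have e: "\<bar>ell k (2 * ?v * \<xi>)\<bar> \<le> K * exp (- (2 * ?v * \<xi>) / 4)"
      using True v by (intro K) auto
    have "sqrt (2 * \<xi>) * \<bar>ell k (2 * ?v * \<xi>)\<bar> \<le> ((1 + 8 / ?v) * exp (?v / 4 * \<xi>)) * (K * exp (- (2 * ?v * \<xi>) / 4))"
      using v True K(1) by (intro mult_mono s e) auto
    also have "\<dots> = (1 + 8 / ?v) * K * (exp (?v / 4 * \<xi>) * exp (- (2 * ?v * \<xi>) / 4))"
      by (simp only: mult_ac)
    also have "exp (?v / 4 * \<xi>) * exp (- (2 * ?v * \<xi>) / 4) = exp (- (?v / 4) * \<xi>)"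
      unfolding mult_exp_exp by (rule arg_cong[of _ _ exp]) simp
    finally have "?v * (sqrt (2 * \<xi>) * \<bar>ell k (2 * ?v * \<xi>)\<bar>) \<le> ?v * ((1 + 8 / ?v) * K * exp (- (?v / 4) * \<xi>))"
      using v by (intro mult_left_mono) auto
    then show ?thesis
      using True v by (simp add: atom_def norm_mult abs_mult mult.assoc)
  qed (simp add: atom_def)
  moreover have "?C \<ge> 0" using v K by simp
  ultimately show ?thesis by blast
qed

lemma atom_integrable:
  assumes v: "snd z > 0"
  shows "integrable lborel (atom k z)" "square_integrable lborel (atom k z)" "\<exists>C. \<forall>\<xi>. cmod (atom k z \<xi>) \<le> C"
proof -
  obtain C where C: "C \<ge> 0" "\<And>\<xi>. cmod (atom k z \<xi>) \<le> C * (indicat_real {0<..} \<xi> * exp (- (snd z / 4) * \<xi>))"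
    using atom_bound[OF v] by blast
  have i: "integrable lborel (\<lambda>\<xi>. C * (indicat_real {0<..} \<xi> * exp (- (snd z / 4) * \<xi>)))"
    using v by (intro integrable_mult_right exp_integrable_Ioi) simp
  show 1: "integrable lborel (atom k z)"
    by (rule Bochner_Integration.integrable_bound[OF i])
      (simp, unfold real_norm_def, intro AE_I2 order_trans[OF C(2) abs_ge_self])
  have b: "cmod (atom k z \<xi>) \<le> C" for \<xi>
  proof -
    have "indicat_real {0<..} \<xi> * exp (- (snd z / 4) * \<xi>) \<le> 1"
      using v by (simp add: indicator_def)
    from mult_left_mono[OF this C(1)] C(2)[of \<xi>] show ?thesis by simp
  qed
  then show "\<exists>C. \<forall>\<xi>. cmod (atom k z \<xi>) \<le> C" by blast
  show "square_integrable lborel (atom k z)"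
    unfolding square_integrable_def
  proof
    show "integrable lborel (\<lambda>\<xi>. (cmod (atom k z \<xi>))\<^sup>2)"
    proof (rule Bochner_Integration.integrable_bound)
      show "integrable lborel (\<lambda>\<xi>. C * cmod (atom k z \<xi>))"
        by (intro integrable_mult_right integrable_norm 1)
      show "AE \<xi> in lborel. norm ((cmod (atom k z \<xi>))\<^sup>2) \<le> norm (C * cmod (atom k z \<xi>))"
        using b C(1) by (auto intro!: AE_I2 mult_right_mono simp: power2_eq_square abs_mult)
    qed measurable
  qed simp
qed

text \<open>Conjugating the phase of the atom gives the integrand of \<open>Wmap\<close>. As an
  inner product, \<open>Wmap\<close> inherits linearity and the pairing formula for Fourier
  transforms.\<close>

lemma Wmap_ip: "Wmap k g z = ip lborel g (atom k z)"
proof -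
  have "Wmap k g z = (\<integral>\<xi>. complex_of_real (snd z) * (indicat_real {0<..} \<xi> *\<^sub>R (g \<xi> * complex_of_real (sqrt (2 * \<xi>) * ell k (2 * snd z * \<xi>))
      * cis (2 * pi * \<xi> * fst z))) \<partial>lborel)"
    unfolding Wmap_def set_lebesgue_integral_def by (rule integral_mult_right_zero[symmetric])
  also have "\<dots> = ip lborel g (atom k z)"
    unfolding ip_def
    by (intro Bochner_Integration.integral_cong) (auto simp: atom_def indicator_def cis_cnj)
  finally show ?thesis .
qed

lemma Wmap_pos: "Wmap k (pos g) z = Wmap k g z"
  unfolding Wmap_ip ip_def
  by (intro Bochner_Integration.integral_cong) (auto simp: atom_def pos_def indicator_def)

lemma Wmap_cong_AE:
  assumes "g \<in> borel_measurable borel" "h \<in> borel_measurable borel"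
    and "AE \<xi> in lborel. pos g \<xi> = pos h \<xi>"
  shows "Wmap k g z = Wmap k h z"
proof -
  have [measurable]: "pos g \<in> borel_measurable borel" "pos h \<in> borel_measurable borel"
    using assms(1,2) by (auto simp: pos_def[abs_def])
  have "Wmap k (pos g) z = Wmap k (pos h) z"
    unfolding Wmap_ip ip_def
    by (rule integral_cong_AE, measurable) (use assms(3) in eventually_elim, simp)
  then show ?thesis by (simp add: Wmap_pos)
qed

text \<open>The substitution \<eta> = v \<xi> in the integral defining \<open>psi\<close>
  contributes a Jacobian v, and sqrt(2 v \<xi>) cancels the normalization 1 / sqrt(v). The argument
  is reflected because \<open>psi\<close> is an inverse transform.\<close>

lemma rho_psi_FT:
  assumes v: "snd z > 0"
  shows "rho z (psi k) x = FT (atom k z) (- x)"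
proof -
  let ?v = "snd z" and ?u = "fst z"
  let ?f = "\<lambda>\<eta>. indicat_real {0<..} \<eta> *\<^sub>R (complex_of_real (sqrt (2 * \<eta>) * ell k (2 * \<eta>)) * cis (2 * pi * ((x - ?u) / ?v) * \<eta>))"
  have "psi k ((x - ?u) / ?v) = \<bar>?v\<bar> *\<^sub>R (\<integral>\<xi>. ?f (0 + ?v * \<xi>) \<partial>lborel)"
    unfolding psi_def set_lebesgue_integral_def using v by (intro lborel_integral_real_affine) simp
  then have "rho z (psi k) x = (\<integral>\<xi>. complex_of_real (?v / sqrt ?v) * ?f (?v * \<xi>) \<partial>lborel)"
    using v by (simp add: rho_def scaleR_conv_of_real)
  also have "\<dots> = FT (atom k z) (- x)"
    unfolding FT_def
  proof (intro Bochner_Integration.integral_cong refl)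
    fix \<xi>
    show "complex_of_real (?v / sqrt ?v) * ?f (?v * \<xi>) = atom k z \<xi> * cis (- 2 * pi * \<xi> * - x)"
    proof (cases "\<xi> > 0")
      case True
      have "?v / sqrt ?v * sqrt (2 * (?v * \<xi>)) = ?v * sqrt (2 * \<xi>)"
        using v by (simp add: real_sqrt_mult field_simps)
      then have "?v / sqrt ?v * (sqrt (2 * (?v * \<xi>)) * ell k (2 * (?v * \<xi>))) = ?v * (sqrt (2 * \<xi>) * ell k (2 * ?v * \<xi>))"
        by (simp only: mult.assoc[symmetric])
      then have 1: "complex_of_real (?v / sqrt ?v) * complex_of_real (sqrt (2 * (?v * \<xi>)) * ell k (2 * (?v * \<xi>)))
          = complex_of_real (?v * (sqrt (2 * \<xi>) * ell k (2 * ?v * \<xi>)))"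
        by (simp only: of_real_mult[symmetric])
      have 2: "cis (2 * pi * ((x - ?u) / ?v) * (?v * \<xi>)) = cis (- 2 * pi * \<xi> * ?u) * cis (- 2 * pi * \<xi> * - x)"
        using v by (simp add: cis_mult) (simp add: algebra_simps)
      have "complex_of_real (?v / sqrt ?v) * ?f (?v * \<xi>) =
          (complex_of_real (?v / sqrt ?v) * complex_of_real (sqrt (2 * (?v * \<xi>)) * ell k (2 * (?v * \<xi>))))
            * cis (2 * pi * ((x - ?u) / ?v) * (?v * \<xi>))"
        using True v by simp
      also have "\<dots> = atom k z \<xi> * cis (- 2 * pi * \<xi> * - x)"
        unfolding 1 2 using True by (simp add: atom_def)
      finally show ?thesis .
    next
      case False
      then have "\<not> 0 < ?v * \<xi>" using v by (simp add: zero_less_mult_iff)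
      then show ?thesis using False by (simp add: atom_def)
    qed
  qed
  finally show ?thesis .
qed

text \<open>The atom lies in L1 and L2, so it may take the place of h in
  \<open>fourierL2_pairing\<close>. The identity holds at each point with v > 0, not merely almost
  everywhere.\<close>

lemma wavelet_transform_eq_Wmap:
  assumes f: "square_integrable lborel f" and fg: "fourierL2 f g" and v: "snd z > 0"
  shows "(LINT x|lborel. f x * cnj (rho z (psi k) x)) = Wmap k g z"
  using fourierL2_pairing[OF f fg atom_integrable(1,2)[OF v]]
  by (simp add: rho_psi_FT[OF v] ip_def[of lborel f] Wmap_ip)

lemma Aspace_Wmap:
  assumes "F \<in> Aspace k"
  shows "\<exists>g. L2Rpos g \<and> (\<forall>z. snd z > 0 \<longrightarrow> F z = Wmap k g z)"
proof -
  obtain f where F: "F = (\<lambda>z. (LINT x|lborel. f x * cnj (rho z (psi k) x)))" and f: "H2plus f"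
    using assms by (auto simp: Aspace_def)
  then obtain g where fg: "fourierL2 f g" and f2: "square_integrable lborel f"
    by (auto simp: H2plus_def L2R_iff)
  then have "square_integrable lborel g" by (simp add: fourierL2_iff)
  then show ?thesis
    using wavelet_transform_eq_Wmap[OF f2 fg] square_integrable_L2Rpos unfolding F by blast
qed

text \<open>Surjectivity of the L2 transform, applied to \<open>pos \<phi>\<close>, produces a
  function whose transform vanishes at negative frequencies, hence a member of
  \<open>H2plus\<close>. Agreement is claimed for v > 0, a set of full \<open>nuG\<close>
  measure.\<close>

lemma Wmap_Aspace:
  assumes "L2Rpos \<phi>"
  shows "\<exists>F\<in>Aspace k. \<forall>z. snd z > 0 \<longrightarrow> F z = Wmap k \<phi> z"
proof -
  obtain f where f: "square_integrable lborel f" "fourierL2 f (pos \<phi>)"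
    using fourierL2_surjective[OF L2Rpos_square_integrable[OF assms]] by blast
  have "H2plus f"
    unfolding H2plus_def L2R_iff using f by (auto simp: pos_def intro!: exI[of _ "pos \<phi>"])
  then have "(\<lambda>z. (LINT x|lborel. f x * cnj (rho z (psi k) x))) \<in> Aspace k"
    unfolding Aspace_def by (intro CollectI exI conjI) (rule refl)
  then show ?thesis
    by (rule rev_bexI) (simp add: wavelet_transform_eq_Wmap[OF f] Wmap_pos)
qed

section \<open>Plancherel in u, averaging in v: isometry and sesquilinear forms\<close>

section \<open>The isometry and Toeplitz forms\<close>

text \<open>For \<open>\<xi> > 0\<close> this is a probability density in \<open>v\<close>, by the normalization of the Laguerre functions.\<close>

definition dens :: "nat \<Rightarrow> real \<Rightarrow> real \<Rightarrow> real" where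
  "dens k \<xi> v = indicat_real {0<..} \<xi> * (indicat_real {0<..} v * (2 * \<xi> * (ell k (2 * v * \<xi>))\<^sup>2))"

lemma dens_nonneg [simp]: "0 \<le> dens k \<xi> v"
  by (simp add: dens_def indicator_def)

lemma dens_measurable [measurable (raw)]:
  assumes [measurable]: "f \<in> borel_measurable M" "g \<in> borel_measurable M"
  shows "(\<lambda>x. dens k (f x) (g x)) \<in> borel_measurable M"
  unfolding dens_def by measurable

text \<open>The substitution t = 2 \<xi> v has Jacobian 2 \<xi> and reduces the mass to the norm of
  the Laguerre function. Its independence of \<xi> is what makes \<open>Wmap k\<close> an
  isometry.\<close>

lemma dens_integral:
  assumes "\<xi> > 0"
  shows "has_bochner_integral lborel (dens k \<xi>) 1"
proof -
  let ?f = "\<lambda>t. indicat_real {0<..} t * (ell k t)\<^sup>2"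
  have i: "integrable lborel ?f" "integral\<^sup>L lborel ?f = 1"
    using ell_normalized[of k] by (auto simp: has_bochner_integral_iff)
  have eq: "dens k \<xi> v = 2 * \<xi> * ?f (0 + (2 * \<xi>) * v)" for v
    using assms by (simp add: dens_def indicator_def zero_less_mult_iff mult_ac)
  have "integrable lborel (dens k \<xi>)"
    unfolding eq[abs_def] using assms by (intro integrable_mult_right lborel_integrable_real_affine i) simp
  moreover have "integral\<^sup>L lborel (dens k \<xi>) = 1"
    using lborel_integral_real_affine[of "2 * \<xi>" ?f 0] i(2) assms unfolding eq[abs_def] by simp
  ultimately show ?thesis by (simp add: has_bochner_integral_iff)
qed

lemma dens_nn_integral: "\<xi> > 0 \<Longrightarrow> (\<integral>\<^sup>+v. ennreal (dens k \<xi> v) \<partial>lborel) = 1"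
  using dens_integral[of \<xi> k] by (subst nn_integral_eq_integral) (auto simp: has_bochner_integral_iff)

lemma Wmap_measurable [measurable (raw)]:
  assumes [measurable]: "\<phi> \<in> borel_measurable borel"
  shows "Wmap k \<phi> \<in> borel_measurable borel"
  unfolding Wmap_def set_lebesgue_integral_def borel_prod[symmetric] by measurable

lemma nuG_alt:
  "nuG = density lborel (\<lambda>z. ennreal (indicat_real {0<..} (snd z) / (snd z)\<^sup>2))"
  unfolding nuG_def by (rule arg_cong[of _ _ "density lborel"]) (auto simp: indicator_def)

lemma sets_nuG [measurable_cong]: "sets nuG = sets borel"
  by (simp add: nuG_def)

lemma nuG_weight_measurable [measurable]:
  "(\<lambda>z::real \<times> real. indicat_real {0<..} (snd z) / (snd z)\<^sup>2) \<in> borel_measurable borel"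
proof -
  have "(\<lambda>v. indicat_real {0<..} v / v\<^sup>2) \<in> borel_measurable borel" by measurable
  moreover have "snd \<in> borel_measurable (borel :: (real \<times> real) measure)"
    by (intro borel_measurable_continuous_onI continuous_intros)
  ultimately show ?thesis by (rule measurable_compose[rotated])
qed

lemma AE_nuG: "AE z in nuG. snd z > 0"
  unfolding nuG_alt
  by (subst AE_density, use nuG_weight_measurable in measurable) (auto simp: indicator_def)

text \<open>\<open>\<phi>\<close> itself is only square integrable. The atom is square integrable
  and bounded, so the product lies in L1 and in L2, as Plancherel demands.\<close>

lemma section_integrable:
  assumes \<phi>: "square_integrable lborel (pos \<phi>)" and v: "v > 0"
  shows "integrable lborel (\<lambda>\<xi>. pos \<phi> \<xi> * atom k (0, v) \<xi>)"
    "square_integrable lborel (\<lambda>\<xi>. pos \<phi> \<xi> * atom k (0, v) \<xi>)"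
proof -
  have v': "snd (0::real, v) > 0" using v by simp
  note [measurable] = square_integrable_measurable[OF \<phi>]
  show "integrable lborel (\<lambda>\<xi>. pos \<phi> \<xi> * atom k (0, v) \<xi>)"
    by (rule square_integrable_mult[OF \<phi> atom_integrable(2)[OF v']])
  obtain C where C: "\<And>\<xi>. cmod (atom k (0::real, v) \<xi>) \<le> C" using atom_integrable(3)[OF v'] by blast
  show "square_integrable lborel (\<lambda>\<xi>. pos \<phi> \<xi> * atom k (0, v) \<xi>)"
  proof (rule square_integrable_bound[OF \<phi>])
    show "AE \<xi> in lborel. cmod (pos \<phi> \<xi> * atom k (0, v) \<xi>) \<le> C * cmod (pos \<phi> \<xi>)"
      using mult_right_mono[OF C norm_ge_zero] by (auto intro!: AE_I2 simp: norm_mult mult.commute)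
  qed measurable
qed

text \<open>The variable u enters the atom only through its phase, so for fixed v the map is a
  reflected Fourier transform in u.\<close>

lemma Wmap_section: "Wmap k \<phi> (u, v) = FT (\<lambda>\<xi>. pos \<phi> \<xi> * atom k (0, v) \<xi>) (- u)"
  unfolding Wmap_ip ip_def FT_def
  by (intro Bochner_Integration.integral_cong) (auto simp: atom_def pos_def indicator_def cis_cnj)

text \<open>The factor v^2 comes from the prefactor v of the atom and will cancel the weight v^(-2)
  of \<open>nuG\<close>.\<close>

lemma section_product:
  assumes "v > 0"
  shows "pos \<phi> \<xi> * atom k (0, v) \<xi> * cnj (pos \<psi> \<xi> * atom k (0, v) \<xi>) =
     complex_of_real (v\<^sup>2 * dens k \<xi> v) * (pos \<phi> \<xi> * cnj (pos \<psi> \<xi>))"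
proof (cases "\<xi> > 0")
  case True
  then have s: "complex_of_real (sqrt (2 * \<xi>)) * complex_of_real (sqrt (2 * \<xi>)) = complex_of_real (2 * \<xi>)"
    by (simp only: of_real_mult[symmetric]) simp
  have "atom k (0, v) \<xi> * cnj (atom k (0, v) \<xi>) = complex_of_real (v\<^sup>2 * dens k \<xi> v)"
    using True assms s by (simp add: atom_def dens_def power2_eq_square mult_ac)
  then show ?thesis by (simp add: mult_ac)
qed (simp add: pos_def)

lemma section_ip:
  assumes \<phi>: "square_integrable lborel (pos \<phi>)" and \<psi>: "square_integrable lborel (pos \<psi>)" and v: "v > 0"
  shows "(\<integral>u. Wmap k \<phi> (u, v) * cnj (Wmap k \<psi> (u, v)) \<partial>lborel) =
    (\<integral>\<xi>. complex_of_real (v\<^sup>2 * dens k \<xi> v) * (pos \<phi> \<xi> * cnj (pos \<psi> \<xi>)) \<partial>lborel)"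
proof -
  have "(\<integral>u. Wmap k \<phi> (u, v) * cnj (Wmap k \<psi> (u, v)) \<partial>lborel) =
     ip lborel (FT (\<lambda>\<xi>. pos \<phi> \<xi> * atom k (0, v) \<xi>)) (FT (\<lambda>\<xi>. pos \<psi> \<xi> * atom k (0, v) \<xi>))"
    unfolding Wmap_section ip_reflect[symmetric, of "FT (\<lambda>\<xi>. pos \<phi> \<xi> * atom k (0, v) \<xi>)"] by (simp add: ip_def)
  also have "\<dots> = ip lborel (\<lambda>\<xi>. pos \<phi> \<xi> * atom k (0, v) \<xi>) (\<lambda>\<xi>. pos \<psi> \<xi> * atom k (0, v) \<xi>)"
    by (intro FT_Plancherel section_integrable \<phi> \<psi> v)
  finally show ?thesis by (simp only: ip_def section_product[OF v])
qed

text \<open>Stated for nonnegative integrals, so that the order of integration may be exchanged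
  before square integrability on the half-plane is known; that integrability is then a
  consequence.\<close>

lemma Wmap_isometry_nn:
  assumes \<phi>: "L2Rpos \<phi>"
  shows "(\<integral>\<^sup>+z. ennreal ((cmod (Wmap k \<phi> z))\<^sup>2) \<partial>nuG) = ennreal (sqn lborel (pos \<phi>))"
proof -
  note p2 = L2Rpos_square_integrable[OF \<phi>]
  have [measurable]: "\<phi> \<in> borel_measurable borel" by (rule L2Rpos_measurable[OF \<phi>])
  have [measurable]: "pos \<phi> \<in> borel_measurable borel" using square_integrable_measurable[OF p2] by simp
  have Wu: "(\<lambda>u. Wmap k \<phi> (u, v)) \<in> borel_measurable borel" for v
    by (rule measurable_compose[where f="\<lambda>u. (u, v)", OF _ Wmap_measurable])
      (auto intro!: borel_measurable_continuous_onI continuous_intros)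
  let ?w = "\<lambda>v::real. ennreal (indicat_real {0<..} v / v\<^sup>2)"
  have "(\<integral>\<^sup>+z. ennreal ((cmod (Wmap k \<phi> z))\<^sup>2) \<partial>nuG) =
     (\<integral>\<^sup>+z. ?w (snd z) * ennreal ((cmod (Wmap k \<phi> z))\<^sup>2) \<partial>(lborel \<Otimes>\<^sub>M lborel))"
    unfolding nuG_alt lborel_prod by (subst nn_integral_density) (auto intro: nuG_weight_measurable)
  also have "\<dots> = (\<integral>\<^sup>+v. \<integral>\<^sup>+u. ?w v * ennreal ((cmod (Wmap k \<phi> (u, v)))\<^sup>2) \<partial>lborel \<partial>lborel)"
    by (subst lborel_pair.nn_integral_snd[symmetric]) (auto simp: lborel_prod)
  also have "\<dots> = (\<integral>\<^sup>+v. \<integral>\<^sup>+\<xi>. ennreal ((cmod (pos \<phi> \<xi>))\<^sup>2) * ennreal (dens k \<xi> v) \<partial>lborel \<partial>lborel)"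
  proof (rule nn_integral_cong)
    fix v :: real
    show "(\<integral>\<^sup>+u. ?w v * ennreal ((cmod (Wmap k \<phi> (u, v)))\<^sup>2) \<partial>lborel) =
       (\<integral>\<^sup>+\<xi>. ennreal ((cmod (pos \<phi> \<xi>))\<^sup>2) * ennreal (dens k \<xi> v) \<partial>lborel)"
    proof (cases "v > 0")
      case True
      let ?h = "\<lambda>\<xi>. pos \<phi> \<xi> * atom k (0, v) \<xi>"
      note h = section_integrable[OF p2 True, of k]
      have "(\<integral>\<^sup>+u. ennreal ((cmod (Wmap k \<phi> (u, v)))\<^sup>2) \<partial>lborel) = ennreal (sqn lborel (\<lambda>u. FT ?h (- u)))"
        unfolding Wmap_section by (rule nn_sqn) (intro square_integrable_reflect FT_contraction h)
      also have "sqn lborel (\<lambda>u. FT ?h (- u)) = sqn lborel ?h"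
      proof -
        have "complex_of_real (sqn lborel (FT ?h)) = complex_of_real (sqn lborel ?h)"
          unfolding ip_self[symmetric] by (rule FT_Plancherel[OF h h])
        then show ?thesis by (simp add: sqn_reflect)
      qed
      also have "ennreal (sqn lborel ?h) = (\<integral>\<^sup>+\<xi>. ennreal ((cmod (?h \<xi>))\<^sup>2) \<partial>lborel)"
        by (rule nn_sqn[symmetric, OF h(2)])
      finally have "(\<integral>\<^sup>+u. ?w v * ennreal ((cmod (Wmap k \<phi> (u, v)))\<^sup>2) \<partial>lborel) =
          (\<integral>\<^sup>+\<xi>. ?w v * ennreal ((cmod (?h \<xi>))\<^sup>2) \<partial>lborel)"
        using Wu[of v] by (simp add: nn_integral_cmult)
      also have "\<dots> = (\<integral>\<^sup>+\<xi>. ennreal ((cmod (pos \<phi> \<xi>))\<^sup>2) * ennreal (dens k \<xi> v) \<partial>lborel)"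
      proof (rule nn_integral_cong)
        fix \<xi>
        have "complex_of_real ((cmod (?h \<xi>))\<^sup>2) = complex_of_real (v\<^sup>2 * dens k \<xi> v * (cmod (pos \<phi> \<xi>))\<^sup>2)"
          using section_product[OF True, of \<phi> \<xi> k \<phi>] by (simp only: complex_norm_square of_real_mult)
        then have "(cmod (?h \<xi>))\<^sup>2 = v\<^sup>2 * dens k \<xi> v * (cmod (pos \<phi> \<xi>))\<^sup>2" by (simp only: of_real_eq_iff)
        then have "indicat_real {0<..} v / v\<^sup>2 * (cmod (?h \<xi>))\<^sup>2 = (cmod (pos \<phi> \<xi>))\<^sup>2 * dens k \<xi> v"
          using True by simp
        then show "?w v * ennreal ((cmod (?h \<xi>))\<^sup>2) = ennreal ((cmod (pos \<phi> \<xi>))\<^sup>2) * ennreal (dens k \<xi> v)"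
          by (simp only: ennreal_mult[symmetric] zero_le_power2 dens_nonneg divide_nonneg_nonneg indicator_pos_le)
      qed
      finally show ?thesis .
    qed (simp add: dens_def)
  qed
  also have "\<dots> = (\<integral>\<^sup>+\<xi>. \<integral>\<^sup>+v. ennreal ((cmod (pos \<phi> \<xi>))\<^sup>2) * ennreal (dens k \<xi> v) \<partial>lborel \<partial>lborel)"
    by (rule lborel_pair.Fubini') measurable
  also have "\<dots> = (\<integral>\<^sup>+\<xi>. ennreal ((cmod (pos \<phi> \<xi>))\<^sup>2) \<partial>lborel)"
  proof (rule nn_integral_cong)
    fix \<xi>
    show "(\<integral>\<^sup>+v. ennreal ((cmod (pos \<phi> \<xi>))\<^sup>2) * ennreal (dens k \<xi> v) \<partial>lborel) = ennreal ((cmod (pos \<phi> \<xi>))\<^sup>2)"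
      by (cases "\<xi> > 0") (auto simp: nn_integral_cmult dens_nn_integral pos_def)
  qed
  also have "\<dots> = ennreal (sqn lborel (pos \<phi>))" by (rule nn_sqn[OF p2])
  finally show ?thesis .
qed

lemma Wmap_square_integrable: "L2Rpos \<phi> \<Longrightarrow> square_integrable nuG (Wmap k \<phi>)"
  unfolding square_integrable_iff_nn measurable_cong_sets[OF sets_nuG refl]
  by (auto simp: Wmap_isometry_nn intro: Wmap_measurable L2Rpos_measurable)

text \<open>An average of a against the probability density \<open>dens k \<xi>\<close>, so a bound
  for a on (0, oo) is inherited. For \<xi> \<le> 0 the value is 0, which lets that bound hold for
  all \<xi>.\<close>

definition spectral_symbol :: "(real \<Rightarrow> complex) \<Rightarrow> nat \<Rightarrow> real \<Rightarrow> complex" where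
  "spectral_symbol a k \<xi> = (\<integral>v. a v * complex_of_real (dens k \<xi> v) \<partial>lborel)"

lemma spectral_symbol_measurable [measurable]:
  assumes [measurable]: "a \<in> borel_measurable borel"
  shows "spectral_symbol a k \<in> borel_measurable borel"
  unfolding spectral_symbol_def[abs_def] by measurable

lemma spectral_symbol_bound:
  assumes [measurable]: "a \<in> borel_measurable borel" and B: "\<And>v. v > 0 \<Longrightarrow> cmod (a v) \<le> B"
  shows "cmod (spectral_symbol a k \<xi>) \<le> B"
proof (cases "\<xi> > 0")
  case True
  have i: "integrable lborel (dens k \<xi>)" "integral\<^sup>L lborel (dens k \<xi>) = 1"
    using dens_integral[OF True] by (auto simp: has_bochner_integral_iff)
  have "cmod (spectral_symbol a k \<xi>) \<le> (\<integral>v. B * dens k \<xi> v \<partial>lborel)"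
    unfolding spectral_symbol_def
  proof -
    have le: "cmod (a v * complex_of_real (dens k \<xi> v)) \<le> B * dens k \<xi> v" for v
    proof (cases "v > 0")
      case True
      then show ?thesis by (simp add: norm_mult B mult_right_mono)
    qed (simp add: dens_def)
    have int: "integrable lborel (\<lambda>v. a v * complex_of_real (dens k \<xi> v))"
      by (rule Bochner_Integration.integrable_bound[OF integrable_mult_right[OF i(1), of B]])
        (measurable, unfold real_norm_def, intro AE_I2 order_trans[OF le abs_ge_self])
    show "cmod (\<integral>v. a v * complex_of_real (dens k \<xi> v) \<partial>lborel) \<le> (\<integral>v. B * dens k \<xi> v \<partial>lborel)"
      by (rule order_trans[OF integral_norm_bound integral_mono[OF integrable_norm[OF int] integrable_mult_right[OF i(1)] le]])
  qed
  then show ?thesis using i by simp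
next
  case False
  have "0 \<le> B" using order_trans[OF norm_ge_zero B[of 1]] by simp
  then show ?thesis using False by (simp add: spectral_symbol_def dens_def)
qed

text \<open>For fixed v the symbol is constant and Plancherel in u applies; exchanging v and \<xi>
  then leaves the average of a over v. Integrability for the first splitting comes from the
  isometry, for the exchange from the unit mass of \<open>dens\<close>.\<close>

lemma Toeplitz_form:
  assumes [measurable]: "a \<in> borel_measurable borel" and B: "\<And>v. v > 0 \<Longrightarrow> cmod (a v) \<le> B"
    and \<phi>: "L2Rpos \<phi>" and \<psi>: "L2Rpos \<psi>"
  shows "square_integrable nuG (\<lambda>z. a (snd z) * Wmap k \<phi> z)"
    and "ip nuG (\<lambda>z. a (snd z) * Wmap k \<phi> z) (Wmap k \<psi>) =
       ip lborel (\<lambda>\<xi>. spectral_symbol a k \<xi> * pos \<phi> \<xi>) (pos \<psi>)"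
proof -
  note p2 = L2Rpos_square_integrable[OF \<phi>] and q2 = L2Rpos_square_integrable[OF \<psi>]
  have [measurable]: "\<phi> \<in> borel_measurable borel" "\<psi> \<in> borel_measurable borel"
    using L2Rpos_measurable \<phi> \<psi> by auto
  have [measurable]: "pos \<phi> \<in> borel_measurable borel" "pos \<psi> \<in> borel_measurable borel"
    using square_integrable_measurable[OF p2] square_integrable_measurable[OF q2] by auto
  have am [measurable]: "(\<lambda>z::real \<times> real. a (snd z)) \<in> borel_measurable borel"
    unfolding borel_prod[symmetric] by measurable
  show s: "square_integrable nuG (\<lambda>z. a (snd z) * Wmap k \<phi> z)"
  proof (rule square_integrable_bound[OF Wmap_square_integrable[OF \<phi>]])
    show "AE z in nuG. cmod (a (snd z) * Wmap k \<phi> z) \<le> B * cmod (Wmap k \<phi> z)"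
      using AE_nuG by eventually_elim (auto simp: norm_mult intro!: mult_right_mono B)
  qed measurable
  let ?w = "\<lambda>v::real. indicat_real {0<..} v / v\<^sup>2"
  let ?F = "\<lambda>z. a (snd z) * Wmap k \<phi> z * cnj (Wmap k \<psi> z)"
  let ?P = "\<lambda>\<xi>. pos \<phi> \<xi> * cnj (pos \<psi> \<xi>)"
  have wn: "AE z in lborel. 0 \<le> ?w (snd (z :: real \<times> real))" by simp
  have "integrable nuG ?F" by (rule square_integrable_ip[OF s Wmap_square_integrable[OF \<psi>]])
  then have i: "integrable (lborel \<Otimes>\<^sub>M lborel) (\<lambda>(u, v). ?w v *\<^sub>R ?F (u, v))"
    unfolding nuG_alt lborel_prod by (subst (asm) integrable_density) (auto simp: case_prod_unfold)
  have "ip nuG (\<lambda>z. a (snd z) * Wmap k \<phi> z) (Wmap k \<psi>) = (\<integral>z. ?w (snd z) *\<^sub>R ?F z \<partial>(lborel \<Otimes>\<^sub>M lborel))"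
    unfolding ip_def nuG_alt lborel_prod by (subst integral_density) auto
  also have "\<dots> = (\<integral>v. (\<integral>u. ?w v *\<^sub>R ?F (u, v) \<partial>lborel) \<partial>lborel)"
    by (subst lborel_pair.integral_snd[OF i]) (simp add: case_prod_unfold)
  also have "\<dots> = (\<integral>v. (\<integral>\<xi>. a v * complex_of_real (dens k \<xi> v) * ?P \<xi> \<partial>lborel) \<partial>lborel)"
  proof (rule Bochner_Integration.integral_cong)
    fix v :: real
    show "(\<integral>u. ?w v *\<^sub>R ?F (u, v) \<partial>lborel) = (\<integral>\<xi>. a v * complex_of_real (dens k \<xi> v) * ?P \<xi> \<partial>lborel)"
    proof (cases "v > 0")
      case True
      have "(\<integral>u. ?w v *\<^sub>R ?F (u, v) \<partial>lborel) =
          (\<integral>u. (complex_of_real (?w v) * a v) * (Wmap k \<phi> (u, v) * cnj (Wmap k \<psi> (u, v))) \<partial>lborel)"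
        by (simp only: scaleR_conv_of_real mult.assoc snd_conv)
      also have "\<dots> = (complex_of_real (?w v) * a v) * (\<integral>\<xi>. complex_of_real (v\<^sup>2 * dens k \<xi> v) * ?P \<xi> \<partial>lborel)"
        by (simp only: integral_mult_right_zero section_ip[OF p2 q2 True])
      also have "\<dots> = (\<integral>\<xi>. (complex_of_real (?w v) * a v) * (complex_of_real (v\<^sup>2 * dens k \<xi> v) * ?P \<xi>) \<partial>lborel)"
        by (rule integral_mult_right_zero[symmetric])
      also have "\<dots> = (\<integral>\<xi>. a v * complex_of_real (dens k \<xi> v) * ?P \<xi> \<partial>lborel)"
        using True by (intro Bochner_Integration.integral_cong) auto
      finally show ?thesis .
    qed (simp add: dens_def)
  qed simp
  also have "\<dots> = (\<integral>\<xi>. (\<integral>v. a v * complex_of_real (dens k \<xi> v) * ?P \<xi> \<partial>lborel) \<partial>lborel)"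
  proof (rule lborel_pair.Fubini_integral)
    have Pi: "integrable lborel ?P" by (rule square_integrable_ip[OF p2 q2])
    have nz: "?P \<xi> = 0" if "\<not> \<xi> > 0" for \<xi> using that by (simp add: pos_def)
    have di: "integrable lborel (dens k \<xi>) \<and> integral\<^sup>L lborel (dens k \<xi>) = 1" if "\<xi> > 0" for \<xi>
      using dens_integral[OF that] by (auto simp: has_bochner_integral_iff)
    \<comment> \<open>This majorant integrates over v to B times the modulus of the product of the
      two half-line functions, because \<open>dens\<close> has mass 1 wherever that product is
      nonzero.\<close>
    have i: "integrable (lborel \<Otimes>\<^sub>M lborel) (\<lambda>(\<xi>, v). B * (dens k \<xi> v * cmod (?P \<xi>)))"
    proof (rule lborel_pair.Fubini_integrable)
      have "(\<integral>v. norm (B * (dens k \<xi> v * cmod (?P \<xi>))) \<partial>lborel) = \<bar>B\<bar> * cmod (?P \<xi>)" for \<xi>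
        using di[of \<xi>] nz[of \<xi>] by (cases "\<xi> > 0") (simp_all add: abs_mult)
      then show "integrable lborel (\<lambda>\<xi>. \<integral>v. norm (case (\<xi>, v) of (\<xi>, v) \<Rightarrow> B * (dens k \<xi> v * cmod (?P \<xi>))) \<partial>lborel)"
        using integrable_mult_right[OF integrable_norm[OF Pi], of "\<bar>B\<bar>"] by simp
      show "AE \<xi> in lborel. integrable lborel (\<lambda>v. case (\<xi>, v) of (\<xi>, v) \<Rightarrow> B * (dens k \<xi> v * cmod (?P \<xi>)))"
      proof (rule AE_I2)
        fix \<xi> :: real
        show "integrable lborel (\<lambda>v. case (\<xi>, v) of (\<xi>, v) \<Rightarrow> B * (dens k \<xi> v * cmod (?P \<xi>)))"
          using di[of \<xi>] nz[of \<xi>] by (cases "\<xi> > 0") simp_all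
      qed
    qed measurable
    show "integrable (lborel \<Otimes>\<^sub>M lborel) (\<lambda>(\<xi>, v). a v * complex_of_real (dens k \<xi> v) * ?P \<xi>)"
    proof (rule Bochner_Integration.integrable_bound[OF i])
      show "AE x in lborel \<Otimes>\<^sub>M lborel. cmod (case x of (\<xi>, v) \<Rightarrow> a v * complex_of_real (dens k \<xi> v) * ?P \<xi>)
         \<le> norm (case x of (\<xi>, v) \<Rightarrow> B * (dens k \<xi> v * cmod (?P \<xi>)))"
      proof (rule AE_I2, clarify)
        fix \<xi> v :: real
        have "cmod (a v * complex_of_real (dens k \<xi> v) * ?P \<xi>) = cmod (a v) * (dens k \<xi> v * cmod (?P \<xi>))"
          by (simp add: norm_mult)
        also have "\<dots> \<le> B * (dens k \<xi> v * cmod (?P \<xi>))"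
        proof (cases "v > 0")
          case True
          then show ?thesis by (intro mult_right_mono B) auto
        qed (simp add: dens_def)
        also have "\<dots> \<le> norm (B * (dens k \<xi> v * cmod (?P \<xi>)))" by simp
        finally show "cmod (a v * complex_of_real (dens k \<xi> v) * ?P \<xi>) \<le> norm (B * (dens k \<xi> v * cmod (?P \<xi>)))" .
      qed
    qed measurable
  qed
  also have "\<dots> = (\<integral>\<xi>. spectral_symbol a k \<xi> * ?P \<xi> \<partial>lborel)"
    unfolding spectral_symbol_def by (simp only: integral_mult_left_zero)
  finally show "ip nuG (\<lambda>z. a (snd z) * Wmap k \<phi> z) (Wmap k \<psi>) =
       ip lborel (\<lambda>\<xi>. spectral_symbol a k \<xi> * pos \<phi> \<xi>) (pos \<psi>)"
    by (simp add: ip_def mult.assoc)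
qed

section \<open>From forms to operators, and the multipliers attached to symbols\<close>

section \<open>Toeplitz operators as multiplication operators\<close>

lemma psi_measurable [measurable]: "psi k \<in> borel_measurable borel"
  unfolding psi_def[abs_def] set_lebesgue_integral_def by measurable

lemma Aspace_measurable:
  assumes "F \<in> Aspace k" shows "F \<in> borel_measurable borel"
proof -
  obtain f where F: "F = (\<lambda>z. (LINT x|lborel. f x * cnj (rho z (psi k) x)))" and f: "H2plus f"
    using assms by (auto simp: Aspace_def)
  have [measurable]: "f \<in> borel_measurable borel" using f by (simp add: H2plus_def L2R_def)
  show ?thesis unfolding F rho_def borel_prod[symmetric] by measurable
qed

lemma innerG_ip: "innerG F H = ip nuG F H"
  by (simp add: innerG_def ip_def)

lemma ip_cong_AE:
  assumes "F \<in> borel_measurable M" "F' \<in> borel_measurable M" "H \<in> borel_measurable M" "H' \<in> borel_measurable M"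
    and "AE z in M. F z = F' z" "AE z in M. H z = H' z"
  shows "ip M F H = ip M F' H'"
  unfolding ip_def
proof (rule integral_cong_AE)
  note [measurable] = assms(1-4)
  show "(\<lambda>z. F z * cnj (H z)) \<in> borel_measurable M" "(\<lambda>z. F' z * cnj (H' z)) \<in> borel_measurable M"
    by measurable
  show "AE z in M. F z * cnj (H z) = F' z * cnj (H' z)"
    using assms(5,6) by eventually_elim simp
qed

lemma spectral_symbol_one: "\<xi> > 0 \<Longrightarrow> spectral_symbol (\<lambda>_. 1) k \<xi> = 1"
  using dens_integral[of \<xi> k] by (simp add: spectral_symbol_def has_bochner_integral_iff)

text \<open>The constant symbol 1 has multiplier 1 on (0, oo), so the polarized isometry is a case
  of \<open>Toeplitz_form\<close>.\<close>

lemma Wmap_ip_nuG: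
  assumes "L2Rpos \<phi>" "L2Rpos \<psi>"
  shows "ip nuG (Wmap k \<phi>) (Wmap k \<psi>) = ip lborel (pos \<phi>) (pos \<psi>)"
proof -
  have "ip nuG (Wmap k \<phi>) (Wmap k \<psi>) = ip lborel (\<lambda>\<xi>. spectral_symbol (\<lambda>_. 1) k \<xi> * pos \<phi> \<xi>) (pos \<psi>)"
    using Toeplitz_form(2)[of "\<lambda>_. 1" 1, OF _ _ assms] by simp
  also have "\<dots> = ip lborel (pos \<phi>) (pos \<psi>)"
    unfolding ip_def
    by (intro Bochner_Integration.integral_cong) (auto simp: pos_def indicator_def spectral_symbol_one)
  finally show ?thesis .
qed

lemma L2Rpos_mult:
  assumes \<phi>: "L2Rpos \<phi>" and [measurable]: "s \<in> borel_measurable borel" and B: "\<And>\<xi>. \<xi> > 0 \<Longrightarrow> cmod (s \<xi>) \<le> B"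
  shows "L2Rpos (\<lambda>\<xi>. s \<xi> * \<phi> \<xi>)"
proof (rule L2RposI)
  have [measurable]: "\<phi> \<in> borel_measurable borel" by (rule L2Rpos_measurable[OF \<phi>])
  show "(\<lambda>\<xi>. s \<xi> * \<phi> \<xi>) \<in> borel_measurable borel" by measurable
  show "square_integrable lborel (pos (\<lambda>\<xi>. s \<xi> * \<phi> \<xi>))"
  proof (rule square_integrable_bound[OF L2Rpos_square_integrable[OF \<phi>]])
    show "AE \<xi> in lborel. cmod (pos (\<lambda>\<xi>. s \<xi> * \<phi> \<xi>) \<xi>) \<le> B * cmod (pos \<phi> \<xi>)"
      using B by (auto simp: pos_def indicator_def norm_mult intro!: AE_I2 mult_right_mono)
  qed (simp add: pos_def[abs_def])
qed

lemma pos_mult: "pos (\<lambda>\<xi>. s \<xi> * \<phi> \<xi>) = (\<lambda>\<xi>. s \<xi> * pos \<phi> \<xi>)"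
  by (auto simp: pos_def indicator_def)

text \<open>An explicit element satisfies the defining property of the projection, so the choice
  satisfies it too; testing against the difference then shows that the two agree for v > 0. F is
  prescribed only for v > 0, as later iterates are outputs of the choice and are known only
  there.\<close>

lemma toep_Wmap:
  assumes a: "a \<in> borel_measurable borel" and B: "\<And>v. v > 0 \<Longrightarrow> cmod (a v) \<le> B"
    and \<phi>: "L2Rpos \<phi>" and F: "F \<in> borel_measurable borel" "\<And>z. snd z > 0 \<Longrightarrow> F z = Wmap k \<phi> z"
  shows "toep a k F \<in> Aspace k"
    and "snd z > 0 \<Longrightarrow> toep a k F z = Wmap k (\<lambda>\<xi>. spectral_symbol a k \<xi> * \<phi> \<xi>) z"
proof -
  note [measurable] = a F(1)
  define s where "s = (\<lambda>\<xi>. spectral_symbol a k \<xi> * \<phi> \<xi>)"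
  have s: "L2Rpos s"
    unfolding s_def by (intro L2Rpos_mult[where B=B] \<phi> spectral_symbol_measurable spectral_symbol_bound a B)
  \<comment> \<open>Translates orthogonality on the half-plane into orthogonality on the half-line,
    for any candidate G and test function H; it serves both existence and uniqueness.\<close>
  have form: "innerG (\<lambda>z. a (snd z) * F z - G z) H = ip lborel (\<lambda>\<xi>. pos s \<xi> - pos g \<xi>) (pos h)"
    if G: "G \<in> Aspace k" "L2Rpos g" "\<And>z. snd z > 0 \<Longrightarrow> G z = Wmap k g z"
      and H: "H \<in> Aspace k" "L2Rpos h" "\<And>z. snd z > 0 \<Longrightarrow> H z = Wmap k h z" for G H g h
  proof -
    have [measurable]: "G \<in> borel_measurable borel" "H \<in> borel_measurable borel"
      using G H Aspace_measurable by auto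
    have [measurable]: "Wmap k \<phi> \<in> borel_measurable borel" "Wmap k g \<in> borel_measurable borel" "Wmap k h \<in> borel_measurable borel"
      by (intro Wmap_measurable L2Rpos_measurable \<phi> G H)+
    have [measurable]: "(\<lambda>z::real \<times> real. a (snd z)) \<in> borel_measurable borel"
      unfolding borel_prod[symmetric] by measurable
    have "innerG (\<lambda>z. a (snd z) * F z - G z) H = ip nuG (\<lambda>z. a (snd z) * Wmap k \<phi> z - Wmap k g z) (Wmap k h)"
      unfolding innerG_ip
    proof (rule ip_cong_AE)
      show "AE z in nuG. a (snd z) * F z - G z = a (snd z) * Wmap k \<phi> z - Wmap k g z"
        using AE_nuG by eventually_elim (simp add: F G)
      show "AE z in nuG. H z = Wmap k h z"
        using AE_nuG by eventually_elim (simp add: H)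
    qed measurable
    also have "\<dots> = ip nuG (\<lambda>z. a (snd z) * Wmap k \<phi> z) (Wmap k h) - ip nuG (Wmap k g) (Wmap k h)"
      by (intro ip_diff_left Toeplitz_form(1)[OF a B \<phi> \<phi>] Wmap_square_integrable G H)
    also have "\<dots> = ip lborel (pos s) (pos h) - ip lborel (pos g) (pos h)"
      using Toeplitz_form(2)[OF a B \<phi> H(2)] Wmap_ip_nuG[OF G(2) H(2)] by (simp add: s_def pos_mult)
    also have "\<dots> = ip lborel (\<lambda>\<xi>. pos s \<xi> - pos g \<xi>) (pos h)"
      by (intro ip_diff_left[symmetric] L2Rpos_square_integrable s G H)
    finally show ?thesis .
  qed
  let ?Q = "\<lambda>G. G \<in> Aspace k \<and> (\<forall>H\<in>Aspace k. innerG (\<lambda>z. a (snd z) * F z - G z) H = 0)"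
  obtain G0 where G0: "G0 \<in> Aspace k" "\<And>z. snd z > 0 \<Longrightarrow> G0 z = Wmap k s z"
    using Wmap_Aspace[OF s] by blast
  have "?Q G0"
  proof (intro conjI ballI G0)
    fix H assume H: "H \<in> Aspace k"
    obtain h where "L2Rpos h" "\<And>z. snd z > 0 \<Longrightarrow> H z = Wmap k h z" using Aspace_Wmap[OF H] by blast
    from form[OF G0(1) s G0(2) H this] show "innerG (\<lambda>z. a (snd z) * F z - G0 z) H = 0"
      by (simp add: ip_def)
  qed
  then have Q: "?Q (toep a k F)"
    unfolding toep_def projA_def by (rule someI[of ?Q])
  then show T: "toep a k F \<in> Aspace k" by blast
  obtain g where g: "L2Rpos g" "\<And>z. snd z > 0 \<Longrightarrow> toep a k F z = Wmap k g z"
    using Aspace_Wmap[OF T] by blast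
  \<comment> \<open>The difference of the two half-line functions is itself admissible, so an
    element H of \<open>Aspace\<close> represents it, and testing against H makes its norm
    vanish.\<close>
  define d where "d = (\<lambda>\<xi>. pos s \<xi> - pos g \<xi>)"
  have d2: "square_integrable lborel d"
    unfolding d_def by (intro square_integrable_diff L2Rpos_square_integrable s g)
  have pd: "pos d = d" by (auto simp: d_def pos_def indicator_def)
  have d: "L2Rpos d" by (rule square_integrable_L2Rpos[OF d2])
  obtain H where H: "H \<in> Aspace k" "\<And>z. snd z > 0 \<Longrightarrow> H z = Wmap k d z"
    using Wmap_Aspace[OF d] by blast
  have "ip lborel d d = 0"
    using form[OF T g H(1) d H(2)] Q H(1) by (simp add: pd d_def[symmetric])
  then have "sqn lborel d = 0" by (simp add: ip_self)
  from sqn_eq_0_AE[OF d2 this] have "AE \<xi> in lborel. pos g \<xi> = pos s \<xi>"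
    by eventually_elim (simp add: d_def)
  from Wmap_cong_AE[OF L2Rpos_measurable[OF g(1)] L2Rpos_measurable[OF s] this]
  show "snd z > 0 \<Longrightarrow> toep a k F z = Wmap k (\<lambda>\<xi>. spectral_symbol a k \<xi> * \<phi> \<xi>) z"
    by (simp add: g s_def)
qed

text \<open>The induction carries measurability rather than membership in \<open>Aspace\<close>: the
  zeroth iterate is \<open>Wmap k \<phi>\<close> itself, known to agree with an element of that
  space only for v > 0.\<close>

lemma toep_funpow_Wmap:
  assumes a: "a \<in> borel_measurable borel" and B: "\<And>v. v > 0 \<Longrightarrow> cmod (a v) \<le> B" and \<phi>: "L2Rpos \<phi>"
  shows "(toep a k ^^ i) (Wmap k \<phi>) \<in> borel_measurable borel \<and> L2Rpos (\<lambda>\<xi>. spectral_symbol a k \<xi> ^ i * \<phi> \<xi>) \<and>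
     (\<forall>z. snd z > 0 \<longrightarrow> (toep a k ^^ i) (Wmap k \<phi>) z = Wmap k (\<lambda>\<xi>. spectral_symbol a k \<xi> ^ i * \<phi> \<xi>) z)"
proof (induction i)
  case 0
  then show ?case using \<phi> by (auto intro: Wmap_measurable L2Rpos_measurable)
next
  case (Suc i)
  have "L2Rpos (\<lambda>\<xi>. spectral_symbol a k \<xi> * (spectral_symbol a k \<xi> ^ i * \<phi> \<xi>))"
    using Suc.IH
    by (intro L2Rpos_mult[where B=B and s="spectral_symbol a k"] spectral_symbol_measurable spectral_symbol_bound a B) auto
  then show ?case
    using toep_Wmap[OF a B, of "\<lambda>\<xi>. spectral_symbol a k \<xi> ^ i * \<phi> \<xi>" "(toep a k ^^ i) (Wmap k \<phi>)" k] Suc.IH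
    by (auto simp: mult.assoc Aspace_measurable)
qed

text \<open>Multiplication by powers of the bounded multiplier stays in \<open>L2Rpos\<close>, so
  each term is integrable against the atom and the finite sum may be taken inside.\<close>

lemma op_poly_Wmap:
  assumes a: "a \<in> borel_measurable borel" and B: "\<And>v. v > 0 \<Longrightarrow> cmod (a v) \<le> B" and \<phi>: "L2Rpos \<phi>"
    and z: "snd z > 0"
  shows "op_poly p (toep a k) (Wmap k \<phi>) z = Wmap k (\<lambda>\<xi>. poly p (spectral_symbol a k \<xi>) * \<phi> \<xi>) z"
proof -
  let ?s = "spectral_symbol a k"
  have i: "integrable lborel (\<lambda>\<xi>. pos (\<lambda>\<xi>. ?s \<xi> ^ i * \<phi> \<xi>) \<xi> * cnj (atom k z \<xi>))" for i
    using toep_funpow_Wmap[OF a B \<phi>] z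
    by (intro square_integrable_ip L2Rpos_square_integrable atom_integrable) auto
  have W: "Wmap k (\<lambda>\<xi>. ?s \<xi> ^ i * \<phi> \<xi>) z = (\<integral>\<xi>. pos (\<lambda>\<xi>. ?s \<xi> ^ i * \<phi> \<xi>) \<xi> * cnj (atom k z \<xi>) \<partial>lborel)" for i
    by (subst Wmap_pos[symmetric]) (simp only: Wmap_ip ip_def)
  have "op_poly p (toep a k) (Wmap k \<phi>) z = (\<Sum>i\<le>degree p. coeff p i * Wmap k (\<lambda>\<xi>. ?s \<xi> ^ i * \<phi> \<xi>) z)"
    unfolding op_poly_def using conjunct2[OF conjunct2[OF toep_funpow_Wmap[OF a B \<phi>]]] z
    by (intro sum.cong refl arg_cong2[where f="(*)"]) blast+
  also have "\<dots> = (\<Sum>i\<le>degree p. (\<integral>\<xi>. coeff p i * (pos (\<lambda>\<xi>. ?s \<xi> ^ i * \<phi> \<xi>) \<xi> * cnj (atom k z \<xi>)) \<partial>lborel))"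
    unfolding integral_mult_right_zero W ..
  also have "\<dots> = (\<integral>\<xi>. (\<Sum>i\<le>degree p. coeff p i * (pos (\<lambda>\<xi>. ?s \<xi> ^ i * \<phi> \<xi>) \<xi> * cnj (atom k z \<xi>))) \<partial>lborel)"
    by (intro Bochner_Integration.integral_sum[symmetric] integrable_mult_right i)
  also have "\<dots> = Wmap k (pos (\<lambda>\<xi>. poly p (?s \<xi>) * \<phi> \<xi>)) z"
    unfolding Wmap_ip ip_def
    by (intro Bochner_Integration.integral_cong) (auto simp: pos_def indicator_def poly_altdef sum_distrib_right sum_distrib_left mult_ac)
  finally show ?thesis by (simp only: Wmap_pos)
qed

text \<open>As L_0 = 1, the density is that of the exponential law of rate 2 \<xi>, and the average
  of the indicator is its distribution function at lam.\<close>

lemma spectral_symbol_indicator: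
  assumes lam: "lam > 0" and xi: "\<xi> > 0"
  shows "spectral_symbol (indicator {0..lam}) 0 \<xi> = complex_of_real (1 - exp (- 2 * lam * \<xi>))"
proof -
  have "((\<lambda>v. - exp (- 2 * \<xi> * v)) has_real_derivative 2 * \<xi> * exp (- 2 * \<xi> * v)) (at v)" for v
    by (auto intro!: derivative_eq_intros)
  then have F: "(\<integral>v. 2 * \<xi> * exp (- 2 * \<xi> * v) * indicat_real {0..lam} v \<partial>lborel) = - exp (- 2 * \<xi> * lam) - - exp (- 2 * \<xi> * 0)"
    using lam by (intro integral_FTC_Icc_real) (auto intro!: continuous_intros)
  have "spectral_symbol (indicator {0..lam}) 0 \<xi> = (\<integral>v. complex_of_real (indicat_real {0..lam} v * dens 0 \<xi> v) \<partial>lborel)"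
    unfolding spectral_symbol_def by (intro Bochner_Integration.integral_cong) (auto simp: indicator_def)
  also have "\<dots> = complex_of_real (\<integral>v. indicat_real {0..lam} v * dens 0 \<xi> v \<partial>lborel)"
    by (rule integral_complex_of_real)
  also have "(\<integral>v. indicat_real {0..lam} v * dens 0 \<xi> v \<partial>lborel) =
      (\<integral>v. 2 * \<xi> * exp (- 2 * \<xi> * v) * indicat_real {0..lam} v \<partial>lborel)"
  proof (rule integral_cong_AE)
    have e: "(ell 0 (2 * v * \<xi>))\<^sup>2 = exp (- 2 * \<xi> * v)" for v
      by (simp add: ell_square laguerre_def)
    show "AE v in lborel. indicat_real {0..lam} v * dens 0 \<xi> v = 2 * \<xi> * exp (- 2 * \<xi> * v) * indicat_real {0..lam} v"
      using AE_lborel_singleton[of "0::real"]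
    proof eventually_elim
      case (elim v)
      then show ?case using xi e[of v] by (auto simp: dens_def indicator_def)
    qed
  qed measurable
  finally show ?thesis unfolding F by (simp add: mult_ac)
qed

text \<open>At this point -(1 / lam) ln(1 - x) equals 2 \<xi>. It is the prefactor, v times it is
  the Laguerre argument, and the power becomes exp(-2 v \<xi>); together they form
  \<open>dens\<close>.\<close>

lemma nabla_spectral_symbol:
  assumes lam: "lam > 0" and xi: "\<xi> > 0"
  shows "nabla a lam k (1 - exp (- 2 * lam * \<xi>)) = spectral_symbol a k \<xi>"
proof -
  let ?x = "1 - exp (- 2 * lam * \<xi>)"
  have l: "ln (1 - ?x) = - 2 * lam * \<xi>" by simp
  have p: "(1 - ?x) powr (v / lam) = exp (- (2 * v * \<xi>))" for v
    using lam by (simp add: powr_def)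
  have r: "- (v / lam) * ln (1 - ?x) = 2 * v * \<xi>" for v using lam by (simp add: l)
  have c: "- (1 / lam) * ln (1 - ?x) = 2 * \<xi>" using lam by (simp add: l)
  show ?thesis
    unfolding nabla_def p r c spectral_symbol_def set_lebesgue_integral_def
      integral_mult_right_zero[symmetric]
    using xi by (intro Bochner_Integration.integral_cong)
      (auto simp: dens_def indicator_def ell_square)
qed

text \<open>The substitution t = 2 \<xi> v moves \<xi> out of the density and into the argument of
  a, so dominated convergence against a fixed density applies. One statement serves both endpoints:
  t / (2 X) tends to infinity or to 0 according to the behaviour of X.\<close>

lemma spectral_symbol_tendsto:
  assumes [measurable]: "a \<in> borel_measurable borel" and B: "\<And>v. v > 0 \<Longrightarrow> cmod (a v) \<le> B"
    and X: "\<And>n. X n > (0::real)" and lim: "\<And>t. t > 0 \<Longrightarrow> (\<lambda>n. a (t / (2 * X n))) \<longlonglongrightarrow> l"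
  shows "(\<lambda>n. spectral_symbol a k (X n)) \<longlonglongrightarrow> l"
proof -
  let ?e = "\<lambda>t. indicat_real {0<..} t * (ell k t)\<^sup>2"
  have e: "integrable lborel ?e" "integral\<^sup>L lborel ?e = 1"
    using ell_normalized[of k] by (auto simp: has_bochner_integral_iff)
  have eq: "spectral_symbol a k (X n) = (\<integral>t. a (t / (2 * X n)) * complex_of_real (?e t) \<partial>lborel)" for n
  proof -
    have "(\<integral>t. a (t / (2 * X n)) * complex_of_real (?e t) \<partial>lborel) =
      \<bar>2 * X n\<bar> *\<^sub>R (\<integral>v. a ((0 + (2 * X n) * v) / (2 * X n)) * complex_of_real (?e (0 + (2 * X n) * v)) \<partial>lborel)"
      using X[of n] by (intro lborel_integral_real_affine) simp
    also have "\<dots> = (\<integral>v. \<bar>2 * X n\<bar> *\<^sub>R (a ((0 + (2 * X n) * v) / (2 * X n)) * complex_of_real (?e (0 + (2 * X n) * v))) \<partial>lborel)"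
      by (rule integral_scaleR_right[symmetric])
    also have "\<dots> = spectral_symbol a k (X n)"
      unfolding spectral_symbol_def
    proof (intro Bochner_Integration.integral_cong refl)
      fix v
      show "\<bar>2 * X n\<bar> *\<^sub>R (a ((0 + (2 * X n) * v) / (2 * X n)) * complex_of_real (?e (0 + (2 * X n) * v))) =
         a v * complex_of_real (dens k (X n) v)"
        using X[of n] by (simp add: dens_def indicator_def zero_less_mult_iff scaleR_conv_of_real mult_ac)
    qed
    finally show ?thesis ..
  qed
  have "(\<lambda>n. \<integral>t. a (t / (2 * X n)) * complex_of_real (?e t) \<partial>lborel) \<longlonglongrightarrow> (\<integral>t. l * complex_of_real (?e t) \<partial>lborel)"
  proof (rule integral_dominated_convergence)
    show "integrable lborel (\<lambda>t. B * ?e t)" using e by simp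
    show "AE t in lborel. (\<lambda>n. a (t / (2 * X n)) * complex_of_real (?e t)) \<longlonglongrightarrow> l * complex_of_real (?e t)"
    proof (rule AE_I2)
      fix t :: real
      show "(\<lambda>n. a (t / (2 * X n)) * complex_of_real (?e t)) \<longlonglongrightarrow> l * complex_of_real (?e t)"
        by (cases "t > 0") (auto intro!: tendsto_mult lim)
    qed
    show "AE t in lborel. cmod (a (t / (2 * X n)) * complex_of_real (?e t)) \<le> B * ?e t" for n
    proof (rule AE_I2)
      fix t :: real
      show "cmod (a (t / (2 * X n)) * complex_of_real (?e t)) \<le> B * ?e t"
      proof (cases "t > 0")
        case True
        then show ?thesis using X[of n] by (auto simp: norm_mult norm_power intro!: mult_right_mono B)
      qed simp
    qed
  qed measurable
  also have "(\<integral>t. l * complex_of_real (?e t) \<partial>lborel) = l * complex_of_real (integral\<^sup>L lborel ?e)"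
    by (simp only: integral_mult_right_zero integral_complex_of_real)
  finally show ?thesis by (simp add: eq e)
qed

lemma continuous_on_ell: "continuous_on UNIV (ell k)"
  unfolding ell_def laguerre_def by (intro continuous_intros) auto

text \<open>Inside (0, oo) the function a is only measurable and bounded, so continuity has to come
  from the density, with an integrable majorant uniform in a neighbourhood of \<xi>.\<close>

lemma spectral_symbol_isCont:
  assumes [measurable]: "a \<in> borel_measurable borel" and B: "\<And>v. v > 0 \<Longrightarrow> cmod (a v) \<le> B"
    and xi: "\<xi> > 0"
  shows "isCont (spectral_symbol a k) \<xi>"
proof -
  obtain K where K: "K \<ge> 0" "\<And>t. t \<ge> 0 \<Longrightarrow> \<bar>ell k t\<bar> \<le> K * exp (- t / 4)" using ell_exp_bound by blast
  have B0: "0 \<le> B" using order_trans[OF norm_ge_zero B[of 1]] by simp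
  \<comment> \<open>The lower end c > 0 fixes the rate of exponential decay in v, and the upper end
    d bounds the factor 2 x.\<close>
  define c where "c = \<xi> / 2"
  define d where "d = 2 * \<xi>"
  have cd: "0 < c" "c < \<xi>" "\<xi> < d" using xi by (auto simp: c_def d_def)
  have bound: "cmod (a v * complex_of_real (dens k x v)) \<le> B * (2 * d * K\<^sup>2) * (indicat_real {0<..} v * exp (- c * v))"
    if "x \<in> {c..d}" for x v
  proof (cases "v > 0")
    case True
    have x: "c \<le> x" "x \<le> d" "0 < x" using that cd by auto
    have "\<bar>ell k (2 * v * x)\<bar>\<^sup>2 \<le> (K * exp (- (2 * v * x) / 4))\<^sup>2"
      using True x by (intro power_mono K) auto
    also have "\<dots> = K\<^sup>2 * exp (- (v * x))"
      by (simp add: power_mult_distrib exp_double[symmetric])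
    also have "\<dots> \<le> K\<^sup>2 * exp (- c * v)"
      using True x by (intro mult_left_mono) (auto simp: mult.commute)
    finally have "(ell k (2 * v * x))\<^sup>2 \<le> K\<^sup>2 * exp (- c * v)" by simp
    then have "2 * x * (ell k (2 * v * x))\<^sup>2 \<le> 2 * d * (K\<^sup>2 * exp (- c * v))"
      using x by (intro mult_mono) auto
    then have "cmod (a v) * (2 * x * (ell k (2 * v * x))\<^sup>2) \<le> B * (2 * d * (K\<^sup>2 * exp (- c * v)))"
      by (rule mult_mono[OF B[OF True]]) (use x B0 in auto)
    then show ?thesis using True x by (simp add: norm_mult norm_power dens_def mult.assoc)
  qed (simp add: dens_def)
  have "continuous_on {c..d} (spectral_symbol a k)"
    unfolding continuous_on_sequentially
  proof (intro allI ballI impI, elim conjE)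
    fix X x assume x: "x \<in> {c..d}" and X: "\<forall>n. X n \<in> {c..d}" and lim: "X \<longlonglongrightarrow> x"
    show "(spectral_symbol a k \<circ> X) \<longlonglongrightarrow> spectral_symbol a k x"
      unfolding spectral_symbol_def comp_def
    proof (rule integral_dominated_convergence)
      show "integrable lborel (\<lambda>v. B * (2 * d * K\<^sup>2) * (indicat_real {0<..} v * exp (- c * v)))"
        by (intro integrable_mult_right exp_integrable_Ioi cd)
      show "AE v in lborel. cmod (a v * complex_of_real (dens k (X n) v)) \<le> B * (2 * d * K\<^sup>2) * (indicat_real {0<..} v * exp (- c * v))" for n
        using bound X by (intro AE_I2) auto
      show "AE v in lborel. (\<lambda>n. a v * complex_of_real (dens k (X n) v)) \<longlonglongrightarrow> a v * complex_of_real (dens k x v)"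
      proof (rule AE_I2)
        fix v
        have pos: "X n > 0" "x > 0" for n using X x cd by (auto intro: less_le_trans)
        have "(\<lambda>n. ell k (2 * v * X n)) \<longlonglongrightarrow> ell k (2 * v * x)"
          using continuous_on_ell[of k] lim
          by (intro isCont_tendsto_compose[of "2 * v * x" "ell k"] tendsto_intros) (auto simp: continuous_on_eq_continuous_at)
        then have "(\<lambda>n. indicat_real {0<..} v * (2 * X n * (ell k (2 * v * X n))\<^sup>2)) \<longlonglongrightarrow> indicat_real {0<..} v * (2 * x * (ell k (2 * v * x))\<^sup>2)"
          using lim by (intro tendsto_intros)
        then have "(\<lambda>n. dens k (X n) v) \<longlonglongrightarrow> dens k x v" using pos by (simp add: dens_def)
        then show "(\<lambda>n. a v * complex_of_real (dens k (X n) v)) \<longlonglongrightarrow> a v * complex_of_real (dens k x v)"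
          by (intro tendsto_intros)
      qed
    qed measurable
  qed
  then show ?thesis by (rule continuous_on_interior) (use cd in auto)
qed

section \<open>Uniform polynomial approximation on [0, 1] and strong convergence\<close>

section \<open>The functional calculus\<close>

lemma Wmap_diff:
  assumes "L2Rpos f" "L2Rpos g" "snd z > 0"
  shows "Wmap k (\<lambda>\<xi>. f \<xi> - g \<xi>) z = Wmap k f z - Wmap k g z"
proof -
  have "pos (\<lambda>\<xi>. f \<xi> - g \<xi>) = (\<lambda>\<xi>. pos f \<xi> - pos g \<xi>)" by (auto simp: pos_def scaleR_diff_right)
  then have "Wmap k (pos (\<lambda>\<xi>. f \<xi> - g \<xi>)) z = Wmap k (pos f) z - Wmap k (pos g) z"
    unfolding Wmap_ip using assms
    by (simp add: ip_diff_left L2Rpos_square_integrable atom_integrable)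
  then show ?thesis by (simp only: Wmap_pos)
qed

lemma poly_measurable:
  fixes p :: "complex poly"
  assumes [measurable]: "s \<in> borel_measurable M"
  shows "(\<lambda>x. poly p (s x)) \<in> borel_measurable M"
  unfolding poly_altdef by measurable

text \<open>A crude bound is enough: it serves only to keep products with polynomial multipliers in
  \<open>L2Rpos\<close>.\<close>

lemma norm_poly_le:
  fixes p :: "complex poly"
  assumes "cmod z \<le> 1"
  shows "cmod (poly p z) \<le> (\<Sum>i\<le>degree p. cmod (coeff p i))"
  unfolding poly_altdef using assms
  by (intro order_trans[OF norm_sum sum_mono]) (auto simp: norm_mult norm_power intro!: mult_right_le_one_le power_le_one)

text \<open>Only the multiplier on (0, oo) counts, and that is where uniform convergence on [0, 1]
  controls it.\<close>

lemma sqn_pos_mult_le: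
  assumes \<phi>: "L2Rpos \<phi>" and s: "s \<in> borel_measurable borel" and e: "\<And>\<xi>. \<xi> > 0 \<Longrightarrow> cmod (s \<xi>) \<le> e"
  shows "sqn lborel (pos (\<lambda>\<xi>. s \<xi> * \<phi> \<xi>)) \<le> e\<^sup>2 * sqn lborel (pos \<phi>)"
proof -
  have "sqn lborel (pos (\<lambda>\<xi>. s \<xi> * \<phi> \<xi>)) \<le> (\<integral>\<xi>. e\<^sup>2 * (cmod (pos \<phi> \<xi>))\<^sup>2 \<partial>lborel)"
    unfolding sqn_def
  proof (rule integral_mono)
    show "integrable lborel (\<lambda>\<xi>. (cmod (pos (\<lambda>\<xi>. s \<xi> * \<phi> \<xi>) \<xi>))\<^sup>2)"
      using L2Rpos_square_integrable[OF L2Rpos_mult[OF \<phi> s e]] by (simp add: square_integrable_def)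
    show "integrable lborel (\<lambda>\<xi>. e\<^sup>2 * (cmod (pos \<phi> \<xi>))\<^sup>2)"
      using L2Rpos_square_integrable[OF \<phi>] by (simp add: square_integrable_def)
    fix \<xi> :: real
    show "(cmod (pos (\<lambda>\<xi>. s \<xi> * \<phi> \<xi>) \<xi>))\<^sup>2 \<le> e\<^sup>2 * (cmod (pos \<phi> \<xi>))\<^sup>2"
      using e[of \<xi>] by (cases "\<xi> > 0")
        (auto simp: pos_def norm_mult power_mult_distrib intro!: mult_right_mono power_mono)
  qed
  then show ?thesis by (simp add: sqn_def)
qed

text \<open>The endpoints are exchanged: as x tends to 0 so does \<xi>, the density in v, of width
  about 1 / \<xi>, spreads to infinity and the limit of a there is picked up. As x tends to 1, \<xi>
  tends to infinity, the mass concentrates at v = 0 and the limit of a at 0 appears.\<close>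

lemma nabla_extension:
  assumes lam: "lam > 0" and a: "a \<in> borel_measurable borel" and B: "\<And>v. v > 0 \<Longrightarrow> cmod (a v) \<le> B"
    and l0: "(a \<longlongrightarrow> l0) (at_right 0)" and linf: "(a \<longlongrightarrow> linf) at_top"
  shows "continuous_on {0..1} (\<lambda>x. if x = 0 then linf else if x = 1 then l0 else nabla a lam k x)"
    (is "continuous_on _ ?N")
proof (rule continuous_on_IccI)
  \<comment> \<open>The inverse of \<xi> \<mapsto> 1 - exp(-2 lam \<xi>) on (0, 1).\<close>
  define \<xi> where "\<xi> = (\<lambda>x. - ln (1 - x) / (2 * lam))"
  have \<xi>_pos: "\<xi> x > 0" if "0 < x" "x < 1" for x
    using that lam by (simp add: \<xi>_def divide_neg_pos)
  have N: "?N x = spectral_symbol a k (\<xi> x)" if "0 < x" "x < 1" for x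
  proof -
    have "1 - exp (- 2 * lam * \<xi> x) = x" using that lam by (simp add: \<xi>_def)
    then show ?thesis using nabla_spectral_symbol[OF lam \<xi>_pos[OF that], of a k] that by simp
  qed
  show "?N \<midarrow>x\<rightarrow> ?N x" if x: "0 < x" "x < 1" for x
  proof -
    have "isCont \<xi> x" unfolding \<xi>_def using x lam by (intro continuous_intros) auto
    then have "isCont (\<lambda>x. spectral_symbol a k (\<xi> x)) x"
      by (rule isCont_o2) (rule spectral_symbol_isCont[OF a B \<xi>_pos[OF x]])
    then have "(\<lambda>x. spectral_symbol a k (\<xi> x)) \<midarrow>x\<rightarrow> ?N x" by (simp add: isCont_def N[OF x])
    then show ?thesis
      by (rule Lim_transform_within_open[where s="{0<..<1}"]) (use x N in auto)
  qed
  have "(?N \<longlongrightarrow> linf) (at_right 0)"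
  proof (rule tendsto_at_right_sequentially[of 0 1])
    fix S :: "nat \<Rightarrow> real" assume S: "\<And>n. 0 < S n" "\<And>n. S n < 1" "S \<longlonglongrightarrow> 0"
    have "(\<lambda>n. \<xi> (S n)) \<longlonglongrightarrow> - ln (1 - 0) / (2 * lam)"
      unfolding \<xi>_def using lam by (intro tendsto_intros S) auto
    then have X: "(\<lambda>n. \<xi> (S n)) \<longlonglongrightarrow> 0" by simp
    have "(\<lambda>n. spectral_symbol a k (\<xi> (S n))) \<longlonglongrightarrow> linf"
    proof (rule spectral_symbol_tendsto[OF a B \<xi>_pos[OF S(1,2)]])
      fix t :: real assume t: "t > 0"
      have "(\<lambda>n. 2 * \<xi> (S n)) \<longlonglongrightarrow> 0" using tendsto_mult_left[OF X, of 2] by simp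
      then have "filterlim (\<lambda>n. t / (2 * \<xi> (S n))) at_top sequentially"
        using \<xi>_pos[OF S(1,2)] t
        by (intro LIM_at_top_divide[OF tendsto_const]) auto
      then show "(\<lambda>n. a (t / (2 * \<xi> (S n)))) \<longlonglongrightarrow> linf" by (rule filterlim_compose[OF linf])
    qed
    then show "(\<lambda>n. ?N (S n)) \<longlonglongrightarrow> linf" using N[OF S(1,2)] by simp
  qed simp
  then show "(?N \<longlongrightarrow> ?N 0) (at_right 0)" by simp
  have "(?N \<longlongrightarrow> l0) (at_left 1)"
  proof (rule tendsto_at_left_sequentially[of 0 1])
    fix S :: "nat \<Rightarrow> real" assume S: "\<And>n. S n < 1" "\<And>n. 0 < S n" "S \<longlonglongrightarrow> 1"
    have "(\<lambda>n. 1 - S n) \<longlonglongrightarrow> 1 - 1" by (intro tendsto_intros S)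
    then have "filterlim (\<lambda>n. 1 - S n) (at_right 0) sequentially"
      using S by (intro tendsto_imp_filterlim_at_right) auto
    then have "filterlim (\<lambda>n. ln (1 - S n)) at_bot sequentially" by (rule filterlim_compose[OF ln_at_0])
    then have "filterlim (\<lambda>n. - ln (1 - S n)) at_top sequentially" by (simp add: filterlim_uminus_at_top)
    then have X: "filterlim (\<lambda>n. (1 / (2 * lam)) * - ln (1 - S n)) at_top sequentially"
      using lam by (intro filterlim_tendsto_pos_mult_at_top[OF tendsto_const]) auto
    have "(\<lambda>n. spectral_symbol a k (\<xi> (S n))) \<longlonglongrightarrow> l0"
    proof (rule spectral_symbol_tendsto[OF a B \<xi>_pos[OF S(2,1)]])
      fix t :: real assume t: "t > 0"
      have "filterlim (\<lambda>n. 2 * \<xi> (S n)) at_top sequentially"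
        using filterlim_tendsto_pos_mult_at_top[OF tendsto_const[of 2] _ X] by (simp add: \<xi>_def)
      then have "(\<lambda>n. t / (2 * \<xi> (S n))) \<longlonglongrightarrow> 0"
        by (intro tendsto_divide_0[OF tendsto_const] filterlim_at_top_imp_at_infinity)
      then have "filterlim (\<lambda>n. t / (2 * \<xi> (S n))) (at_right 0) sequentially"
        using t \<xi>_pos[OF S(2,1)] by (intro tendsto_imp_filterlim_at_right) auto
      then show "(\<lambda>n. a (t / (2 * \<xi> (S n)))) \<longlonglongrightarrow> l0" by (rule filterlim_compose[OF l0])
    qed
    then show "(\<lambda>n. ?N (S n)) \<longlonglongrightarrow> l0" using N[OF S(2,1)] by simp
  qed simp
  then show "(?N \<longlongrightarrow> ?N 1) (at_left 1)" by simp
qed simp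

text \<open>The continuous functional calculus is expressed by its defining property: N(T) is the
  strong limit of p_n(T) for every sequence of polynomials converging uniformly to N on [0, 1]. The
  two operators act on different spaces, so \<open>\<psi>\<close> records the common result on the
  half-line.\<close>

theorem mainTheorem11:
  fixes a :: "real \<Rightarrow> complex" and lam :: real and k :: nat
  assumes "lam > 0" and "Linf0inf a"
  shows "\<exists>N. continuous_on {0..1} N \<and> (\<forall>x\<in>{0<..<1}. N x = nabla a lam k x) \<and>
    (\<forall>\<phi>. L2Rpos \<phi> \<longrightarrow>
      (\<exists>\<psi>. L2Rpos \<psi> \<and>
         (AE z in nuG. toep a k (Wmap k \<phi>) z = Wmap k \<psi> z) \<and>
         (\<forall>p :: nat \<Rightarrow> complex poly.
            uniform_limit {0..1} (\<lambda>n x. poly (p n) (complex_of_real x)) N sequentially \<longrightarrow>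
            (\<lambda>n. sqnormG (\<lambda>z. op_poly (p n) (toep (indicator {0..lam}) 0) (Wmap 0 \<phi>) z
                               - Wmap 0 \<psi> z)) \<longlonglongrightarrow> 0)))"
proof -
  have a: "a \<in> borel_measurable borel" using assms(2) by (simp add: Linf0inf_def)
  obtain B where B: "\<And>v. v > 0 \<Longrightarrow> cmod (a v) \<le> B"
    using assms(2) by (auto simp: Linf0inf_def bounded_iff)
  obtain l0 linf where l: "(a \<longlongrightarrow> l0) (at_right 0)" "(a \<longlongrightarrow> linf) at_top"
    using assms(2) by (auto simp: Linf0inf_def)
  define N where "N = (\<lambda>x. if x = 0 then linf else if x = 1 then l0 else nabla a lam k x)"
  define \<sigma> where "\<sigma> = spectral_symbol a k"
  define \<sigma>0 where "\<sigma>0 = spectral_symbol (indicator {0..lam}) 0"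
  have ind: "(indicator {0..lam} :: real \<Rightarrow> complex) \<in> borel_measurable borel"
    "cmod (indicator {0..lam} v) \<le> 1" for v by (auto simp: indicator_def)
  have \<sigma>m: "\<sigma> \<in> borel_measurable borel" "\<And>\<xi>. cmod (\<sigma> \<xi>) \<le> B"
    unfolding \<sigma>_def by (intro spectral_symbol_measurable spectral_symbol_bound a B; assumption?)+
  have \<sigma>0m: "\<sigma>0 \<in> borel_measurable borel" "\<And>\<xi>. cmod (\<sigma>0 \<xi>) \<le> 1"
    unfolding \<sigma>0_def by (intro spectral_symbol_measurable spectral_symbol_bound ind)+
  \<comment> \<open>The value of the first multiplier is a point of [0, 1] at which N gives the
    second multiplier. A uniform estimate on [0, 1] thus becomes a uniform estimate for the
    multipliers on (0, oo).\<close>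
  have N\<sigma>: "\<exists>x\<in>{0..1}. \<sigma>0 \<xi> = complex_of_real x \<and> \<sigma> \<xi> = N x" if "\<xi> > 0" for \<xi>
  proof (intro bexI conjI)
    have x: "1 - exp (- 2 * lam * \<xi>) \<in> {0<..<1}"
      using assms(1) that by (simp add: zero_less_mult_iff)
    show "\<sigma>0 \<xi> = complex_of_real (1 - exp (- 2 * lam * \<xi>))"
      unfolding \<sigma>0_def by (rule spectral_symbol_indicator[OF assms(1) that])
    show "\<sigma> \<xi> = N (1 - exp (- 2 * lam * \<xi>))"
      using nabla_spectral_symbol[OF assms(1) that, of a k] x that assms(1) by (simp add: \<sigma>_def N_def)
    show "1 - exp (- 2 * lam * \<xi>) \<in> {0..1}" using x by simp
  qed
  have limit: "(\<lambda>n. sqnormG (\<lambda>z. op_poly (p n) (toep (indicator {0..lam}) 0) (Wmap 0 \<phi>) z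
      - Wmap 0 (\<lambda>\<xi>. \<sigma> \<xi> * \<phi> \<xi>) z)) \<longlonglongrightarrow> 0"
    if \<phi>: "L2Rpos \<phi>" and ul: "uniform_limit {0..1} (\<lambda>n x. poly (p n) (complex_of_real x)) N sequentially"
    for \<phi> and p :: "nat \<Rightarrow> complex poly"
  proof -
    define D where "D = (\<lambda>n \<xi>. poly (p n) (\<sigma>0 \<xi>) - \<sigma> \<xi>)"
    let ?S = "sqn lborel (pos \<phi>)"
    have Dm: "D n \<in> borel_measurable borel" for n
      unfolding D_def by (intro borel_measurable_diff poly_measurable \<sigma>m \<sigma>0m)
    have L: "L2Rpos (\<lambda>\<xi>. poly (p n) (\<sigma>0 \<xi>) * \<phi> \<xi>)" "L2Rpos (\<lambda>\<xi>. \<sigma> \<xi> * \<phi> \<xi>)" for n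
      by (rule L2Rpos_mult[OF \<phi> poly_measurable[OF \<sigma>0m(1)] norm_poly_le[OF \<sigma>0m(2)]])
        (rule L2Rpos_mult[OF \<phi> \<sigma>m])
    have DL: "L2Rpos (\<lambda>\<xi>. D n \<xi> * \<phi> \<xi>)" for n
    proof (rule L2Rpos_mult[OF \<phi> Dm])
      show "cmod (D n \<xi>) \<le> (\<Sum>i\<le>degree (p n). cmod (coeff (p n) i)) + B" for \<xi>
        unfolding D_def by (rule norm_triangle_le_diff add_mono norm_poly_le \<sigma>m \<sigma>0m)+
    qed
    \<comment> \<open>The outputs of \<open>toep\<close> are known only for v > 0, so the two
      functions are compared almost everywhere; the isometry then turns the norm on the half-plane
      into one on the half-line.\<close>
    have eq: "sqnormG (\<lambda>z. op_poly (p n) (toep (indicator {0..lam}) 0) (Wmap 0 \<phi>) z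
        - Wmap 0 (\<lambda>\<xi>. \<sigma> \<xi> * \<phi> \<xi>) z) = ennreal (sqn lborel (pos (\<lambda>\<xi>. D n \<xi> * \<phi> \<xi>)))" for n
    proof -
      have "AE z in nuG. op_poly (p n) (toep (indicator {0..lam}) 0) (Wmap 0 \<phi>) z
         - Wmap 0 (\<lambda>\<xi>. \<sigma> \<xi> * \<phi> \<xi>) z = Wmap 0 (\<lambda>\<xi>. D n \<xi> * \<phi> \<xi>) z"
        using AE_nuG
      proof eventually_elim
        case (elim z)
        show ?case
          unfolding op_poly_Wmap[OF ind \<phi> elim] \<sigma>0_def[symmetric] Wmap_diff[OF L elim, symmetric]
          by (simp add: D_def left_diff_distrib)
      qed
      then have "AE z in nuG. ennreal ((cmod (op_poly (p n) (toep (indicator {0..lam}) 0) (Wmap 0 \<phi>) z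
         - Wmap 0 (\<lambda>\<xi>. \<sigma> \<xi> * \<phi> \<xi>) z))\<^sup>2) = ennreal ((cmod (Wmap 0 (\<lambda>\<xi>. D n \<xi> * \<phi> \<xi>) z))\<^sup>2)"
        by eventually_elim simp
      then show ?thesis
        unfolding sqnormG_def Wmap_isometry_nn[OF DL, of 0, symmetric] by (rule nn_integral_cong_AE)
    qed
    have "(\<lambda>n. sqn lborel (pos (\<lambda>\<xi>. D n \<xi> * \<phi> \<xi>))) \<longlonglongrightarrow> 0"
    proof (rule order_tendstoI)
      fix \<epsilon> :: real assume "\<epsilon> > 0"
      have S: "?S \<ge> 0" by simp
      \<comment> \<open>Adding 1 keeps the denominator positive when the norm of
        \<open>\<phi>\<close> is 0 and makes the resulting inequality strict.\<close>
      define e where "e = sqrt (\<epsilon> / (?S + 1))"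
      have e: "e > 0" "e\<^sup>2 * ?S < \<epsilon>"
        using \<open>\<epsilon> > 0\<close> S unfolding e_def by (auto simp: field_simps add_pos_nonneg)
      have "\<forall>\<^sub>F n in sequentially. \<forall>x\<in>{0..1}. dist (poly (p n) (complex_of_real x)) (N x) < e"
        using uniform_limitD[OF ul e(1)] .
      then show "\<forall>\<^sub>F n in sequentially. sqn lborel (pos (\<lambda>\<xi>. D n \<xi> * \<phi> \<xi>)) < \<epsilon>"
      proof eventually_elim
        case (elim n)
        have "cmod (D n \<xi>) \<le> e" if "\<xi> > 0" for \<xi>
          using N\<sigma>[OF that] elim by (force simp: D_def dist_norm)
        from sqn_pos_mult_le[OF \<phi> Dm this] e(2) show ?case by simp
      qed
    qed (auto intro!: always_eventually less_le_trans[OF _ sqn_nonneg])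
    then have "(\<lambda>n. ennreal (sqn lborel (pos (\<lambda>\<xi>. D n \<xi> * \<phi> \<xi>)))) \<longlonglongrightarrow> ennreal 0"
      by (rule tendsto_ennrealI)
    then show ?thesis unfolding eq by simp
  qed
  show ?thesis
  proof (rule exI[of _ N], intro conjI allI impI)
    show "continuous_on {0..1} N" unfolding N_def by (rule nabla_extension[OF assms(1) a B l])
    show "\<forall>x\<in>{0<..<1}. N x = nabla a lam k x" by (auto simp: N_def)
    fix \<phi> assume \<phi>: "L2Rpos \<phi>"
    \<comment> \<open>The witness depends on \<open>\<phi>\<close> and a but not on the polynomials,
      as the order of quantifiers demands.\<close>
    let ?\<psi> = "\<lambda>\<xi>. \<sigma> \<xi> * \<phi> \<xi>"
    have "L2Rpos ?\<psi>" by (rule L2Rpos_mult[OF \<phi> \<sigma>m])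
    moreover have "AE z in nuG. toep a k (Wmap k \<phi>) z = Wmap k ?\<psi> z"
      using AE_nuG
    proof eventually_elim
      case (elim z)
      show ?case
        unfolding \<sigma>_def using elim
        by (intro toep_Wmap(2)[OF a B \<phi> Wmap_measurable[OF L2Rpos_measurable[OF \<phi>]]]) auto
    qed
    ultimately show "\<exists>\<psi>. L2Rpos \<psi> \<and> (AE z in nuG. toep a k (Wmap k \<phi>) z = Wmap k \<psi> z) \<and>
         (\<forall>p :: nat \<Rightarrow> complex poly.
            uniform_limit {0..1} (\<lambda>n x. poly (p n) (complex_of_real x)) N sequentially \<longrightarrow>
            (\<lambda>n. sqnormG (\<lambda>z. op_poly (p n) (toep (indicator {0..lam}) 0) (Wmap 0 \<phi>) z
                               - Wmap 0 \<psi> z)) \<longlonglongrightarrow> 0)"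
      using limit[OF \<phi>] by (intro exI[of _ ?\<psi>]) blast
  qed
qed

end
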